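(* Let $n\ge2$ and let $M\subset\mathbb R^n$ be an origin-symmetric star-shaped body such that $\|x\|_M^{-1}$ is a positive definite distribution. Then for any origin-symmetric star-shaped bodies $K,L\subset\mathbb R^n$ such that, for every $\xi\in S^{n-1}$, $$\mathrm{Vol}_{n-1}(K\cap\xi^\perp)\le\mathrm{Vol}_{n-1}(L\cap\xi^\perp),$$ we have $$\int_K\|x\|_M^{-1}\,dx\le\int_L\|x\|_M^{-1}\,dx.$$
   Context: $\xi^\perp$ is the hyperplane through the origin orthogonal to $\xi$. A star-shaped body is a compact set with non-empty interior that is star-shaped with respect to the origin. The Minkowski functional of $M$ is $\|x\|_M=\min\{a>0: x\in aM\}$. The Fourier transform of a tempered distribution $f$ is defined by $\langle\hat f,\phi\rangle=\langle f,\hat\phi\rangle$ for Schwartz functions $\phi$, with $\hat\phi(\xi)=\int\phi(x)e^{-i(x,\xi)}dx$. A distribution $f$ is positive definite iff $\langle\hat f,\phi\rangle\ge0$ for every nonnegative Schwartz function $\phi$. *)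

theory Defs
  imports "HOL-Analysis.Analysis"
begin

section \<open>Star-shaped bodies\<close>

definition star_body :: "'a::euclidean_space set \<Rightarrow> bool" where
  "star_body M \<longleftrightarrow>
     compact M \<and> interior M \<noteq> {} \<and> 0 \<in> M \<and> (\<forall>x\<in>M. closed_segment 0 x \<subseteq> M)"

definition origin_symmetric :: "'a::euclidean_space set \<Rightarrow> bool" where
  "origin_symmetric M \<longleftrightarrow> uminus ` M = M"

text \<open>
  The origin need not be interior to a star-shaped body, so a ray may meet \<open>M\<close> only in \<open>0\<close>; the
  functional is then \<open>\<infinity>\<close>. For \<open>x \<noteq> 0\<close> on any other ray the infimum is attained. At \<open>x = 0\<close> no
  minimum exists and the infimum is \<open>0\<close>.
\<close>

definition minkowski_functional :: "'a::euclidean_space set \<Rightarrow> 'a \<Rightarrow> ennreal" where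
  "minkowski_functional M x = Inf {ennreal a | a. 0 < a \<and> x \<in> (\<lambda>y. a *\<^sub>R y) ` M}"


section \<open>Lebesgue measure on a linear subspace\<close>

definition orthonormal_basis_of :: "'a::euclidean_space set \<Rightarrow> 'a set \<Rightarrow> bool" where
  "orthonormal_basis_of S B \<longleftrightarrow>
     B \<subseteq> S \<and> pairwise orthogonal B \<and> (\<forall>b\<in>B. norm b = 1) \<and> span B = S"

text \<open>
  The same construction as \<^const>\<open>lborel\<close>, with an orthonormal basis of the subspace in place of
  \<^const>\<open>Basis\<close>. The measure does not depend on the choice of the basis; it lives on the ambient
  Borel sets and is concentrated on \<open>S\<close>.
\<close>

definition subspace_lborel :: "'a::euclidean_space set \<Rightarrow> 'a measure" where
  "subspace_lborel S =
     (let B = (SOME B. orthonormal_basis_of S B)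
      in distr (\<Pi>\<^sub>M b\<in>B. lborel) borel (\<lambda>f. \<Sum>b\<in>B. f b *\<^sub>R b))"

definition orth_hyperplane :: "'a::euclidean_space \<Rightarrow> 'a set" where
  "orth_hyperplane \<xi> = {x. \<xi> \<bullet> x = 0}"

definition section_volume :: "'a::euclidean_space set \<Rightarrow> 'a \<Rightarrow> ennreal" where
  "section_volume K \<xi> = emeasure (subspace_lborel (orth_hyperplane \<xi>)) (K \<inter> orth_hyperplane \<xi>)"


section \<open>Schwartz functions and positive definite distributions\<close>

primrec iterated_partial ::
    "'a::euclidean_space list \<Rightarrow> ('a \<Rightarrow> complex) \<Rightarrow> 'a \<Rightarrow> complex" where
  "iterated_partial [] \<phi> = \<phi>"
| "iterated_partial (b # bs) \<phi> = (\<lambda>x. frechet_derivative (iterated_partial bs \<phi>) (at x) b)"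

text \<open>
  Differentiability of all iterated partial derivatives is smoothness. Weighting by the powers of
  the norm is equivalent to weighting by all monomials in the coordinates.
\<close>

definition schwartz :: "('a::euclidean_space \<Rightarrow> complex) \<Rightarrow> bool" where
  "schwartz \<phi> \<longleftrightarrow>
     (\<forall>bs. set bs \<subseteq> Basis \<longrightarrow>
        (\<forall>x. iterated_partial bs \<phi> differentiable (at x)) \<and>
        (\<forall>k::nat. bounded (range (\<lambda>x. norm x ^ k *\<^sub>R iterated_partial bs \<phi> x))))"

definition fourier :: "('a::euclidean_space \<Rightarrow> complex) \<Rightarrow> 'a \<Rightarrow> complex" where
  "fourier \<phi> \<xi> = (LINT x|lborel. \<phi> x * exp (- \<i> * complex_of_real (x \<bullet> \<xi>)))"

text \<open>
  Distributions are represented by their action on test functions; only the values on Schwartz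
  functions matter.
\<close>

type_synonym 'a distribution = "('a \<Rightarrow> complex) \<Rightarrow> complex"

definition function_distribution :: "('a::euclidean_space \<Rightarrow> real) \<Rightarrow> 'a distribution" where
  "function_distribution f \<phi> = (LINT x|lborel. complex_of_real (f x) * \<phi> x)"

definition fourier_distribution :: "'a::euclidean_space distribution \<Rightarrow> 'a distribution" where
  "fourier_distribution T \<phi> = T (fourier \<phi>)"

definition positive_definite :: "'a::euclidean_space distribution \<Rightarrow> bool" where
  "positive_definite T \<longleftrightarrow>
     (\<forall>\<phi>. schwartz \<phi> \<and> (\<forall>x. \<phi> x \<in> \<real>\<^sub>\<ge>\<^sub>0) \<longrightarrow> fourier_distribution T \<phi> \<in> \<real>\<^sub>\<ge>\<^sub>0)"

end

theory Submission
  imports Defs "HOL-Probability.Probability"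
begin

text \<open>
  Write \<open>f = \<parallel>x\<parallel>\<^sub>M\<^bsup>-1\<^esup>\<close>, which is even and homogeneous of degree \<open>-1\<close>. For compact \<open>C\<close> let \<open>\<rho>\<^sub>C\<close> be the
  image of \<open>1\<^sub>C(y) exp (- s\<^sup>2|y|\<^sup>2/2) ds dy\<close> under \<open>(s, y) \<mapsto> s y\<close>. Its Fourier transform at \<open>\<xi>\<close> is
  \<open>2\<pi> \<integral> gauss \<eta> Vol (C \<inter> (\<xi>+\<eta>)\<^sup>\<bottom>) / |\<xi>+\<eta>| d\<eta>\<close>, so the assumption on the sections gives
  \<open>\<rho>\<^sub>K\<^sup>^ \<le> \<rho>\<^sub>L\<^sup>^\<close>. Hence \<open>(exp (- \<epsilon>\<^sup>2|\<xi>|\<^sup>2/2) - exp (- 2\<epsilon>\<^sup>2|\<xi>|\<^sup>2)) (\<rho>\<^sub>L\<^sup>^ - \<rho>\<^sub>K\<^sup>^)\<close> is a nonnegative Schwartz function.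
  Testing the positive definite \<open>f\<close> with it gives \<open>\<integral> (F\<^sub>\<epsilon> - F\<^bsub>2\<epsilon>\<^esub>) d\<rho>\<^sub>K \<le> \<integral> (F\<^sub>\<epsilon> - F\<^bsub>2\<epsilon>\<^esub>) d\<rho>\<^sub>L\<close>, where
  \<open>F\<^sub>\<epsilon>\<close> is the convolution of \<open>f\<close> with the Gaussian of width \<open>\<epsilon>\<close>. By homogeneity the integral against \<open>\<rho>\<^sub>C\<close> equals
  \<open>\<integral>\<integral> 1\<^sub>C(y) (exp (- s\<^sup>2|y|\<^sup>2/2) - exp (- 2s\<^sup>2|y|\<^sup>2)) F\<^sub>\<epsilon>(s y) ds dy\<close>, which tends to a positive multiple
  of \<open>\<integral>\<^sub>C f\<close> as \<open>\<epsilon> \<rightarrow> 0\<close>.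
\<close>

section \<open>Gaussians\<close>

text \<open>Without its Gaussian weight, \<rho>_C is homogeneous of degree 1-n and its transform is
  2\<pi> Vol (C \<inter> \<xi>^\<bottom>) / |\<xi>|. That is singular at 0, so no Gaussian multiple
  of it is a test function. Damping by exp (-|x|^2/2) at x = s y gives a finite measure with all
  moments and a smooth transform. The price is an average over \<eta> with nonnegative weights,
  which keeps inequalities between sections. The parameters (s, y) stand in for polar coordinates:
  integrals over spheres become Fubini on a product. The product f \<rho>_C has degree -n, so its
  integral diverges logarithmically at the origin, and one Gaussian width alone has no finite limit
  in general. Passing from \<epsilon> to 2\<epsilon> is a dilation, F_{2\<epsilon>}(2x) =
  F_\<epsilon>(x)/2, so the difference of the two widths cancels the divergence. Since f may be
  discontinuous (it vanishes on rays that meet M only in 0), the limit \<epsilon> \<rightarrow> 0 is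
  taken weakly, against continuous approximations of 1_C. The error is controlled by a bound
  F_\<epsilon>(x) \<le> const/|x| that does not depend on \<epsilon>.\<close>

lemma nn_integral_lborel_affine:
  fixes h :: "'a::euclidean_space \<Rightarrow> ennreal"
  assumes [measurable]: "h \<in> borel_measurable borel" and "c \<noteq> 0"
  shows "(\<integral>\<^sup>+x. h x \<partial>lborel) = ennreal (\<bar>c\<bar> ^ DIM('a)) * (\<integral>\<^sup>+x. h (t + c *\<^sub>R x) \<partial>lborel)"
  by (subst lborel_affine[OF \<open>c \<noteq> 0\<close>, of t])
     (simp add: nn_integral_density nn_integral_distr nn_integral_cmult)

lemma integral_lborel_affine:
  fixes h :: "'a::euclidean_space \<Rightarrow> 'b::{banach, second_countable_topology}"
  assumes [measurable]: "h \<in> borel_measurable borel" and "c \<noteq> 0"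
  shows "(LBINT x. h x) = (\<bar>c\<bar> ^ DIM('a)) *\<^sub>R (LBINT x. h (t + c *\<^sub>R x))"
  by (subst lborel_affine[OF \<open>c \<noteq> 0\<close>, of t])
     (simp add: integral_density integral_distr)

definition gauss :: "'a::euclidean_space \<Rightarrow> real" where
  "gauss x = (1 / sqrt (2 * pi)) ^ DIM('a) * exp (- (norm x)\<^sup>2 / 2)"

lemma gauss_nonneg [simp]: "0 \<le> gauss x"
  by (simp add: gauss_def)

lemma gauss_uminus [simp]: "gauss (- x) = gauss x"
  by (simp add: gauss_def)

lemma gauss_measurable [measurable]: "gauss \<in> borel_measurable borel"
  unfolding gauss_def by measurable

lemma gauss_le_1: "gauss x \<le> 1"
proof -
  have "1 \<le> sqrt (2 * pi)" using pi_gt3 by simp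
  then have "(1 / sqrt (2 * pi)) ^ DIM('a) \<le> 1"
    by (intro power_le_one) auto
  moreover have "exp (- (norm x)\<^sup>2 / 2) \<le> 1" by simp
  ultimately show ?thesis
    unfolding gauss_def by (intro mult_le_one) auto
qed

lemma gauss_eq_prod: "gauss (x::'a::euclidean_space) = (\<Prod>b\<in>Basis. std_normal_density (x \<bullet> b))"
proof -
  have "(norm x)\<^sup>2 = (\<Sum>b\<in>Basis. (x \<bullet> b)\<^sup>2)"
    unfolding power2_norm_eq_inner by (subst euclidean_inner) (simp add: power2_eq_square)
  then have "exp (- (norm x)\<^sup>2 / 2) = (\<Prod>b\<in>Basis. exp (- (x \<bullet> b)\<^sup>2 / 2))"
    by (simp add: exp_sum[symmetric] sum_negf sum_divide_distrib)
  then show ?thesis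
    by (simp add: gauss_def std_normal_density_def prod.distrib power_one_over prod_dividef)
qed

lemma nn_integral_gauss: "(\<integral>\<^sup>+x. ennreal (gauss (x::'a::euclidean_space)) \<partial>lborel) = 1"
proof -
  have 1: "(\<integral>\<^sup>+x. ennreal (std_normal_density x) \<partial>lborel) = 1"
    using nn_integral_eq_integral[OF integrable_std_normal_moment[of 0]] std_normal_moment_even[of 0]
    by (auto simp: has_bochner_integral_iff)
  have "(\<integral>\<^sup>+x. ennreal (gauss (x::'a)) \<partial>lborel)
      = (\<integral>\<^sup>+x. (\<Prod>b\<in>Basis. ennreal (std_normal_density ((x::'a) \<bullet> b))) \<partial>lborel)"
    by (simp add: gauss_eq_prod prod_ennreal)
  also have "\<dots> = (\<Prod>b\<in>(Basis::'a set). (\<integral>\<^sup>+x. ennreal (std_normal_density x) \<partial>lborel))"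
    by (rule nn_integral_lborel_prod) auto
  finally show ?thesis using 1 by simp
qed

lemma integrable_gauss: "integrable lborel (gauss :: 'a::euclidean_space \<Rightarrow> real)"
  by (rule integrableI_nonneg) (auto simp: nn_integral_gauss)

text \<open>Both factors split over the coordinates, so the product measure reduces the claim to the
  characteristic function of the one-dimensional standard normal distribution.\<close>

lemma integral_gauss_exp:
  fixes \<xi> :: "'a::euclidean_space"
  shows "(LBINT x. of_real (gauss x) * iexp (x \<bullet> \<xi>))
       = of_real (exp (- (norm \<xi>)\<^sup>2 / 2))"
proof -
  interpret product_sigma_finite "\<lambda>b::'a. lborel :: real measure" ..
  have one: "(LBINT x. complex_of_real (std_normal_density x) * iexp (x * t))
      = of_real (exp (- t\<^sup>2 / 2))" for t
  proof -
    have "char std_normal_distribution t = of_real (exp (- t\<^sup>2 / 2))"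
      by (simp add: char_std_normal_distribution)
    then show ?thesis
      unfolding char_def by (simp add: integral_density mult.commute[of t] scaleR_conv_of_real)
  qed
  have int1: "integrable lborel (\<lambda>x. complex_of_real (std_normal_density x) * iexp (x * t))" for t
  proof (rule Bochner_Integration.integrable_bound)
    show "integrable lborel std_normal_density"
      using integrable_std_normal_moment[of 0] by simp
  qed (auto simp: norm_mult)
  define g where "g b t = of_real (std_normal_density t) * iexp (t * (\<xi> \<bullet> b))" for b t
  have [measurable]: "g b \<in> borel_measurable borel" for b
    unfolding g_def by measurable
  have prod: "of_real (gauss x) * iexp (x \<bullet> \<xi>) = (\<Prod>b\<in>Basis. g b (x \<bullet> b))" for x
  proof -
    have "x \<bullet> \<xi> = (\<Sum>b\<in>Basis. (x \<bullet> b) * (\<xi> \<bullet> b))" by (rule euclidean_inner)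
    then have "iexp (x \<bullet> \<xi>) = (\<Prod>b\<in>Basis. iexp ((x \<bullet> b) * (\<xi> \<bullet> b)))"
      by (simp add: exp_sum[symmetric] sum_distrib_left)
    then show ?thesis by (simp add: gauss_eq_prod g_def prod.distrib)
  qed
  have "(LBINT x. of_real (gauss x) * iexp (x \<bullet> \<xi>))
      = (LBINT x. (\<Prod>b\<in>Basis. g b ((x::'a) \<bullet> b)))"
    by (simp add: prod)
  also have "\<dots> = (LINT f|(\<Pi>\<^sub>M b\<in>Basis. lborel). (\<Prod>b\<in>Basis. g b ((\<Sum>b\<in>(Basis::'a set). f b *\<^sub>R b) \<bullet> b)))"
    by (subst lborel_eq, subst integral_distr) auto
  also have "\<dots> = (LINT f|(\<Pi>\<^sub>M b\<in>(Basis::'a set). lborel). (\<Prod>b\<in>Basis. g b (f b)))"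
    by (intro Bochner_Integration.integral_cong prod.cong refl) simp
  also have "\<dots> = (\<Prod>b\<in>Basis. (LBINT t. g b t))"
    using int1 by (intro product_integral_prod) (auto simp: g_def)
  also have "\<dots> = (\<Prod>b\<in>(Basis::'a set). complex_of_real (exp (- (\<xi> \<bullet> b)\<^sup>2 / 2)))"
    unfolding g_def by (intro prod.cong refl one)
  also have "\<dots> = of_real (exp (\<Sum>b\<in>(Basis::'a set). - (\<xi> \<bullet> b)\<^sup>2 / 2))"
    by (simp add: exp_sum)
  also have "(\<Sum>b\<in>(Basis::'a set). - (\<xi> \<bullet> b)\<^sup>2 / 2) = - (norm \<xi>)\<^sup>2 / 2"
    unfolding power2_norm_eq_inner
    by (subst euclidean_inner) (simp add: sum_negf sum_divide_distrib[symmetric] power2_eq_square)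
  finally show ?thesis .
qed

text \<open>A factor t is paid for by widening the Gaussian: t \<le> 1 + t^2/4 \<le> exp (t^2/4),
  and exp (-t^2/4) is what remains.\<close>

lemma norm_times_gauss_le: "norm x * gauss x \<le> gauss (x /\<^sub>R sqrt 2)"
proof -
  have "norm x \<le> 1 + (norm x)\<^sup>2 / 4"
    using zero_le_power2[of "norm x / 2 - 1"] by (simp add: power2_diff power_divide)
  also have "\<dots> \<le> exp ((norm x)\<^sup>2 / 4)" by (rule exp_ge_add_one_self)
  finally have "norm x * exp (- (norm x)\<^sup>2 / 2) \<le> exp ((norm x)\<^sup>2 / 4) * exp (- (norm x)\<^sup>2 / 2)"
    by (rule mult_right_mono) simp
  also have "\<dots> = exp (- (norm (x /\<^sub>R sqrt 2))\<^sup>2 / 2)"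
    by (simp add: exp_add[symmetric] power_mult_distrib power_divide field_simps)
  finally show ?thesis
    unfolding gauss_def by (simp add: mult.left_commute mult_left_mono)
qed

lemma nn_integral_norm_gauss_finite:
  "(\<integral>\<^sup>+x. ennreal (norm (x::'a::euclidean_space) * gauss x) \<partial>lborel) < \<infinity>"
proof -
  have "(\<integral>\<^sup>+x. ennreal (norm (x::'a) * gauss x) \<partial>lborel) \<le> (\<integral>\<^sup>+x. ennreal (gauss ((x::'a) /\<^sub>R sqrt 2)) \<partial>lborel)"
    by (intro nn_integral_mono ennreal_leI norm_times_gauss_le)
  also have "\<dots> = ennreal (\<bar>sqrt 2\<bar> ^ DIM('a)) * (\<integral>\<^sup>+x. ennreal (gauss (x::'a)) \<partial>lborel)"
    by (subst nn_integral_lborel_affine[where c = "sqrt 2" and t = 0]) simp_all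
  also have "\<dots> < \<infinity>" by (simp add: nn_integral_gauss)
  finally show ?thesis .
qed

lemma norm_gauss_le_1: "norm x * gauss x \<le> 1"
  using norm_times_gauss_le[of x] gauss_le_1[of "x /\<^sub>R sqrt 2"] by linarith

section \<open>Slicing Lebesgue measure by hyperplanes\<close>

lemma ball_borel [measurable, simp]: "ball (a::'a::metric_space) r \<in> sets borel"
  by (intro borel_open open_ball)

lemma cball_borel [measurable, simp]: "cball (a::'a::metric_space) r \<in> sets borel"
  by (intro borel_closed closed_cball)

text \<open>On the dyadic shell inside radius 2^-k the integrand is at most 2^(k+1), while the ball
  has volume proportional to 2^(-kn). For n \<ge> 2 the products are dominated by a geometric
  series; this is where the dimension enters.\<close>

lemma nn_integral_inverse_norm_ball_finite:
  assumes "DIM('a::euclidean_space) \<ge> 2"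
  shows "(\<integral>\<^sup>+x. ennreal (1 / norm x) * indicator (ball (0::'a) 1) x \<partial>lborel) < \<infinity>"
proof -
  define v where "v = unit_ball_vol (real DIM('a))"
  have v: "0 \<le> v" by (simp add: v_def)
  have pt: "ennreal (1 / norm x) * indicator (ball (0::'a) 1) x
      \<le> (\<Sum>k. ennreal (2 ^ Suc k) * indicator (ball 0 ((1/2) ^ k)) x)" (is "_ \<le> (\<Sum>k. ?g k)") for x
  proof (cases "x \<noteq> 0 \<and> x \<in> ball 0 1")
    case True
    then obtain m where "(1/2) ^ m < norm x"
      using real_arch_pow_inv[of "norm x" "1/2"] by auto
    moreover have "(1/2::real) ^ Suc m \<le> (1/2) ^ m"
      by (rule power_decreasing) auto
    ultimately have ex: "(1/2) ^ Suc m \<le> norm x" by linarith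
    \<comment> \<open>The index of the dyadic shell 2^-(k+1) \<le> |x| < 2^-k that contains x. The
      single term of the series at this index already dominates.\<close>
    define k where "k = (LEAST k. (1/2) ^ Suc k \<le> norm x)"
    have k: "(1/2) ^ Suc k \<le> norm x"
      unfolding k_def by (rule LeastI, rule ex)
    have "norm x < (1/2) ^ k"
    proof (cases k)
      case 0 then show ?thesis using True by simp
    next
      case (Suc j)
      then have "\<not> (1/2) ^ Suc j \<le> norm x"
        using not_less_Least[of j "\<lambda>k. (1/2) ^ Suc k \<le> norm x"] by (simp add: k_def)
      then show ?thesis using Suc by simp
    qed
    moreover have "1 / norm x \<le> 2 ^ Suc k"
      using k True by (simp add: field_simps power_divide)
    ultimately have "ennreal (1 / norm x) * indicator (ball (0::'a) 1) x \<le> ?g k"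
      using True by (auto intro: ennreal_leI)
    also have "\<dots> \<le> (\<Sum>k. ?g k)"
    proof -
      have "sum (\<lambda>k. ?g k) {k} \<le> (\<Sum>k. ?g k)" by (rule sum_le_suminf) auto
      then show ?thesis by (simp only: sum.insert[OF finite.emptyI] sum.empty empty_iff not_False_eq_True add_0_right)
    qed
    finally show ?thesis .
  qed auto
  have "(\<integral>\<^sup>+x. ennreal (1 / norm x) * indicator (ball (0::'a) 1) x \<partial>lborel)
      \<le> (\<integral>\<^sup>+x. (\<Sum>k. ennreal (2 ^ Suc k) * indicator (ball (0::'a) ((1/2) ^ k)) x) \<partial>lborel)"
    by (intro nn_integral_mono pt)
  also have "\<dots> = (\<Sum>k. ennreal (2 ^ Suc k) * emeasure lborel (ball (0::'a) ((1/2) ^ k)))"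
    by (subst nn_integral_suminf) (auto simp: nn_integral_cmult_indicator)
  also have "\<dots> = (\<Sum>k. ennreal (2 ^ Suc k * (v * ((1/2) ^ k) ^ DIM('a))))"
    by (simp add: emeasure_ball v_def ennreal_mult')
  also have "\<dots> \<le> (\<Sum>k. ennreal (2 * v * (1/2) ^ k))"
  proof (rule suminf_le)
    fix k :: nat
    have "((1/2::real) ^ k) ^ DIM('a) \<le> ((1/2) ^ k) ^ 2"
      using assms by (intro power_decreasing) (auto simp: power_le_one)
    then have "2 ^ Suc k * (v * ((1/2) ^ k) ^ DIM('a)) \<le> 2 ^ Suc k * (v * ((1/2) ^ k) ^ 2)"
      using v by (intro mult_left_mono) auto
    also have "\<dots> = 2 * v * (1/2) ^ k"
      by (simp add: power2_eq_square power_divide)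
    finally show "ennreal (2 ^ Suc k * (v * ((1/2) ^ k) ^ DIM('a))) \<le> ennreal (2 * v * (1/2) ^ k)"
      by (rule ennreal_leI)
  qed auto
  also have "\<dots> < \<infinity>"
    using v by (subst suminf_ennreal2) (auto intro!: summable_mult summable_geometric simp: less_top)
  finally show ?thesis .
qed

definition inv_norm_const :: "'a::euclidean_space itself \<Rightarrow> ennreal" where
  "inv_norm_const _ = (\<integral>\<^sup>+x. ennreal (1 / norm x) * indicator (ball (0::'a) 1) x \<partial>lborel)"

text \<open>The bound is the same for every a, as dominated convergence requires later. Where |a +
  z| < 1, use h \<le> 1 and translate the singularity to the origin; elsewhere 1/|a + z| \<le> 1.
  The factor \<open>1 *\<^sub>R z\<close> in the proof puts the translation into the shape of the
  affine substitution rule.\<close>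

lemma nn_integral_div_norm_le:
  fixes h :: "'a::euclidean_space \<Rightarrow> ennreal"
  assumes [measurable]: "h \<in> borel_measurable borel" and h1: "\<And>x. h x \<le> 1"
  shows "(\<integral>\<^sup>+z. h z * ennreal (1 / norm (a + z)) \<partial>lborel)
    \<le> inv_norm_const TYPE('a) + (\<integral>\<^sup>+z. h z \<partial>lborel)"
proof -
  have [measurable]: "(\<lambda>z. indicator (ball (0::'a) 1) (a + 1 *\<^sub>R z) :: ennreal) \<in> borel_measurable borel"
    by (rule measurable_compose[where N = borel and g = "indicator (ball 0 1)"])
       (simp, intro borel_measurable_indicator borel_open open_ball)
  have "(\<integral>\<^sup>+z. h z * ennreal (1 / norm (a + z)) \<partial>lborel)
    \<le> (\<integral>\<^sup>+z. ennreal (1 / norm (a + 1 *\<^sub>R z)) * indicator (ball (0::'a) 1) (a + 1 *\<^sub>R z) + h z \<partial>lborel)"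
  proof (rule nn_integral_mono)
    fix z
    show "h z * ennreal (1 / norm (a + z))
      \<le> ennreal (1 / norm (a + 1 *\<^sub>R z)) * indicator (ball (0::'a) 1) (a + 1 *\<^sub>R z) + h z"
    proof (cases "a + z \<in> ball 0 1")
      case True
      then have "h z * ennreal (1 / norm (a + z)) \<le> 1 * ennreal (1 / norm (a + z))"
        by (intro mult_right_mono h1) auto
      then show ?thesis using True by (auto intro: order_trans)
    next
      case False
      then have "1 / norm (a + z) \<le> 1" by (simp add: divide_simps)
      then have "h z * ennreal (1 / norm (a + z)) \<le> h z * 1"
        by (intro mult_left_mono) (auto simp: ennreal_le_1)
      then show ?thesis using False by simp
    qed
  qed
  also have "\<dots> = (\<integral>\<^sup>+z. ennreal (1 / norm (a + 1 *\<^sub>R z)) * indicator (ball (0::'a) 1) (a + 1 *\<^sub>R z) \<partial>lborel)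
      + (\<integral>\<^sup>+z. h z \<partial>lborel)"
    by (intro nn_integral_add) (simp_all del: scaleR_one)
  also have "(\<integral>\<^sup>+z. ennreal (1 / norm (a + 1 *\<^sub>R z)) * indicator (ball (0::'a) 1) (a + 1 *\<^sub>R z) \<partial>lborel)
      = inv_norm_const TYPE('a)"
    unfolding inv_norm_const_def
    by (subst (2) nn_integral_lborel_affine[where c = 1 and t = a]) auto
  finally show ?thesis .
qed

text \<open>
  The image measure is translation invariant, so by Tonelli, with the Gaussian as normalising
  density, it is a multiple of \<^const>\<open>lborel\<close>; the Gaussian is rotation invariant, so the factor is 1.
\<close>

lemma distr_lborel_orthogonal_transformation:
  fixes T :: "'a::euclidean_space \<Rightarrow> 'a"
  assumes "orthogonal_transformation T"
  shows "distr lborel borel T = lborel"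
proof (rule measure_eqI)
  have lin: "linear T" and nT: "\<And>x. norm (T x) = norm x" and "bij T"
    using assms by (auto simp: orthogonal_transformation_linear orthogonal_transformation_norm orthogonal_transformation_bij)
  have [measurable]: "T \<in> borel_measurable borel"
    by (intro borel_measurable_continuous_onI linear_continuous_on linear_conv_bounded_linear[THEN iffD1] lin)
  have gT: "gauss (T x) = gauss x" for x by (simp add: gauss_def nT)
  fix A assume "A \<in> sets (distr lborel borel T)"
  then have [measurable]: "A \<in> sets borel" by simp
  define h :: "'a \<Rightarrow> ennreal" where "h = indicator A"
  have [measurable]: "h \<in> borel_measurable borel" by (simp add: h_def)
  have translate: "(\<integral>\<^sup>+y. k (a + y) \<partial>lborel) = (\<integral>\<^sup>+y. k y \<partial>lborel)"
    if "k \<in> borel_measurable borel" for k and a :: 'a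
    using nn_integral_lborel_affine[OF that, where c = 1 and t = a] by simp
  have "emeasure (distr lborel borel T) A = (\<integral>\<^sup>+x. h (T x) \<partial>lborel)"
    using nn_integral_distr[of T lborel borel h] by (simp add: h_def)
  also have "\<dots> = (\<integral>\<^sup>+x. h (T x) * (\<integral>\<^sup>+y. gauss (y::'a) \<partial>lborel) \<partial>lborel)"
    by (simp add: nn_integral_gauss)
  also have "\<dots> = (\<integral>\<^sup>+x. h (T x) * (\<integral>\<^sup>+y. gauss (- T x + y) \<partial>lborel) \<partial>lborel)"
    by (subst translate) auto
  also have "\<dots> = (\<integral>\<^sup>+x. (\<integral>\<^sup>+y. h (T x) * gauss (- T x + y) \<partial>lborel) \<partial>lborel)"
    by (simp add: nn_integral_cmult)
  also have "\<dots> = (\<integral>\<^sup>+y. (\<integral>\<^sup>+x. h (T x) * gauss (- T x + y) \<partial>lborel) \<partial>lborel)"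
    by (rule lborel_pair.Fubini') measurable
  also have "\<dots> = (\<integral>\<^sup>+y. (\<integral>\<^sup>+x. h (y + T x) * gauss x \<partial>lborel) \<partial>lborel)"
  proof (rule nn_integral_cong)
    fix y
    have Ty: "T (inv T y + x) = y + T x" for x
      using linear_add[OF lin] \<open>bij T\<close> by (simp add: bij_is_surj surj_f_inv_f)
    have g: "gauss (- (y + T x) + y) = gauss x" for x
      using gT[of x] gauss_uminus[of "T x"] by simp
    show "(\<integral>\<^sup>+x. h (T x) * gauss (- T x + y) \<partial>lborel) = (\<integral>\<^sup>+x. h (y + T x) * gauss x \<partial>lborel)"
      by (subst translate[symmetric, where a = "inv T y"], measurable) (simp only: Ty g)
  qed
  also have "\<dots> = (\<integral>\<^sup>+x. (\<integral>\<^sup>+y. h (y + T x) * gauss x \<partial>lborel) \<partial>lborel)"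
    by (rule lborel_pair.Fubini') measurable
  also have "\<dots> = (\<integral>\<^sup>+x. (\<integral>\<^sup>+y. h (T x + y) \<partial>lborel) * gauss x \<partial>lborel)"
    by (simp add: nn_integral_multc add.commute)
  also have "\<dots> = (\<integral>\<^sup>+y. h y \<partial>lborel)"
    by (subst translate) (auto simp: nn_integral_cmult nn_integral_gauss)
  also have "\<dots> = emeasure lborel A" by (simp add: h_def)
  finally show "emeasure (distr lborel borel T) A = emeasure lborel A" .
qed simp

text \<open>A bijection \<open>p\<close> from \<open>Basis\<close> to \<open>B\<close> extends to an
  orthogonal map \<open>T\<close>, which preserves \<open>lborel\<close>. Transporting the defining
  product over \<open>Basis\<close> along \<open>T\<close> and renaming the coordinates by
  \<open>p\<close> gives the product over \<open>B\<close>.\<close>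

lemma lborel_eq_orthonormal_basis:
  fixes B :: "'a::euclidean_space set"
  assumes B: "orthonormal_basis_of UNIV B"
  shows "lborel = distr (\<Pi>\<^sub>M b\<in>B. lborel) borel (\<lambda>f. \<Sum>b\<in>B. f b *\<^sub>R b)"
proof -
  have orth: "pairwise orthogonal B" and n1: "\<And>b. b \<in> B \<Longrightarrow> norm b = 1" and sp: "span B = UNIV"
    using B by (auto simp: orthonormal_basis_of_def)
  have ind: "independent B"
    using pairwise_orthogonal_independent[OF orth] n1 by force
  then have fin: "finite B" by (rule independent_imp_finite)
  have "card B = DIM('a)"
    using dim_eq_card_independent[OF ind] dim_span[of B] sp by simp
  then obtain p where p: "bij_betw p (Basis :: 'a set) B"
    using finite_same_card_bij[OF finite_Basis fin] by auto
  have pB: "p b \<in> B" if "b \<in> Basis" for b using p that by (auto simp: bij_betw_def)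
  define T where "T x = (\<Sum>b\<in>Basis. (x \<bullet> b) *\<^sub>R p b)" for x
  have pin: "p b \<bullet> p c = (if b = c then 1 else 0)" if "b \<in> Basis" "c \<in> Basis" for b c
  proof (cases "b = c")
    case True then show ?thesis using n1[OF pB[OF that(1)]] by (simp add: norm_eq_1)
  next
    case False
    then have "p b \<noteq> p c" using p that by (auto simp: bij_betw_def inj_on_def)
    then show ?thesis using orth pB that False by (auto simp: pairwise_def orthogonal_def)
  qed
  have "T v \<bullet> T w = v \<bullet> w" for v w
  proof -
    have "T v \<bullet> T w = (\<Sum>b\<in>Basis. \<Sum>c\<in>Basis. (v \<bullet> b) * (w \<bullet> c) * (p b \<bullet> p c))"
      unfolding T_def inner_sum_left inner_sum_right
      by (subst sum.swap) (simp add: mult_ac)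
    also have "\<dots> = (\<Sum>b\<in>Basis. \<Sum>c\<in>Basis. if b = c then (v \<bullet> b) * (w \<bullet> c) else 0)"
      by (intro sum.cong refl) (simp add: pin)
    also have "\<dots> = v \<bullet> w" by (simp add: euclidean_inner[of v w])
    finally show ?thesis .
  qed
  moreover have "linear T"
    unfolding T_def by (intro linear_compose_sum ballI linearI) (auto simp: inner_add_left scaleR_add_left)
  ultimately have T: "orthogonal_transformation T" by (simp add: orthogonal_transformation_def)
  have [measurable]: "T \<in> borel_measurable borel" unfolding T_def by measurable
  let ?P = "\<Pi>\<^sub>M b\<in>B. (lborel :: real measure)"
  let ?Q = "\<Pi>\<^sub>M b\<in>(Basis :: 'a set). (lborel :: real measure)"
  let ?r = "\<lambda>f. \<lambda>b\<in>(Basis :: 'a set). f (p b) :: real"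
  have [measurable]: "?r \<in> ?P \<rightarrow>\<^sub>M ?Q"
    using pB by (intro measurable_restrict measurable_component_singleton) auto
  \<comment> \<open>Only the index set changes here; the claim is checked on boxes, which determine
    the product measure.\<close>
  have reindex: "?Q
      = distr ?P ?Q ?r"
  proof -
    interpret P: product_sigma_finite "\<lambda>_::'a. lborel :: real measure" ..
    show ?thesis
    proof (rule P.PiM_eqI[symmetric])
      fix A :: "'a \<Rightarrow> real set" assume A: "\<And>i. i \<in> Basis \<Longrightarrow> A i \<in> sets lborel"
      define q where "q = inv_into Basis p"
      have q: "q (p b) = b" if "b \<in> Basis" for b
        using p that by (auto simp: q_def bij_betw_def)
      have "?r -` (Pi\<^sub>E Basis A) \<inter> space ?P = Pi\<^sub>E B (\<lambda>c. A (q c))"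
      proof -
        have "B = p ` Basis" using p by (simp add: bij_betw_def)
        then show ?thesis
          by (auto simp: space_PiM PiE_iff q)
      qed
      moreover have "Pi\<^sub>E Basis A \<in> sets ?Q"
        using A by (intro sets_PiM_I_finite) auto
      ultimately have "emeasure (distr ?P ?Q ?r) (Pi\<^sub>E Basis A)
         = emeasure ?P (Pi\<^sub>E B (\<lambda>c. A (q c)))"
        by (subst emeasure_distr) auto
      also have "\<dots> = (\<Prod>c\<in>B. emeasure lborel (A (q c)))"
      proof (rule P.emeasure_PiM[OF fin])
        fix c assume "c \<in> B"
        then obtain b where "b \<in> Basis" "c = p b" using p by (auto simp: bij_betw_def)
        then show "A (q c) \<in> sets lborel" using A q by auto
      qed
      also have "\<dots> = (\<Prod>b\<in>Basis. emeasure lborel (A b))"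
        by (subst prod.reindex_bij_betw[OF p, symmetric]) (auto simp: q intro!: prod.cong)
      finally show "emeasure (distr ?P ?Q ?r) (Pi\<^sub>E Basis A)
         = (\<Prod>b\<in>Basis. emeasure lborel (A b))" .
    qed auto
  qed
  have "(lborel :: 'a measure) = distr lborel borel T"
    using distr_lborel_orthogonal_transformation[OF T] by simp
  also have "\<dots> = distr (distr (distr ?P ?Q ?r)
       borel (\<lambda>f. \<Sum>b\<in>Basis. f b *\<^sub>R b)) borel T"
    by (subst reindex[symmetric], subst lborel_eq[symmetric], rule refl)
  also have "\<dots> = distr ?P borel (T \<circ> ((\<lambda>f. \<Sum>b\<in>Basis. f b *\<^sub>R b) \<circ> ?r))"
  proof -
    have "distr (distr ?P ?Q ?r)
       borel (\<lambda>f. \<Sum>b\<in>Basis. f b *\<^sub>R b)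
     = distr ?P borel ((\<lambda>f. \<Sum>b\<in>Basis. f b *\<^sub>R b) \<circ> ?r)"
      by (rule distr_distr) measurable
    moreover have "distr (distr ?P borel ((\<lambda>f. \<Sum>b\<in>Basis. f b *\<^sub>R b) \<circ> ?r)) borel T
      = distr ?P borel (T \<circ> ((\<lambda>f. \<Sum>b\<in>Basis. f b *\<^sub>R b) \<circ> ?r))"
      by (intro distr_distr measurable_comp[where N = "\<Pi>\<^sub>M b\<in>Basis. lborel"]) measurable
    ultimately show ?thesis by simp
  qed
  also have "\<dots> = distr ?P borel (\<lambda>f. \<Sum>b\<in>B. f b *\<^sub>R b)"
  proof (rule distr_cong[OF refl refl])
    fix f
    have "(\<Sum>b\<in>B. f b *\<^sub>R b) = (\<Sum>b\<in>Basis. f (p b) *\<^sub>R p b)"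
      by (subst sum.reindex_bij_betw[OF p, symmetric]) simp
    then show "(T \<circ> ((\<lambda>f. \<Sum>b\<in>Basis. f b *\<^sub>R b) \<circ> ?r)) f = (\<Sum>b\<in>B. f b *\<^sub>R b)"
      by (simp add: T_def)
  qed
  finally show ?thesis .
qed


section \<open>Lebesgue measure on hyperplanes and the slicing formula\<close>

abbreviation hyperplane_lborel :: "'a::euclidean_space \<Rightarrow> 'a measure" where
  "hyperplane_lborel \<xi> \<equiv> subspace_lborel (orth_hyperplane \<xi>)"

lemma orthonormal_basis_of_exists:
  fixes S :: "'a::euclidean_space set"
  assumes "subspace S"
  shows "\<exists>B. orthonormal_basis_of S B"
proof -
  obtain B where "B \<subseteq> S" "pairwise orthogonal B" "\<And>x. x \<in> B \<Longrightarrow> norm x = 1" "span B = S"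
    using orthonormal_basis_subspace[OF assms] by metis
  then show ?thesis by (auto simp: orthonormal_basis_of_def)
qed

lemma subspace_orth_hyperplane: "subspace (orth_hyperplane \<xi>)"
  unfolding orth_hyperplane_def by (rule subspace_hyperplane)

lemma subspace_lborel_obtain:
  fixes \<xi> :: "'a::euclidean_space"
  obtains B where "orthonormal_basis_of (orth_hyperplane \<xi>) B" "finite B"
    "hyperplane_lborel \<xi> = distr (\<Pi>\<^sub>M b\<in>B. lborel) borel (\<lambda>f. \<Sum>b\<in>B. f b *\<^sub>R b)"
proof -
  define B where "B = (SOME B. orthonormal_basis_of (orth_hyperplane \<xi>) B)"
  have B: "orthonormal_basis_of (orth_hyperplane \<xi>) B"
    unfolding B_def by (rule someI_ex) (intro orthonormal_basis_of_exists subspace_orth_hyperplane)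
  then have "independent B"
    by (intro pairwise_orthogonal_independent) (auto simp: orthonormal_basis_of_def)
  then have "finite B" by (rule independent_imp_finite)
  with B show ?thesis
    by (intro that[of B]) (auto simp: subspace_lborel_def B_def[symmetric])
qed

lemma sets_subspace_lborel [simp, measurable_cong]: "sets (subspace_lborel S) = sets borel"
  by (simp add: subspace_lborel_def Let_def)

lemma space_subspace_lborel [simp]: "space (subspace_lborel S) = UNIV"
  by (simp add: subspace_lborel_def Let_def)

lemma orth_hyperplane_closed [measurable]: "orth_hyperplane \<xi> \<in> sets borel"
  unfolding orth_hyperplane_def by (intro borel_closed closed_hyperplane)

lemma AE_subspace_lborel:
  fixes \<xi> :: "'a::euclidean_space"
  shows "AE z in hyperplane_lborel \<xi>. \<xi> \<bullet> z = 0"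
proof -
  obtain B where B: "orthonormal_basis_of (orth_hyperplane \<xi>) B" "finite B"
    "hyperplane_lborel \<xi> = distr (\<Pi>\<^sub>M b\<in>B. lborel) borel (\<lambda>f. \<Sum>b\<in>B. f b *\<^sub>R b)"
    by (rule subspace_lborel_obtain)
  have "\<xi> \<bullet> b = 0" if "b \<in> B" for b
    using B(1) that by (auto simp: orthonormal_basis_of_def orth_hyperplane_def)
  then have "\<xi> \<bullet> (\<Sum>b\<in>B. f b *\<^sub>R b) = 0" for f
    by (simp add: inner_sum_right)
  then show ?thesis
    unfolding B(3) by (subst AE_distr_iff) auto
qed

text \<open>Adjoining the unit normal to the chosen basis of the hyperplane gives an orthonormal
  basis of the whole space, and the product measure over this enlarged index set splits off the
  normal coordinate.\<close>

lemma nn_integral_slice: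
  fixes \<xi> :: "'a::euclidean_space"
  assumes "\<xi> \<noteq> 0" and [measurable]: "h \<in> borel_measurable borel"
  shows "(\<integral>\<^sup>+x. h x \<partial>lborel)
    = (\<integral>\<^sup>+z. (\<integral>\<^sup>+t. h (z + t *\<^sub>R (\<xi> /\<^sub>R norm \<xi>)) \<partial>lborel) \<partial>hyperplane_lborel \<xi>)"
proof -
  interpret P: product_sigma_finite "\<lambda>_::'a. lborel :: real measure" ..
  obtain B where B: "orthonormal_basis_of (orth_hyperplane \<xi>) B" "finite B"
    "hyperplane_lborel \<xi> = distr (\<Pi>\<^sub>M b\<in>B. lborel) borel (\<lambda>f. \<Sum>b\<in>B. f b *\<^sub>R b)"
    by (rule subspace_lborel_obtain)
  define e where "e = \<xi> /\<^sub>R norm \<xi>"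
  have e1: "norm e = 1" using assms by (simp add: e_def)
  have eB: "e \<bullet> b = 0" if "b \<in> B" for b
    using B(1) that by (auto simp: orthonormal_basis_of_def orth_hyperplane_def e_def)
  have "e \<notin> B" using eB[of e] e1 by (auto simp: norm_eq_1)
  have "span (insert e B) = UNIV"
  proof (intro equalityI subsetI UNIV_I)
    fix x :: 'a
    have "\<xi> \<bullet> (x - (e \<bullet> x) *\<^sub>R e) = 0"
      using assms by (simp add: e_def inner_diff_right power2_norm_eq_inner[symmetric] power2_eq_square field_simps)
    then have "x - (e \<bullet> x) *\<^sub>R e \<in> span B"
      using B(1) by (auto simp: orthonormal_basis_of_def orth_hyperplane_def)
    then show "x \<in> span (insert e B)" by (auto simp: span_breakdown_eq)
  qed
  then have "orthonormal_basis_of UNIV (insert e B)"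
    using B(1) e1 eB
    by (auto simp: orthonormal_basis_of_def pairwise_insert orthogonal_def inner_commute)
  note L = lborel_eq_orthonormal_basis[OF this]
  have "(\<integral>\<^sup>+x. h x \<partial>lborel) = (\<integral>\<^sup>+f. h (\<Sum>b\<in>insert e B. f b *\<^sub>R b) \<partial>(\<Pi>\<^sub>M b\<in>insert e B. lborel))"
    by (subst L, subst nn_integral_distr) measurable
  also have "\<dots> = (\<integral>\<^sup>+f. (\<integral>\<^sup>+t. h (\<Sum>b\<in>insert e B. (f(e := t)) b *\<^sub>R b) \<partial>lborel) \<partial>(\<Pi>\<^sub>M b\<in>B. lborel))"
    by (rule P.product_nn_integral_insert[OF B(2) \<open>e \<notin> B\<close>]) measurable
  also have "\<dots> = (\<integral>\<^sup>+f. (\<integral>\<^sup>+t. h ((\<Sum>b\<in>B. f b *\<^sub>R b) + t *\<^sub>R e) \<partial>lborel) \<partial>(\<Pi>\<^sub>M b\<in>B. lborel))"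
  proof (intro nn_integral_cong)
    fix f t
    have "(\<Sum>b\<in>insert e B. (f(e := t)) b *\<^sub>R b) = (\<Sum>b\<in>B. f b *\<^sub>R b) + t *\<^sub>R e"
      using B(2) \<open>e \<notin> B\<close> by (auto simp: add.commute intro!: sum.cong)
    then show "h (\<Sum>b\<in>insert e B. (f(e := t)) b *\<^sub>R b) = h ((\<Sum>b\<in>B. f b *\<^sub>R b) + t *\<^sub>R e)" by simp
  qed
  also have "\<dots> = (\<integral>\<^sup>+z. (\<integral>\<^sup>+t. h (z + t *\<^sub>R e) \<partial>lborel) \<partial>hyperplane_lborel \<xi>)"
    unfolding B(3) by (subst nn_integral_distr) measurable
  finally show ?thesis unfolding e_def .
qed

definition section_bound :: "'a::euclidean_space itself \<Rightarrow> real \<Rightarrow> real" where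
  "section_bound _ R = 1 / (2 * R) * measure lborel (cball (0::'a) (2 * R))"

lemma section_bound_nonneg: "R > 0 \<Longrightarrow> 0 \<le> section_bound TYPE('a::euclidean_space) R"
  by (simp add: section_bound_def)

text \<open>The cylinder of height 2R over the section of the ball lies in the ball of radius 2R,
  whence the shape of \<open>section_bound\<close>. What matters is that the bound does not depend
  on the direction \<xi>.\<close>

lemma section_cball_le:
  fixes \<xi> :: "'a::euclidean_space"
  assumes "\<xi> \<noteq> 0" "R > 0"
  shows "emeasure (hyperplane_lborel \<xi>) (cball 0 R)
    \<le> ennreal (section_bound TYPE('a) R)"
proof -
  let ?N = "hyperplane_lborel \<xi>"
  have "ennreal (2 * R) * emeasure ?N (cball 0 R)
      = (\<integral>\<^sup>+z. (\<integral>\<^sup>+t. indicator (cball 0 R) z * indicator {-R..R} t \<partial>lborel) \<partial>?N)"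
  proof -
    have "(\<integral>\<^sup>+t. indicator (cball 0 R) z * indicator {-R..R} t \<partial>lborel) = ennreal (2 * R) * indicator (cball (0::'a) R) z" for z
      using assms(2) by (simp add: nn_integral_cmult mult.commute)
    then show ?thesis by (simp add: nn_integral_cmult_indicator)
  qed
  also have "\<dots> \<le> (\<integral>\<^sup>+z. (\<integral>\<^sup>+t. indicator (cball 0 (2 * R)) (z + t *\<^sub>R (\<xi> /\<^sub>R norm \<xi>)) \<partial>lborel) \<partial>?N)"
  proof (intro nn_integral_mono)
    fix z :: 'a and t :: real
    have "norm (z + t *\<^sub>R (\<xi> /\<^sub>R norm \<xi>)) \<le> 2 * R" if "norm z \<le> R" "\<bar>t\<bar> \<le> R"
    proof -
      have "norm (t *\<^sub>R (\<xi> /\<^sub>R norm \<xi>)) = \<bar>t\<bar>" using assms(1) by (simp add: abs_mult)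
      then show ?thesis using norm_triangle_ineq[of z "t *\<^sub>R (\<xi> /\<^sub>R norm \<xi>)"] that by linarith
    qed
    then show "indicator (cball 0 R) z * indicator {-R..R} t
      \<le> (indicator (cball 0 (2 * R)) (z + t *\<^sub>R (\<xi> /\<^sub>R norm \<xi>)) :: ennreal)"
      by (auto simp: indicator_def)
  qed
  also have "\<dots> = (\<integral>\<^sup>+x. indicator (cball 0 (2 * R)) (x::'a) \<partial>lborel)"
    by (rule nn_integral_slice[OF assms(1), symmetric]) simp
  finally have le: "ennreal (2 * R) * emeasure ?N (cball 0 R) \<le> emeasure lborel (cball (0::'a) (2 * R))" by simp
  have "emeasure ?N (cball 0 R) = ennreal (1 / (2 * R)) * (ennreal (2 * R) * emeasure ?N (cball 0 R))"
    using assms(2) by (simp add: mult.assoc[symmetric] ennreal_mult'[symmetric])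
  also have "\<dots> \<le> ennreal (1 / (2 * R)) * emeasure lborel (cball (0::'a) (2 * R))"
    by (intro mult_left_mono le) simp
  also have "\<dots> = ennreal (section_bound TYPE('a) R)"
    using emeasure_lborel_cball_finite[of "0::'a" "2 * R"] assms(2)
    by (simp add: section_bound_def emeasure_eq_ennreal_measure less_top ennreal_mult[symmetric])
  finally show ?thesis .
qed

section \<open>Section volumes and the Fourier transform\<close>

lemma inv_norm_const_finite:
  "DIM('a::euclidean_space) \<ge> 2 \<Longrightarrow> inv_norm_const TYPE('a) < \<infinity>"
  unfolding inv_norm_const_def by (rule nn_integral_inverse_norm_ball_finite)

lemma nn_integral_cball_div_norm_finite:
  assumes "DIM('a::euclidean_space) \<ge> 2"
  shows "(\<integral>\<^sup>+y. indicator (cball (0::'a) R) y * ennreal (1 / norm y) \<partial>lborel) < \<infinity>"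
proof -
  have "(\<integral>\<^sup>+y. indicator (cball (0::'a) R) y * ennreal (1 / norm (0 + y)) \<partial>lborel)
     \<le> inv_norm_const TYPE('a) + (\<integral>\<^sup>+y. indicator (cball (0::'a) R) y \<partial>lborel)"
    by (rule nn_integral_div_norm_le) (auto simp: indicator_def)
  also have "\<dots> < \<infinity>"
    using inv_norm_const_finite[OF assms] emeasure_lborel_cball_finite[of "0::'a" R]
    by (simp add: ennreal_add_less_top)
  finally show ?thesis by simp
qed

lemma nn_integral_scale_real:
  fixes r :: real
  assumes "r > 0" and [measurable]: "g \<in> borel_measurable borel"
  shows "(\<integral>\<^sup>+s. g (s * r) \<partial>lborel) = ennreal (1 / r) * (\<integral>\<^sup>+s. g s \<partial>lborel)"
  using assms
  by (subst (2) nn_integral_lborel_affine[where c = r and t = 0])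
     (auto simp: mult.commute[of r] mult.assoc[symmetric] ennreal_mult'[symmetric])

lemma nn_integral_gauss_moment_finite:
  "(\<integral>\<^sup>+s. ennreal (\<bar>s\<bar> ^ k * exp (- (s::real)\<^sup>2 / 2)) \<partial>lborel) < \<infinity>"
proof -
  have "integrable lborel (\<lambda>x. sqrt (2 * pi) * (std_normal_density x * \<bar>x\<bar> ^ k))"
    by (intro integrable_mult_right integrable_std_normal_moment_abs)
  then have "integrable lborel (\<lambda>x::real. \<bar>x\<bar> ^ k * exp (- x\<^sup>2 / 2))"
    by (simp add: std_normal_density_def mult_ac)
  then show ?thesis
    by (auto simp: integrable_iff_bounded abs_mult power_abs)
qed

abbreviation cone_exp :: "real \<times> 'a::euclidean_space \<Rightarrow> real" where
  "cone_exp p \<equiv> exp (- (fst p * norm (snd p))\<^sup>2 / 2)"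

text \<open>For fixed y \<noteq> 0 the substitution s |y| \<rightarrow> s turns the inner integral
  into 1/|y| times an absolute Gaussian moment, so the claim rests on the integrability of 1/|y|
  over a ball.\<close>

lemma nn_integral_cone_moment_finite:
  assumes "DIM('a::euclidean_space) \<ge> 2"
  shows "(\<integral>\<^sup>+p. ennreal (norm (fst p *\<^sub>R snd p) ^ k * cone_exp p)
        * indicator (cball (0::'a) R) (snd p) \<partial>lborel) < \<infinity>"
proof -
  define A where "A = (\<integral>\<^sup>+s. ennreal (\<bar>s\<bar> ^ k * exp (- s\<^sup>2 / 2)) \<partial>lborel)"
  let ?g = "\<lambda>p. ennreal (norm (fst p *\<^sub>R snd p) ^ k * cone_exp p)
        * indicator (cball (0::'a) R) (snd p)"
  let ?h = "\<lambda>s y. ennreal (norm (s *\<^sub>R y) ^ k * exp (- (s * norm y)\<^sup>2 / 2))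
        * indicator (cball (0::'a) R) y"
  let ?r = "\<lambda>y. indicator (cball (0::'a) R) y * ennreal (1 / norm y) * A"
  have "(\<integral>\<^sup>+p. ?g p \<partial>lborel)
    = (\<integral>\<^sup>+y. (\<integral>\<^sup>+s. ?h s y \<partial>lborel) \<partial>lborel)"
    unfolding lborel_prod[symmetric] by (subst lborel_pair.nn_integral_snd[symmetric]) auto
  also have "\<dots> = (\<integral>\<^sup>+y. ?r y \<partial>lborel)"
  proof (rule nn_integral_cong_AE)
    show "AE y in lborel. (\<integral>\<^sup>+s. ?h s y \<partial>lborel) = ?r y"
      using AE_lborel_singleton[of "0::'a"]
    proof eventually_elim
      case (elim y)
      have "(\<integral>\<^sup>+s. ennreal (norm (s *\<^sub>R y) ^ k * exp (- (s * norm y)\<^sup>2 / 2)) \<partial>lborel)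
         = (\<integral>\<^sup>+s. ennreal (\<bar>s * norm y\<bar> ^ k * exp (- (s * norm y)\<^sup>2 / 2)) \<partial>lborel)"
        by (simp add: abs_mult)
      also have "\<dots> = ennreal (1 / norm y) * A"
        using nn_integral_scale_real[of "norm y" "\<lambda>s. ennreal (\<bar>s\<bar> ^ k * exp (- s\<^sup>2 / 2))"] elim
        by (simp add: A_def)
      finally show ?case by (subst nn_integral_multc) (simp_all add: mult_ac)
    qed
  qed
  also have "\<dots> = (\<integral>\<^sup>+y. indicator (cball (0::'a) R) y * ennreal (1 / norm y) \<partial>lborel) * A"
    by (rule nn_integral_multc) auto
  also have "\<dots> < \<infinity>"
    using nn_integral_cball_div_norm_finite[OF assms] nn_integral_gauss_moment_finite[of k]
    by (simp add: A_def ennreal_mult_less_top)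
  finally show ?thesis .
qed

text \<open>Read from right to left, this writes Gaussian damping at frequency \<xi> as an average
  of undamped cosines at the frequencies \<xi> + \<eta>. With x = s y it is the source of the
  hyperplanes orthogonal to \<xi> + \<eta>. The shift by \<xi> contributes only a phase.\<close>

lemma integral_gauss_cos:
  fixes x \<xi> :: "'a::euclidean_space"
  shows "(LBINT \<eta>. gauss \<eta> * cos (x \<bullet> (\<xi> + \<eta>))) = exp (- (norm x)\<^sup>2 / 2) * cos (x \<bullet> \<xi>)"
proof -
  let ?e = "\<lambda>\<eta>. iexp (x \<bullet> \<xi>) * (of_real (gauss \<eta>) * iexp (\<eta> \<bullet> x))"
  have "(LBINT \<eta>. gauss \<eta> * cos (x \<bullet> (\<xi> + \<eta>)))
      = (LBINT \<eta>. Re (?e \<eta>))"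
  proof (intro Bochner_Integration.integral_cong refl)
    fix \<eta>
    have "?e \<eta>
      = of_real (gauss \<eta>) * iexp (x \<bullet> (\<xi> + \<eta>))"
      by (simp add: exp_add[symmetric] inner_add_right inner_commute algebra_simps)
    then show "gauss \<eta> * cos (x \<bullet> (\<xi> + \<eta>))
      = Re (?e \<eta>)"
      by (simp only:) (simp add: Re_exp)
  qed
  also have "\<dots> = Re (LBINT \<eta>. ?e \<eta>)"
  proof (rule integral_Re)
    show "integrable lborel (\<lambda>\<eta>. ?e \<eta>)"
      by (rule Bochner_Integration.integrable_bound[OF integrable_gauss]) (auto simp: norm_mult)
  qed
  also have "\<dots> = Re (iexp (x \<bullet> \<xi>) * complex_of_real (exp (- (norm x)\<^sup>2 / 2)))"
    by (subst integral_mult_right_zero) (simp only: integral_gauss_exp)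
  also have "\<dots> = exp (- (norm x)\<^sup>2 / 2) * cos (x \<bullet> \<xi>)"
    by (simp add: Re_exp)
  finally show ?thesis .
qed

lemma integral_exp_sq_cos:
  assumes "\<delta> > 0"
  shows "(LBINT s. exp (- (\<delta> * s)\<^sup>2 / 2) * cos (s * b)) = sqrt (2 * pi) / \<delta> * exp (- (b / \<delta>)\<^sup>2 / 2)"
proof -
  have "(LBINT s. exp (- s\<^sup>2 / 2) * cos (s * (b / \<delta>))) = \<delta> * (LBINT s. exp (- (\<delta> * s)\<^sup>2 / 2) * cos (s * b))"
    using assms by (subst integral_lborel_affine[where c = \<delta> and t = 0]) auto
  moreover have "(LBINT s. exp (- s\<^sup>2 / 2) * cos (s * (b / \<delta>))) = sqrt (2 * pi) * exp (- (b / \<delta>)\<^sup>2 / 2)"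
  proof -
    have "(LBINT s. gauss s * cos ((b / \<delta>) \<bullet> (0 + s))) = exp (- (norm (b / \<delta>))\<^sup>2 / 2) * cos ((b / \<delta>) \<bullet> 0)"
      by (rule integral_gauss_cos)
    then show ?thesis
      by (simp add: gauss_def mult.commute[of b] field_simps)
  qed
  ultimately show ?thesis using assms by (simp add: field_simps)
qed

text \<open>For k = \<open>indicator C\<close> and \<delta> = 0 this is the Fourier transform of
  \<rho>_C; only the cosine appears because the sine is odd in s. The parameter \<delta> cuts off
  large s, and a general k leaves room for continuous approximations of the indicator.\<close>

definition cone_cos :: "('a::euclidean_space \<Rightarrow> real) \<Rightarrow> real \<Rightarrow> 'a \<Rightarrow> real" where
  "cone_cos k \<delta> \<xi> = (LBINT p. k (snd p) * cone_exp p
     * exp (- (\<delta> * fst p)\<^sup>2 / 2) * cos (fst p * (snd p \<bullet> \<xi>)))"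

text \<open>As a function of y \<bullet> \<eta> the weight has total mass 2\<pi> and concentrates at
  0 as \<delta> \<rightarrow> 0: it approximates 2\<pi> times a Dirac mass on the hyperplane
  orthogonal to \<eta>.\<close>

definition slab_integral :: "('a::euclidean_space \<Rightarrow> real) \<Rightarrow> real \<Rightarrow> 'a \<Rightarrow> real" where
  "slab_integral k \<delta> \<eta> = (LBINT y. k y * (sqrt (2 * pi) / \<delta> * exp (- ((y \<bullet> \<eta>) / \<delta>)\<^sup>2 / 2)))"

text \<open>
  Substitute \<open>exp (- s\<^sup>2|y|\<^sup>2/2) = \<integral> gauss \<eta> cos (s y\<bullet>\<eta>) d\<eta>\<close> and carry out the integration over \<open>s\<close>, which
  converges thanks to \<open>\<delta>\<close>.
\<close>

lemma cone_cos_eq_slab: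
  fixes k :: "'a::euclidean_space \<Rightarrow> real"
  assumes [measurable]: "k \<in> borel_measurable borel"
    and k0: "\<And>y. 0 \<le> k y" and k1: "\<And>y. k y \<le> indicator (cball 0 R) y" and "\<delta> > 0"
  shows "cone_cos k \<delta> \<xi> = (LBINT \<eta>. gauss \<eta> * slab_integral k \<delta> (\<xi> + \<eta>))"
proof -
  let ?k = "\<lambda>p::real \<times> 'a. k (snd p) * exp (- (\<delta> * fst p)\<^sup>2 / 2)"
  define F where "F p \<eta> = ?k p * (gauss \<eta> * cos ((fst p *\<^sub>R snd p) \<bullet> (\<xi> + \<eta>)))"
    for p :: "real \<times> 'a" and \<eta> :: 'a
  have [measurable]: "case_prod F \<in> borel_measurable (borel \<Otimes>\<^sub>M borel)"
    unfolding F_def borel_prod[symmetric] by measurable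
  have fin_s: "(\<integral>\<^sup>+s. ennreal (exp (- (\<delta> * s)\<^sup>2 / 2)) \<partial>lborel) < \<infinity>"
    using nn_integral_scale_real[of \<delta> "\<lambda>s. ennreal (exp (- s\<^sup>2 / 2))"] nn_integral_gauss_moment_finite[of 0] \<open>\<delta> > 0\<close>
    by (simp add: mult.commute[of _ \<delta>] ennreal_mult_less_top)
  have fin_y: "(\<integral>\<^sup>+y. ennreal (k y) \<partial>lborel) < \<infinity>"
  proof -
    have "(\<integral>\<^sup>+y. ennreal (k y) \<partial>lborel) \<le> (\<integral>\<^sup>+y. indicator (cball (0::'a) R) y \<partial>lborel)"
    proof (rule nn_integral_mono)
      show "ennreal (k y) \<le> indicator (cball 0 R) y" for y
        using ennreal_leI[OF k1[of y]] by (simp add: ennreal_indicator)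
    qed
    then show ?thesis using emeasure_lborel_cball_finite[of "0::'a" R] by (simp add: order_le_less_trans)
  qed
  have int_sy: "integrable lborel ?k"
  proof (rule integrableI_nonneg)
    have "(\<integral>\<^sup>+p. ennreal (?k p) \<partial>lborel)
       = (\<integral>\<^sup>+s. (\<integral>\<^sup>+y. ennreal (k y) * ennreal (exp (- (\<delta> * s)\<^sup>2 / 2)) \<partial>lborel) \<partial>lborel)"
      unfolding lborel_prod[symmetric] by (subst lborel.nn_integral_fst[symmetric]) (auto simp: ennreal_mult' k0)
    also have "\<dots> = (\<integral>\<^sup>+y. ennreal (k y) \<partial>lborel) * (\<integral>\<^sup>+s. ennreal (exp (- (\<delta> * s)\<^sup>2 / 2)) \<partial>lborel)"
      by (simp add: nn_integral_multc nn_integral_cmult)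
    also have "\<dots> < \<infinity>" using fin_s fin_y by (simp add: ennreal_mult_less_top)
    finally show "(\<integral>\<^sup>+p. ennreal (?k p) \<partial>(lborel::(real \<times> 'a) measure)) < \<infinity>" .
  qed (auto simp: k0 borel_prod[symmetric])
  have int_F: "integrable (lborel \<Otimes>\<^sub>M lborel) (case_prod F)"
  proof (rule lborel_pair.Fubini_integrable)
    have bd: "norm (F p \<eta>) \<le> norm (?k p * gauss \<eta>)" for p \<eta>
      unfolding F_def by (auto simp: abs_mult intro!: mult_left_mono mult_left_le)
    have i1: "integrable lborel (F p)" for p
    proof (rule Bochner_Integration.integrable_bound)
      show "integrable lborel (\<lambda>\<eta>. ?k p * gauss \<eta>)"
        by (intro integrable_mult_right integrable_gauss)
      show "F p \<in> borel_measurable lborel" unfolding F_def by measurable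
    qed (use bd in auto)
    then show "AE p in lborel. integrable lborel (\<lambda>y. case_prod F (p, y))" by simp
    show "integrable lborel (\<lambda>p. LBINT y. norm (case_prod F (p, y)))"
    proof (rule Bochner_Integration.integrable_bound[OF int_sy])
      show "AE p in lborel. norm (LBINT y. norm (case_prod F (p, y))) \<le> norm (?k p)"
      proof (rule AE_I2)
        fix p :: "real \<times> 'a"
        have "(LBINT y. norm (F p y)) \<le> (LBINT y. norm (?k p) * gauss (y::'a))"
          using bd[of p] i1[of p] by (intro integral_mono) (auto simp: abs_mult intro!: integrable_mult_right integrable_gauss)
        also have "\<dots> = norm (?k p)"
          using integral_gauss_cos[of "0::'a" 0] by simp
        finally show "norm (LBINT y. norm (case_prod F (p, y))) \<le> norm (?k p)"
          by simp
      qed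
    qed measurable
  qed measurable
  have "cone_cos k \<delta> \<xi> = (LBINT p. (LBINT \<eta>. F p \<eta>))"
    unfolding cone_cos_def F_def
    by (intro Bochner_Integration.integral_cong refl, subst integral_mult_right_zero, subst integral_gauss_cos)
       (simp add: mult_ac power_mult_distrib)
  also have "\<dots> = (LBINT \<eta>. (LBINT p. F p \<eta>))"
    by (rule lborel_pair.Fubini_integral[OF int_F, symmetric])
  also have "\<dots> = (LBINT \<eta>. gauss \<eta> * slab_integral k \<delta> (\<xi> + \<eta>))"
  proof (intro Bochner_Integration.integral_cong refl)
    fix \<eta> :: 'a
    define G where "G s y = k y * (exp (- (\<delta> * s)\<^sup>2 / 2) * cos (s * (y \<bullet> (\<xi> + \<eta>))))" for s :: real and y :: 'a
    have int_G: "integrable (lborel \<Otimes>\<^sub>M lborel) (case_prod G)"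
      unfolding lborel_prod
    proof (rule Bochner_Integration.integrable_bound[OF int_sy])
      show "case_prod G \<in> borel_measurable lborel"
        unfolding G_def measurable_lborel2 borel_prod[symmetric] by measurable
    qed (intro AE_I2, auto simp: G_def abs_mult intro!: mult_left_mono mult_left_le)
    have "(LBINT p. F p \<eta>) = gauss \<eta> * (LBINT p. case_prod G p)"
      unfolding F_def G_def by (subst integral_mult_right_zero[symmetric])
        (intro Bochner_Integration.integral_cong refl, auto simp: case_prod_beta mult_ac)
    also have "(LBINT p. case_prod G p) = (LBINT y. (LBINT s. G s y))"
      using lborel_pair.integral_snd[OF int_G] by (simp add: lborel_prod)
    also have "\<dots> = slab_integral k \<delta> (\<xi> + \<eta>)"
      unfolding slab_integral_def G_def
      by (intro Bochner_Integration.integral_cong refl, subst integral_mult_right_zero,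
          subst integral_exp_sq_cos[OF \<open>\<delta> > 0\<close>]) (rule refl)
    finally show "(LBINT p. F p \<eta>) = gauss \<eta> * slab_integral k \<delta> (\<xi> + \<eta>)" .
  qed
  finally show ?thesis .
qed


text \<open>Slicing along \<eta> makes y \<bullet> \<eta> equal to t |\<eta>|, and t = \<delta> r /
  |\<eta>| turns the weight into 2\<pi>/|\<eta>| times the standard Gaussian in r. Afterwards
  \<delta> occurs only inside the argument of k.\<close>

lemma slab_integral_slice:
  fixes k :: "'a::euclidean_space \<Rightarrow> real"
  assumes [measurable]: "k \<in> borel_measurable borel"
    and k0: "\<And>y. 0 \<le> k y" and k1: "\<And>y. k y \<le> indicator (cball 0 R) y" and "\<delta> > 0" and "\<eta> \<noteq> 0"
  shows "ennreal (slab_integral k \<delta> \<eta>) = ennreal (2 * pi / norm \<eta>) *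
    (\<integral>\<^sup>+z. (\<integral>\<^sup>+r. ennreal (k (z + (\<delta> / norm \<eta> * r) *\<^sub>R (\<eta> /\<^sub>R norm \<eta>))) * ennreal (gauss r) \<partial>lborel)
      \<partial>hyperplane_lborel \<eta>)"
proof -
  let ?N = "hyperplane_lborel \<eta>"
  define e where "e = \<eta> /\<^sub>R norm \<eta>"
  define c where "c = \<delta> / norm \<eta>"
  have c: "c > 0" using assms by (simp add: c_def)
  have e\<eta>: "e \<bullet> \<eta> = norm \<eta>"
    using \<open>\<eta> \<noteq> 0\<close> by (simp add: e_def power2_norm_eq_inner[symmetric] power2_eq_square field_simps)
  let ?I = "\<lambda>z. \<integral>\<^sup>+r. ennreal (k (z + (c * r) *\<^sub>R e)) * ennreal (gauss r) \<partial>lborel"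
  define w where "w t = sqrt (2 * pi) / \<delta> * exp (- (t / \<delta>)\<^sup>2 / 2)" for t
  have w0: "0 \<le> w t" for t using \<open>\<delta> > 0\<close> by (simp add: w_def)
  have [measurable]: "w \<in> borel_measurable borel" unfolding w_def by measurable
  have int: "integrable lborel (\<lambda>y. k y * w (y \<bullet> \<eta>))"
  proof (rule Bochner_Integration.integrable_bound)
    show "integrable lborel (\<lambda>y. indicator (cball (0::'a) R) y * (sqrt (2 * pi) / \<delta>))"
      using emeasure_lborel_cball_finite[of "0::'a" R]
      by (intro integrable_mult_left integrable_real_indicator) auto
    show "AE y in lborel. norm (k y * w (y \<bullet> \<eta>)) \<le> norm (indicator (cball (0::'a) R) y * (sqrt (2 * pi) / \<delta>))"
    proof (rule AE_I2)
      fix y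
      have "w (y \<bullet> \<eta>) \<le> sqrt (2 * pi) / \<delta>"
        unfolding w_def using \<open>\<delta> > 0\<close> by (intro mult_left_le) auto
      then have "k y * w (y \<bullet> \<eta>) \<le> indicator (cball (0::'a) R) y * (sqrt (2 * pi) / \<delta>)"
        using k0 k1 w0 by (intro mult_mono) auto
      then show "norm (k y * w (y \<bullet> \<eta>)) \<le> norm (indicator (cball (0::'a) R) y * (sqrt (2 * pi) / \<delta>))"
        using k0 w0 \<open>\<delta> > 0\<close> by (simp add: abs_mult)
    qed
  qed measurable
  have "ennreal (slab_integral k \<delta> \<eta>) = (\<integral>\<^sup>+y. ennreal (k y * w (y \<bullet> \<eta>)) \<partial>lborel)"
    unfolding slab_integral_def w_def[symmetric] using int k0 w0
    by (intro nn_integral_eq_integral[symmetric]) auto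
  also have "\<dots> = (\<integral>\<^sup>+z. (\<integral>\<^sup>+t. ennreal (k (z + t *\<^sub>R e) * w ((z + t *\<^sub>R e) \<bullet> \<eta>)) \<partial>lborel) \<partial>?N)"
    unfolding e_def by (rule nn_integral_slice[OF \<open>\<eta> \<noteq> 0\<close>]) measurable
  also have "\<dots> = (\<integral>\<^sup>+z. ennreal (2 * pi / norm \<eta>) * ?I z
      \<partial>?N)"
  proof (rule nn_integral_cong_AE)
    show "AE z in ?N.
      (\<integral>\<^sup>+t. ennreal (k (z + t *\<^sub>R e) * w ((z + t *\<^sub>R e) \<bullet> \<eta>)) \<partial>lborel)
      = ennreal (2 * pi / norm \<eta>) * ?I z"
      using AE_subspace_lborel[of \<eta>]
    proof eventually_elim
      case (elim z)
      have "(\<integral>\<^sup>+t. ennreal (k (z + t *\<^sub>R e) * w ((z + t *\<^sub>R e) \<bullet> \<eta>)) \<partial>lborel)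
         = (\<integral>\<^sup>+t. ennreal (k (z + t *\<^sub>R e) * w (t * norm \<eta>)) \<partial>lborel)"
        using elim by (simp add: inner_add_left inner_commute[of z] e\<eta>)
      also have "\<dots> = ennreal c * (\<integral>\<^sup>+r. ennreal (k (z + (c * r) *\<^sub>R e) * w (c * r * norm \<eta>)) \<partial>lborel)"
        using c by (subst nn_integral_lborel_affine[where c = c and t = 0]) auto
      also have "\<dots> = (\<integral>\<^sup>+r. ennreal (2 * pi / norm \<eta>) * (ennreal (k (z + (c * r) *\<^sub>R e)) * ennreal (gauss r)) \<partial>lborel)"
      proof (subst nn_integral_cmult[symmetric], measurable, intro nn_integral_cong)
        fix r
        have "c * w (c * r * norm \<eta>) = 2 * pi / norm \<eta> * gauss r"
          using assms(4,5) by (simp add: w_def c_def gauss_def field_simps)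
        then have "c * (k (z + (c * r) *\<^sub>R e) * w (c * r * norm \<eta>)) = 2 * pi / norm \<eta> * (k (z + (c * r) *\<^sub>R e) * gauss r)"
          by (simp only: mult.left_commute[of _ "k (z + (c * r) *\<^sub>R e)"])
        then show "ennreal c * ennreal (k (z + (c * r) *\<^sub>R e) * w (c * r * norm \<eta>))
           = ennreal (2 * pi / norm \<eta>) * (ennreal (k (z + (c * r) *\<^sub>R e)) * ennreal (gauss r))"
          using k0 c w0 by (simp add: ennreal_mult[symmetric])
      qed
      finally show ?case by (subst (asm) nn_integral_cmult) simp_all
    qed
  qed
  also have "\<dots> = ennreal (2 * pi / norm \<eta>) * (\<integral>\<^sup>+z. ?I z
      \<partial>?N)"
    by (rule nn_integral_cmult) measurable
  finally show ?thesis unfolding c_def e_def .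
qed

text \<open>Moving off the hyperplane along its normal can only increase the norm, by Pythagoras. So
  a function supported in the ball sees only base points z in the ball, whatever the
  displacement.\<close>

lemma slab_inner_le:
  fixes k :: "'a::euclidean_space \<Rightarrow> real"
  assumes [measurable]: "k \<in> borel_measurable borel" and k1: "\<And>y. k y \<le> indicator (cball 0 R) y"
    and "\<eta> \<bullet> z = 0"
  shows "(\<integral>\<^sup>+r. ennreal (k (z + (c * r) *\<^sub>R (\<eta> /\<^sub>R norm \<eta>))) * ennreal (gauss r) \<partial>lborel) \<le> indicator (cball 0 R) z"
proof -
  have "norm z \<le> norm (z + t *\<^sub>R (\<eta> /\<^sub>R norm \<eta>))" for t
  proof (rule power2_le_imp_le)
    have "orthogonal z (t *\<^sub>R (\<eta> /\<^sub>R norm \<eta>))"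
      using assms(3) by (simp add: orthogonal_def inner_commute)
    from norm_add_Pythagorean[OF this]
    show "(norm z)\<^sup>2 \<le> (norm (z + t *\<^sub>R (\<eta> /\<^sub>R norm \<eta>)))\<^sup>2" by simp
  qed simp
  then have "indicator (cball 0 R) (z + t *\<^sub>R (\<eta> /\<^sub>R norm \<eta>)) \<le> (indicator (cball 0 R) z :: real)" for t
    by (auto simp: indicator_def intro: order_trans)
  then have "k (z + t *\<^sub>R (\<eta> /\<^sub>R norm \<eta>)) \<le> indicator (cball 0 R) z" for t
    using k1 order_trans by blast
  then have "ennreal (k (z + t *\<^sub>R (\<eta> /\<^sub>R norm \<eta>))) \<le> indicator (cball 0 R) z" for t
    by (metis ennreal_indicator ennreal_leI)
  then have "(\<integral>\<^sup>+r. ennreal (k (z + (c * r) *\<^sub>R (\<eta> /\<^sub>R norm \<eta>))) * ennreal (gauss r) \<partial>lborel)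
      \<le> (\<integral>\<^sup>+r. indicator (cball 0 R) z * ennreal (gauss (r::real)) \<partial>lborel)"
    by (intro nn_integral_mono mult_right_mono) auto
  also have "\<dots> = indicator (cball 0 R) z"
    by (simp add: nn_integral_cmult nn_integral_gauss)
  finally show ?thesis .
qed

lemma slab_integral_nonneg:
  assumes "\<And>y. 0 \<le> k y" "\<delta> > 0"
  shows "0 \<le> slab_integral k \<delta> \<eta>"
  unfolding slab_integral_def using assms by (intro integral_nonneg_AE AE_I2) auto

text \<open>The right-hand side does not involve \<delta>, so together with the Gaussian in \<eta>
  it is the dominating function for \<delta> \<rightarrow> 0.\<close>

lemma slab_integral_le:
  fixes k :: "'a::euclidean_space \<Rightarrow> real"
  assumes [measurable]: "k \<in> borel_measurable borel"
    and k0: "\<And>y. 0 \<le> k y" and k1: "\<And>y. k y \<le> indicator (cball 0 R) y" and "\<delta> > 0" and "\<eta> \<noteq> 0" and "R > 0"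
  shows "slab_integral k \<delta> \<eta> \<le> 2 * pi / norm \<eta> * section_bound TYPE('a) R"
proof -
  have "ennreal (slab_integral k \<delta> \<eta>) \<le> ennreal (2 * pi / norm \<eta>) *
    (\<integral>\<^sup>+z. indicator (cball 0 R) z \<partial>hyperplane_lborel \<eta>)"
    unfolding slab_integral_slice[OF assms(1-5)]
  proof (intro mult_left_mono nn_integral_mono_AE)
    show "AE z in hyperplane_lborel \<eta>.
      (\<integral>\<^sup>+r. ennreal (k (z + (\<delta> / norm \<eta> * r) *\<^sub>R (\<eta> /\<^sub>R norm \<eta>))) * ennreal (gauss r) \<partial>lborel) \<le> indicator (cball 0 R) z"
      using AE_subspace_lborel[of \<eta>] by eventually_elim (rule slab_inner_le[OF assms(1) k1])
  qed simp
  also have "\<dots> \<le> ennreal (2 * pi / norm \<eta>) * ennreal (section_bound TYPE('a) R)"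
    using section_cball_le[OF assms(5,6)] by (intro mult_left_mono) auto
  also have "\<dots> = ennreal (2 * pi / norm \<eta> * section_bound TYPE('a) R)"
    using section_bound_nonneg[OF \<open>R > 0\<close>, where 'a = 'a] by (intro ennreal_mult[symmetric]) auto
  finally show ?thesis
    using section_bound_nonneg[OF \<open>R > 0\<close>, where 'a = 'a] by (subst (asm) ennreal_le_iff) simp_all
qed

lemma section_integral_le:
  fixes k :: "'a::euclidean_space \<Rightarrow> real"
  assumes k1: "\<And>y. k y \<le> indicator (cball 0 R) y" and "\<eta> \<noteq> 0" and "R > 0"
  shows "(\<integral>\<^sup>+z. ennreal (k z) \<partial>hyperplane_lborel \<eta>) \<le> ennreal (section_bound TYPE('a) R)"
proof -
  have "ennreal (k z) \<le> indicator (cball 0 R) z" for z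
    using ennreal_leI[OF k1[of z]] by (simp add: ennreal_indicator)
  then have "(\<integral>\<^sup>+z. ennreal (k z) \<partial>hyperplane_lborel \<eta>)
     \<le> (\<integral>\<^sup>+z. indicator (cball 0 R) z \<partial>hyperplane_lborel \<eta>)"
    by (intro nn_integral_mono)
  then show ?thesis using section_cball_le[OF assms(2,3)] by simp
qed

text \<open>In the form of \<open>slab_integral_slice\<close> the parameter only displaces the
  argument of k, so continuity of k and two dominated convergences, over r and then over z, suffice.
  Indicators are not continuous and are reached later by approximation.\<close>

lemma slab_integral_tendsto:
  fixes k :: "'a::euclidean_space \<Rightarrow> real"
  assumes cont: "continuous_on UNIV k"
    and k0: "\<And>y. 0 \<le> k y" and k1: "\<And>y. k y \<le> indicator (cball 0 R) y" and "\<eta> \<noteq> 0" and "R > 0"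
    and d0: "\<And>m. d m > 0" and d: "d \<longlonglongrightarrow> 0"
  shows "(\<lambda>m. slab_integral k (d m) \<eta>)
    \<longlonglongrightarrow> 2 * pi / norm \<eta> * enn2real (\<integral>\<^sup>+z. ennreal (k z) \<partial>hyperplane_lborel \<eta>)"
proof -
  have [measurable]: "k \<in> borel_measurable borel" using cont by (rule borel_measurable_continuous_onI)
  let ?N = "hyperplane_lborel \<eta>"
  define I where "I m z = (\<integral>\<^sup>+r. ennreal (k (z + (d m / norm \<eta> * r) *\<^sub>R (\<eta> /\<^sub>R norm \<eta>))) * ennreal (gauss r) \<partial>lborel)" for m z
  have k1': "k y \<le> 1" for y using k1[of y] indicator_le_1[of "cball 0 R" y] by (rule order_trans)
  have I: "(\<lambda>m. I m z) \<longlonglongrightarrow> ennreal (k z)" for z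
  proof -
    have "(\<lambda>m. I m z) \<longlonglongrightarrow> (\<integral>\<^sup>+r. ennreal (k z) * ennreal (gauss (r::real)) \<partial>lborel)"
      unfolding I_def
    proof (rule nn_integral_dominated_convergence[where w = "\<lambda>r. ennreal (gauss r)"])
      show "AE r in lborel. ennreal (k (z + (d m / norm \<eta> * r) *\<^sub>R (\<eta> /\<^sub>R norm \<eta>))) * ennreal (gauss r) \<le> ennreal (gauss r)" for m
        using k1' k0 by (intro AE_I2) (simp add: ennreal_mult[symmetric] mult_left_le_one_le)
      show "AE r in lborel. (\<lambda>m. ennreal (k (z + (d m / norm \<eta> * r) *\<^sub>R (\<eta> /\<^sub>R norm \<eta>))) * ennreal (gauss r))
          \<longlonglongrightarrow> ennreal (k z) * ennreal (gauss r)"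
      proof (intro AE_I2 tendsto_mult_ennreal tendsto_ennrealI tendsto_const)
        fix r :: real
        have "(\<lambda>m. z + (d m / norm \<eta> * r) *\<^sub>R (\<eta> /\<^sub>R norm \<eta>)) \<longlonglongrightarrow> z + (0 / norm \<eta> * r) *\<^sub>R (\<eta> /\<^sub>R norm \<eta>)"
          using \<open>\<eta> \<noteq> 0\<close> by (intro tendsto_intros d) auto
        moreover have "isCont k z" using cont by (simp add: continuous_on_eq_continuous_at)
        ultimately show "(\<lambda>m. k (z + (d m / norm \<eta> * r) *\<^sub>R (\<eta> /\<^sub>R norm \<eta>))) \<longlonglongrightarrow> k z"
          by (intro isCont_tendsto_compose[of z k]) auto
      qed auto
    qed (auto simp: nn_integral_gauss)
    then show ?thesis by (simp add: nn_integral_cmult nn_integral_gauss)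
  qed
  have fin: "(\<integral>\<^sup>+z. ennreal (k z) \<partial>?N) < \<infinity>"
    using section_integral_le[of k R \<eta>, OF k1 \<open>\<eta> \<noteq> 0\<close> \<open>R > 0\<close>] by (simp add: order_le_less_trans)
  have "(\<lambda>m. (\<integral>\<^sup>+z. I m z \<partial>?N)) \<longlonglongrightarrow> (\<integral>\<^sup>+z. ennreal (k z) \<partial>?N)"
  proof (rule nn_integral_dominated_convergence[where w = "indicator (cball 0 R)"])
    show "AE z in ?N. I m z \<le> indicator (cball 0 R) z" for m
      using AE_subspace_lborel[of \<eta>] unfolding I_def by eventually_elim (rule slab_inner_le[OF _ k1], auto)
    show "(\<integral>\<^sup>+z. indicator (cball 0 R) z \<partial>?N) < \<infinity>"
      using section_cball_le[OF \<open>\<eta> \<noteq> 0\<close> \<open>R > 0\<close>] by (simp add: order_le_less_trans)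
    show "AE z in ?N. (\<lambda>m. I m z) \<longlonglongrightarrow> ennreal (k z)" by (intro AE_I2 I)
  qed (auto simp: I_def)
  then have "(\<lambda>m. ennreal (2 * pi / norm \<eta>) * (\<integral>\<^sup>+z. I m z \<partial>?N)) \<longlonglongrightarrow> ennreal (2 * pi / norm \<eta>) * (\<integral>\<^sup>+z. ennreal (k z) \<partial>?N)"
    by (intro ennreal_tendsto_cmult) auto
  moreover have "ennreal (2 * pi / norm \<eta>) * (\<integral>\<^sup>+z. I m z \<partial>?N) = ennreal (slab_integral k (d m) \<eta>)" for m
    unfolding I_def by (rule slab_integral_slice[OF _ k0 k1 d0 \<open>\<eta> \<noteq> 0\<close>, symmetric]) simp
  moreover have "ennreal (2 * pi / norm \<eta>) * (\<integral>\<^sup>+z. ennreal (k z) \<partial>?N)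
      = ennreal (2 * pi / norm \<eta> * enn2real (\<integral>\<^sup>+z. ennreal (k z) \<partial>?N))"
    using fin by (subst ennreal_mult) simp_all
  ultimately have "(\<lambda>m. ennreal (slab_integral k (d m) \<eta>)) \<longlonglongrightarrow> ennreal (2 * pi / norm \<eta> * enn2real (\<integral>\<^sup>+z. ennreal (k z) \<partial>?N))"
    by simp
  then show ?thesis
    by (subst (asm) tendsto_ennreal_iff) (auto intro!: always_eventually slab_integral_nonneg k0 d0)
qed


section \<open>From slabs to sections, and from continuous functions to compact sets\<close>

lemma integrable_gauss_div_norm:
  fixes \<xi> :: "'a::euclidean_space"
  assumes "DIM('a) \<ge> 2"
  shows "integrable lborel (\<lambda>\<eta>. gauss \<eta> * (1 / norm (\<xi> + \<eta>)))"
proof (rule integrableI_nonneg)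
  have "(\<integral>\<^sup>+\<eta>. ennreal (gauss \<eta> * (1 / norm (\<xi> + \<eta>))) \<partial>lborel)
      = (\<integral>\<^sup>+\<eta>. ennreal (gauss \<eta>) * ennreal (1 / norm (\<xi> + \<eta>)) \<partial>lborel)"
    by (simp add: ennreal_mult[symmetric])
  also have "\<dots> \<le> inv_norm_const TYPE('a) + (\<integral>\<^sup>+\<eta>. ennreal (gauss (\<eta>::'a)) \<partial>lborel)"
    by (rule nn_integral_div_norm_le) (auto simp: gauss_le_1)
  also have "\<dots> < \<infinity>"
    using inv_norm_const_finite[OF assms] by (simp add: nn_integral_gauss)
  finally show "(\<integral>\<^sup>+\<eta>. ennreal (gauss \<eta> * (1 / norm (\<xi> + \<eta>))) \<partial>lborel) < \<infinity>" .
qed auto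

lemma integrable_cone:
  fixes k :: "'a::euclidean_space \<Rightarrow> real"
  assumes "DIM('a) \<ge> 2" and [measurable]: "k \<in> borel_measurable borel" and k0: "\<And>y. 0 \<le> k y" and k1: "\<And>y. k y \<le> indicator (cball 0 R) y"
  shows "integrable lborel (\<lambda>p::real \<times> 'a. norm (fst p *\<^sub>R snd p) ^ j * (k (snd p) * cone_exp p))"
    (is "integrable lborel ?h")
proof (rule integrableI_nonneg)
  let ?r = "\<lambda>p. ennreal (norm (fst p *\<^sub>R snd p) ^ j * cone_exp p)
        * indicator (cball (0::'a) R) (snd p)"
  have "(\<integral>\<^sup>+p. ennreal (?h p) \<partial>(lborel :: (real \<times> 'a) measure))
     \<le> (\<integral>\<^sup>+p. ?r p \<partial>lborel)"
  proof (rule nn_integral_mono)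
    fix p :: "real \<times> 'a"
    have "?h p
       \<le> norm (fst p *\<^sub>R snd p) ^ j * (indicator (cball 0 R) (snd p) * cone_exp p)"
      by (intro mult_left_mono mult_right_mono k1) auto
    also have "ennreal \<dots> = ?r p"
      by (auto simp: indicator_def)
    finally show "ennreal (?h p)
      \<le> ?r p"
      by (simp add: ennreal_leI)
  qed
  also have "\<dots> < \<infinity>" by (rule nn_integral_cone_moment_finite[OF assms(1)])
  finally show "(\<integral>\<^sup>+p. ennreal (?h p) \<partial>(lborel :: (real \<times> 'a) measure)) < \<infinity>" .
qed (auto simp: k0 borel_prod[symmetric])

text \<open>The integrand over \<eta> in the overview's formula for the transform of \<rho>_C, with
  k in place of the indicator. Under the bound by a ball indicator the section integrals are finite
  for \<xi> + \<eta> \<noteq> 0; at \<xi> + \<eta> = 0 division by zero makes the value 0.\<close>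

definition section_density :: "('a::euclidean_space \<Rightarrow> real) \<Rightarrow> 'a \<Rightarrow> 'a \<Rightarrow> real" where
  "section_density k \<xi> \<eta> = gauss \<eta> * (2 * pi / norm (\<xi> + \<eta>)
     * enn2real (\<integral>\<^sup>+z. ennreal (k z) \<partial>hyperplane_lborel (\<xi> + \<eta>)))"

lemma section_density_le:
  fixes k :: "'a::euclidean_space \<Rightarrow> real"
  assumes k1: "\<And>y. k y \<le> indicator (cball 0 R) y" and "\<xi> + \<eta> \<noteq> 0" and "R > 0"
  shows "norm (section_density k \<xi> \<eta>) \<le> 2 * pi * section_bound TYPE('a) R * (gauss \<eta> * (1 / norm (\<xi> + \<eta>)))"
proof -
  have "enn2real (\<integral>\<^sup>+z. ennreal (k z) \<partial>hyperplane_lborel (\<xi> + \<eta>)) \<le> section_bound TYPE('a) R"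
    using section_integral_le[OF assms] section_bound_nonneg[OF \<open>R > 0\<close>, where 'a = 'a] by (intro enn2real_leI)
  then have "section_density k \<xi> \<eta> \<le> gauss \<eta> * (2 * pi / norm (\<xi> + \<eta>) * section_bound TYPE('a) R)"
    unfolding section_density_def by (intro mult_left_mono) auto
  moreover have "0 \<le> section_density k \<xi> \<eta>" by (simp add: section_density_def)
  ultimately show ?thesis by (simp add: mult_ac)
qed

lemma AE_translate_nonzero: "AE \<eta> in lborel. \<xi> + \<eta> \<noteq> (0::'a::euclidean_space)"
  using AE_lborel_singleton[of "-\<xi>"] by eventually_elim (simp add: add_eq_0_iff)

text \<open>Stated with both arguments varying so that it covers two limits: k fixed with \<delta>
  \<rightarrow> 0, and \<delta> = 0 with continuous functions tending to an indicator.\<close>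

lemma cone_cos_tendsto:
  fixes k :: "'a::euclidean_space \<Rightarrow> real" and K :: "nat \<Rightarrow> 'a \<Rightarrow> real"
  assumes "DIM('a) \<ge> 2" and [measurable]: "\<And>m. K m \<in> borel_measurable borel" "k \<in> borel_measurable borel"
    and k0: "\<And>m y. 0 \<le> K m y" and k1: "\<And>m y. K m y \<le> indicator (cball 0 R) y"
    and lim: "\<And>y. (\<lambda>m. K m y) \<longlonglongrightarrow> k y" and "d \<longlonglongrightarrow> 0"
  shows "(\<lambda>m. cone_cos (K m) (d m) \<xi>) \<longlonglongrightarrow> cone_cos k 0 \<xi>"
  unfolding cone_cos_def
proof (rule integral_dominated_convergence)
  let ?s = "\<lambda>m p. K m (snd p) * cone_exp p * exp (- (d m * fst p)\<^sup>2 / 2) * cos (fst p * (snd p \<bullet> \<xi>))"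
  \<comment> \<open>The zeroth power matches the moment form of
    \<open>integrable_cone\<close>.\<close>
  let ?w = "\<lambda>p::real \<times> 'a. norm (fst p *\<^sub>R snd p) ^ 0 * (indicator (cball 0 R) (snd p) * cone_exp p)"
  show "integrable lborel ?w"
    by (rule integrable_cone[OF assms(1)]) auto
  show "AE p in lborel. norm (?s m p)
     \<le> ?w p" for m
  proof (rule AE_I2)
    fix p :: "real \<times> 'a"
    have "exp (- (d m * fst p)\<^sup>2 / 2) * \<bar>cos (fst p * (snd p \<bullet> \<xi>))\<bar> \<le> 1"
      by (intro mult_le_one) auto
    then have "(K m (snd p) * cone_exp p) * (exp (- (d m * fst p)\<^sup>2 / 2) * \<bar>cos (fst p * (snd p \<bullet> \<xi>))\<bar>)
       \<le> (indicator (cball 0 R) (snd p) * cone_exp p) * 1"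
      using k0 k1 by (intro mult_mono) auto
    then show "norm (?s m p)
     \<le> ?w p"
      using k0 by (simp add: abs_mult mult.assoc)
  qed
  show "AE p in lborel. (\<lambda>m. ?s m p)
     \<longlonglongrightarrow> k (snd p) * cone_exp p * exp (- (0 * fst p)\<^sup>2 / 2) * cos (fst p * (snd p \<bullet> \<xi>))"
    by (intro AE_I2 tendsto_intros lim assms) auto
qed (auto simp: borel_prod[symmetric])

text \<open>The hyperplane measures are picked by \<open>SOME\<close> separately for each normal, so
  measurability in \<eta> cannot be read off \<open>section_density\<close>. It is inherited from
  the approximants \<open>s m\<close> as a pointwise limit.\<close>

lemma section_density_dominated:
  fixes k :: "'a::euclidean_space \<Rightarrow> real" and s :: "nat \<Rightarrow> 'a \<Rightarrow> real"
  assumes "DIM('a) \<ge> 2" and [measurable]: "\<And>m. s m \<in> borel_measurable borel"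
    and lim: "\<And>\<eta>. \<xi> + \<eta> \<noteq> 0 \<Longrightarrow> (\<lambda>m. s m \<eta>) \<longlonglongrightarrow> section_density k \<xi> \<eta>"
    and bd: "\<And>m \<eta>. \<xi> + \<eta> \<noteq> 0 \<Longrightarrow> norm (s m \<eta>) \<le> B * (gauss \<eta> * (1 / norm (\<xi> + \<eta>)))"
  shows "integrable lborel (section_density k \<xi>)"
    and "(\<lambda>m. LBINT \<eta>. s m \<eta>) \<longlonglongrightarrow> (LBINT \<eta>. section_density k \<xi> \<eta>)"
proof -
  have meas: "section_density k \<xi> \<in> borel_measurable borel"
  proof (rule borel_measurable_LIMSEQ_real)
    \<comment> \<open>At \<eta> = - \<xi> the density is 0 by division by zero; setting the
      approximants to 0 there makes the convergence hold everywhere.\<close>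
    show "(\<lambda>m. if \<eta> = - \<xi> then 0 else s m \<eta>) \<longlonglongrightarrow> section_density k \<xi> \<eta>" for \<eta>
      using lim[of \<eta>] by (cases "\<eta> = - \<xi>") (auto simp: section_density_def add_eq_0_iff)
  qed measurable
  let ?w = "\<lambda>\<eta>. B * (gauss \<eta> * (1 / norm (\<xi> + \<eta>)))"
  have w: "integrable lborel ?w"
    by (intro integrable_mult_right integrable_gauss_div_norm assms)
  have bd': "AE \<eta> in lborel. norm (s m \<eta>) \<le> ?w \<eta>" for m
    using AE_translate_nonzero[of \<xi>] by eventually_elim (rule bd)
  have AElim: "AE \<eta> in lborel. (\<lambda>m. s m \<eta>) \<longlonglongrightarrow> section_density k \<xi> \<eta>"
    using AE_translate_nonzero[of \<xi>] by eventually_elim (rule lim)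
  show "integrable lborel (section_density k \<xi>)"
    by (rule integrable_dominated_convergence[OF _ _ w AElim bd']) (auto simp: meas)
  show "(\<lambda>m. LBINT \<eta>. s m \<eta>) \<longlonglongrightarrow> (LBINT \<eta>. section_density k \<xi> \<eta>)"
    by (rule integral_dominated_convergence[OF _ _ w AElim bd']) (auto simp: meas)
qed

text \<open>Both sides of \<open>cone_cos_eq_slab\<close> have a limit as \<delta> \<rightarrow> 0;
  uniqueness of limits gives the identity at \<delta> = 0, where the integral over s could not be
  exchanged directly.\<close>

lemma cone_cos_eq_sections_continuous:
  fixes k :: "'a::euclidean_space \<Rightarrow> real"
  assumes "DIM('a) \<ge> 2" and cont: "continuous_on UNIV k"
    and k0: "\<And>y. 0 \<le> k y" and k1: "\<And>y. k y \<le> indicator (cball 0 R) y" and "R > 0"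
  shows "integrable lborel (section_density k \<xi>) \<and> cone_cos k 0 \<xi> = (LBINT \<eta>. section_density k \<xi> \<eta>)"
proof -
  have [measurable]: "k \<in> borel_measurable borel" using cont by (rule borel_measurable_continuous_onI)
  define d where "d m = 1 / real (Suc m)" for m
  have d: "d m > 0" "d \<longlonglongrightarrow> 0" for m
    using LIMSEQ_inverse_real_of_nat by (simp_all add: d_def[abs_def] inverse_eq_divide)
  define s where "s m \<eta> = gauss \<eta> * slab_integral k (d m) (\<xi> + \<eta>)" for m \<eta>
  have [measurable]: "slab_integral k \<delta> \<in> borel_measurable borel" for \<delta>
    unfolding slab_integral_def by measurable
  have [measurable]: "s m \<in> borel_measurable borel" for m
    unfolding s_def by measurable
  have lim: "(\<lambda>m. s m \<eta>) \<longlonglongrightarrow> section_density k \<xi> \<eta>" if "\<xi> + \<eta> \<noteq> 0" for \<eta>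
    unfolding s_def section_density_def
    by (intro tendsto_mult tendsto_const slab_integral_tendsto[OF cont k0 k1 that \<open>R > 0\<close> d])
  have bd: "norm (s m \<eta>) \<le> 2 * pi * section_bound TYPE('a) R * (gauss \<eta> * (1 / norm (\<xi> + \<eta>)))" if "\<xi> + \<eta> \<noteq> 0" for m \<eta>
  proof -
    have "s m \<eta> \<le> gauss \<eta> * (2 * pi / norm (\<xi> + \<eta>) * section_bound TYPE('a) R)"
      unfolding s_def using that by (intro mult_left_mono slab_integral_le k0 k1 d \<open>R > 0\<close>) auto
    moreover have "0 \<le> s m \<eta>" unfolding s_def by (intro mult_nonneg_nonneg slab_integral_nonneg k0 d(1)) simp
    ultimately show ?thesis by (simp add: mult_ac)
  qed
  note dom = section_density_dominated[of s, OF assms(1) _ lim bd]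
  have "(\<lambda>m. cone_cos k (d m) \<xi>) \<longlonglongrightarrow> cone_cos k 0 \<xi>"
    by (rule cone_cos_tendsto[OF assms(1) _ _ k0 k1 _ d(2)]) auto
  then have "(\<lambda>m. LBINT \<eta>. s m \<eta>) \<longlonglongrightarrow> cone_cos k 0 \<xi>"
    by (subst (asm) cone_cos_eq_slab[OF _ k0 k1 d(1)]) (auto simp: s_def)
  with dom show ?thesis using LIMSEQ_unique by force
qed

text \<open>Tent functions of the distance to C, of slope m + 1. They vanish at distance 1 or more,
  hence the enlarged radius r + 1, and they approximate from above, so their difference from the
  indicator is nonnegative.\<close>

lemma continuous_approx_indicator:
  fixes C :: "'a::euclidean_space set"
  assumes "compact C" "C \<noteq> {}"
  obtains R K where "R > 0" "C \<subseteq> cball 0 R" "\<And>m. continuous_on UNIV (K m)" "\<And>m y. 0 \<le> (K m y :: real)"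
    "\<And>m y. K m y \<le> indicator (cball 0 R) y" "\<And>y. (\<lambda>m::nat. K m y) \<longlonglongrightarrow> indicator C y"
    "\<And>m y. indicator C y \<le> K m y"
proof -
  obtain r where r: "r > 0" "C \<subseteq> cball 0 r"
    using compact_imp_bounded[OF assms(1)] unfolding bounded_pos by (auto simp: subset_eq)
  define K where "K m y = max 0 (1 - real (Suc m) * infdist y C)" for m y
  have ind: "infdist y C = 0" if "y \<in> C" for y using that by simp
  have pos: "infdist y C > 0" if "y \<notin> C" for y
    using that assms compact_imp_closed[OF assms(1)] in_closed_iff_infdist_zero[of C y] infdist_nonneg[of y C] by force
  show ?thesis
  proof (rule that[of "r + 1" K])
    show "r + 1 > 0" "C \<subseteq> cball 0 (r + 1)" using r by auto
    show "continuous_on UNIV (K m)" for m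
      unfolding K_def by (intro continuous_intros)
    show "0 \<le> K m y" for m y by (simp add: K_def)
    show "K m y \<le> indicator (cball 0 (r + 1)) y" for m y
    proof (cases "y \<in> cball 0 (r + 1)")
      case True
      then show ?thesis using infdist_nonneg[of y C] by (simp add: K_def)
    next
      case False
      have "1 \<le> infdist y C"
        unfolding infdist_notempty[OF assms(2)]
      proof (rule cINF_greatest[OF assms(2)])
        fix a assume "a \<in> C"
        then have "norm a \<le> r" using r by auto
        then show "1 \<le> dist y a" using False norm_triangle_ineq2[of y a] by (simp add: dist_norm)
      qed
      then have "1 \<le> real (Suc m) * infdist y C"
        using mult_mono[of 1 "real (Suc m)" 1 "infdist y C"] by simp
      then show ?thesis by (simp add: K_def)
    qed
    show "indicator C y \<le> K m y" for m y
      using ind[of y] by (simp add: K_def indicator_def)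
    show "(\<lambda>m. K m y) \<longlonglongrightarrow> indicator C y" for y
    proof (cases "y \<in> C")
      case True then show ?thesis by (simp add: K_def)
    next
      case False
      obtain N where N: "1 < real N * infdist y C"
        using reals_Archimedean3[OF pos[OF False]] by auto
      have "K m y = 0" if "m \<ge> N" for m
      proof -
        have "real N * infdist y C \<le> real (Suc m) * infdist y C"
          using that infdist_nonneg by (intro mult_right_mono) auto
        then show ?thesis using N by (simp add: K_def)
      qed
      then have "\<forall>\<^sub>F m in sequentially. K m y = indicator C y"
        using False by (auto simp: eventually_sequentially)
      then show ?thesis by (rule tendsto_eventually)
    qed
  qed
qed

text \<open>The section integrals of the tents converge on each hyperplane by dominated convergence,
  with the section of a ball as bound. A second dominated convergence over \<eta> then carries the
  continuous case to the indicator of C.\<close>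

lemma cone_cos_eq_sections:
  fixes C :: "'a::euclidean_space set"
  assumes "DIM('a) \<ge> 2" and "compact C" "C \<noteq> {}"
  shows "integrable lborel (section_density (indicator C) \<xi>)
    \<and> cone_cos (indicator C) 0 \<xi> = (LBINT \<eta>. section_density (indicator C) \<xi> \<eta>)"
proof -
  obtain R K where R: "R > 0" "C \<subseteq> cball 0 R" and cont: "\<And>m. continuous_on UNIV (K m)"
    and k0: "\<And>m y. 0 \<le> (K m y :: real)" and k1: "\<And>m y. K m y \<le> indicator (cball 0 R) y"
    and Klim: "\<And>y. (\<lambda>m::nat. K m y) \<longlonglongrightarrow> indicator C y"
    by (rule continuous_approx_indicator[OF assms(2,3)]) auto
  have [measurable]: "C \<in> sets borel" using assms(2) by (simp add: borel_compact)
  have [measurable]: "K m \<in> borel_measurable borel" for m using cont by (rule borel_measurable_continuous_onI)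
  have K: "integrable lborel (section_density (K m) \<xi>)" "cone_cos (K m) 0 \<xi> = (LBINT \<eta>. section_density (K m) \<xi> \<eta>)" for m
    using cone_cos_eq_sections_continuous[OF assms(1) cont k0 k1 R(1)] by auto
  have C1: "indicator C y \<le> (indicator (cball 0 R) y :: real)" for y using R(2) by (auto simp: indicator_def)
  have lim: "(\<lambda>m. section_density (K m) \<xi> \<eta>) \<longlonglongrightarrow> section_density (indicator C) \<xi> \<eta>" if "\<xi> + \<eta> \<noteq> 0" for \<eta>
    unfolding section_density_def
  proof (intro tendsto_mult tendsto_const tendsto_enn2real)
    let ?N = "hyperplane_lborel (\<xi> + \<eta>)"
    have "(\<integral>\<^sup>+z. ennreal (indicator C z) \<partial>?N) < top"
      using section_integral_le[of "indicator C", OF C1 that R(1)] by (simp add: order_le_less_trans)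
    then show "(\<lambda>m. \<integral>\<^sup>+z. ennreal (K m z) \<partial>?N) \<longlonglongrightarrow> ennreal (enn2real (\<integral>\<^sup>+z. ennreal (indicator C z) \<partial>?N))"
    proof (simp only: ennreal_enn2real, intro nn_integral_dominated_convergence[where w = "indicator (cball 0 R)"])
      show "AE z in ?N. ennreal (K m z) \<le> indicator (cball 0 R) z" for m
        using ennreal_leI[OF k1] by (simp add: ennreal_indicator)
      show "(\<integral>\<^sup>+z. indicator (cball 0 R) z \<partial>?N) < \<infinity>"
        using section_cball_le[OF that R(1)] by (simp add: order_le_less_trans)
      show "AE z in ?N. (\<lambda>m. ennreal (K m z)) \<longlonglongrightarrow> ennreal (indicator C z)"
        by (intro AE_I2 tendsto_ennrealI Klim)
    qed auto
  qed auto
  have mK: "section_density (K m) \<xi> \<in> borel_measurable borel" for m using K(1)[of m] by auto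
  note dom = section_density_dominated[of "\<lambda>m. section_density (K m) \<xi>", OF assms(1) mK lim section_density_le[OF k1 _ R(1)]]
  have "(\<lambda>m. cone_cos (K m) 0 \<xi>) \<longlonglongrightarrow> cone_cos (indicator C) 0 \<xi>"
    by (rule cone_cos_tendsto[OF assms(1) _ _ k0 k1 Klim tendsto_const]) auto
  with dom show ?thesis unfolding K(2) using LIMSEQ_unique by blast
qed

lemma section_volume_eq:
  fixes \<eta> :: "'a::euclidean_space"
  assumes "\<eta> \<noteq> 0" and [measurable]: "C \<in> sets borel"
  shows "(\<integral>\<^sup>+z. ennreal (indicator C z) \<partial>hyperplane_lborel \<eta>) = section_volume C (\<eta> /\<^sub>R norm \<eta>)"
proof -
  \<comment> \<open>Equality as sets matters: the same set yields the same chosen basis and hence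
    the same measure.\<close>
  have eq: "orth_hyperplane (\<eta> /\<^sub>R norm \<eta>) = orth_hyperplane \<eta>"
    using assms(1) by (auto simp: orth_hyperplane_def)
  have "(\<integral>\<^sup>+z. ennreal (indicator C z) \<partial>hyperplane_lborel \<eta>)
      = (\<integral>\<^sup>+z. indicator (C \<inter> orth_hyperplane \<eta>) z \<partial>hyperplane_lborel \<eta>)"
    using AE_subspace_lborel[of \<eta>]
    by (intro nn_integral_cong_AE, eventually_elim) (auto simp: indicator_def orth_hyperplane_def)
  then show ?thesis by (simp add: section_volume_def eq)
qed

text \<open>The comparison of sections enters here, at the unit normal in direction \<xi> + \<eta>
  for almost every \<eta>; the remaining factors of the density are nonnegative.\<close>

lemma cone_cos_mono_sections:
  fixes K L :: "'a::euclidean_space set"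
  assumes dim: "DIM('a) \<ge> 2" and K: "compact K" "K \<noteq> {}" and L: "compact L" "L \<noteq> {}"
    and le: "\<And>\<xi>. \<xi> \<in> sphere 0 1 \<Longrightarrow> section_volume K \<xi> \<le> section_volume L \<xi>"
  shows "cone_cos (indicator K) 0 \<xi> \<le> cone_cos (indicator L) 0 \<xi>"
proof -
  have "(LBINT \<eta>. section_density (indicator K) \<xi> \<eta>) \<le> (LBINT \<eta>. section_density (indicator L) \<xi> \<eta>)"
  proof (rule integral_mono_AE)
    show "AE \<eta> in lborel. section_density (indicator K) \<xi> \<eta> \<le> section_density (indicator L) \<xi> \<eta>"
      using AE_translate_nonzero[of \<xi>]
    proof eventually_elim
      case (elim \<eta>)
      let ?S = "\<lambda>C. \<integral>\<^sup>+z. ennreal (indicator C z) \<partial>hyperplane_lborel (\<xi> + \<eta>)"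
      \<comment> \<open>\<open>enn2real\<close> sends \<infinity> to 0, so comparing real section
        volumes requires the larger one to be finite.\<close>
      obtain R where R: "R > 0" "L \<subseteq> cball 0 R"
        by (rule continuous_approx_indicator[OF L]) auto
      have "?S L \<le> ennreal (section_bound TYPE('a) R)"
        by (rule section_integral_le[OF _ elim R(1)]) (use R in \<open>auto simp: indicator_def\<close>)
      then have fin: "?S L < top"
        by (rule order_le_less_trans) simp
      have "?S K
         \<le> ?S L"
        using le[of "(\<xi> + \<eta>) /\<^sub>R norm (\<xi> + \<eta>)"] elim K(1) L(1)
        by (subst (1 2) section_volume_eq) (auto simp: borel_compact)
      then show ?case
        unfolding section_density_def using fin
        by (intro mult_left_mono enn2real_mono) auto
    qed
  qed (use cone_cos_eq_sections[OF dim K] cone_cos_eq_sections[OF dim L] in auto)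
  then show ?thesis
    using cone_cos_eq_sections[OF dim K] cone_cos_eq_sections[OF dim L] by auto
qed

section \<open>A class of Schwartz functions\<close>

text \<open>Finite moments of every order allow arbitrarily many differentiations under the
  integral. The weight q is complex because each derivative of the transform in direction b
  multiplies it by \<i> (w \<bullet> b).\<close>

definition moments_finite :: "'a::euclidean_space measure \<Rightarrow> ('a \<Rightarrow> complex) \<Rightarrow> bool" where
  "moments_finite \<rho> q \<longleftrightarrow> sets \<rho> = sets borel \<and> (\<forall>k. integrable \<rho> (\<lambda>w. norm w ^ k *\<^sub>R q w))"

definition fourier_weighted :: "'a::euclidean_space measure \<Rightarrow> ('a \<Rightarrow> complex) \<Rightarrow> 'a \<Rightarrow> complex" where
  "fourier_weighted \<rho> q \<xi> = (LINT w|\<rho>. q w * iexp (w \<bullet> \<xi>))"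

text \<open>
  This class contains the test functions below and is stable under partial derivatives, whence all
  its members are Schwartz functions.
\<close>

inductive gauss_span :: "'a::euclidean_space measure \<Rightarrow> real \<Rightarrow> ('a \<Rightarrow> complex) \<Rightarrow> bool" for \<rho> a where
  base: "moments_finite \<rho> q \<Longrightarrow> gauss_span \<rho> a (\<lambda>\<xi>. complex_of_real (exp (- a * (norm \<xi>)\<^sup>2)) * fourier_weighted \<rho> q \<xi>)"
| coord: "gauss_span \<rho> a \<phi> \<Longrightarrow> gauss_span \<rho> a (\<lambda>\<xi>. complex_of_real (\<xi> \<bullet> b) * \<phi> \<xi>)"
| add: "gauss_span \<rho> a \<phi> \<Longrightarrow> gauss_span \<rho> a \<psi> \<Longrightarrow> gauss_span \<rho> a (\<lambda>\<xi>. \<phi> \<xi> + \<psi> \<xi>)"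
| scale: "gauss_span \<rho> a \<phi> \<Longrightarrow> gauss_span \<rho> a (\<lambda>\<xi>. c * \<phi> \<xi>)"

section \<open>Differentiation and decay of Gaussian-damped Fourier transforms\<close>

lemma moments_finite_measurable:
  "moments_finite \<rho> q \<Longrightarrow> q \<in> borel_measurable \<rho>"
  unfolding moments_finite_def by (auto dest!: spec[of _ 0])

lemma moments_finite_integrable:
  assumes "moments_finite \<rho> q"
  shows "integrable \<rho> q" and "integrable \<rho> (\<lambda>w. norm w ^ k * norm (q w))"
proof -
  have k: "integrable \<rho> (\<lambda>w. norm w ^ k *\<^sub>R q w)" for k
    using assms by (auto simp: moments_finite_def)
  show "integrable \<rho> q" using k[of 0] by simp
  show "integrable \<rho> (\<lambda>w. norm w ^ k * norm (q w))"
    using integrable_norm[OF k[of k]] by simp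
qed

lemma moments_finite_finite_measure:
  assumes "moments_finite \<rho> (\<lambda>_. 1)"
  shows "finite_measure \<rho>"
  using moments_finite_integrable(1)[OF assms]
  by (intro finite_measureI) (auto simp: integrable_iff_bounded less_top)

lemma moments_finite_coord:
  assumes q: "moments_finite \<rho> q"
  shows "moments_finite \<rho> (\<lambda>w. \<i> * of_real (w \<bullet> b) * q w)"
  unfolding moments_finite_def
proof (intro conjI allI)
  show s [measurable_cong]: "sets \<rho> = sets borel" using q by (simp add: moments_finite_def)
  note [measurable] = moments_finite_measurable[OF q]
  fix k
  show "integrable \<rho> (\<lambda>w. norm w ^ k *\<^sub>R (\<i> * of_real (w \<bullet> b) * q w))"
  proof (rule Bochner_Integration.integrable_bound)
    show "integrable \<rho> (\<lambda>w. norm b * (norm w ^ Suc k * norm (q w)))"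
      by (intro integrable_mult_right moments_finite_integrable q)
    show "AE w in \<rho>. norm (norm w ^ k *\<^sub>R (\<i> * of_real (w \<bullet> b) * q w)) \<le> norm (norm b * (norm w ^ Suc k * norm (q w)))"
    proof (rule AE_I2)
      fix w
      have "\<bar>w \<bullet> b\<bar> \<le> norm w * norm b" by (rule Cauchy_Schwarz_ineq2)
      then have "\<bar>w \<bullet> b\<bar> * (norm w ^ k * norm (q w)) \<le> norm w * norm b * (norm w ^ k * norm (q w))"
        by (intro mult_right_mono) auto
      then show "norm (norm w ^ k *\<^sub>R (\<i> * of_real (w \<bullet> b) * q w)) \<le> norm (norm b * (norm w ^ Suc k * norm (q w)))"
        by (simp add: norm_mult abs_mult mult_ac)
    qed
  qed measurable
qed

lemma integrable_fourier_weighted: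
  assumes q: "moments_finite \<rho> q"
  shows "integrable \<rho> (\<lambda>w. q w * iexp (w \<bullet> \<xi>))"
proof -
  have [measurable_cong]: "sets \<rho> = sets borel" using q by (simp add: moments_finite_def)
  note [measurable] = moments_finite_measurable[OF q]
  show ?thesis
    by (rule Bochner_Integration.integrable_bound[OF moments_finite_integrable(1)[OF q]]) (auto simp: norm_mult)
qed

lemma norm_fourier_weighted_le:
  assumes q: "moments_finite \<rho> q"
  shows "norm (fourier_weighted \<rho> q \<xi>) \<le> (LINT w|\<rho>. norm (q w))"
proof -
  have "norm (fourier_weighted \<rho> q \<xi>) \<le> (LINT w|\<rho>. norm (q w * iexp (w \<bullet> \<xi>)))"
    unfolding fourier_weighted_def by (rule integral_norm_bound)
  then show ?thesis by (simp add: norm_mult)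
qed

text \<open>The Taylor estimate |exp (i t) - 1 - i t| \<le> t^2/2 is integrated directly: the
  remainder is at most the second moment of |q| times |y - \<xi>|^2. This yields the full Frechet
  derivative at once, not just partial derivatives.\<close>

lemma fourier_weighted_has_derivative:
  fixes \<rho> :: "'a::euclidean_space measure"
  assumes q: "moments_finite \<rho> q"
  shows "(fourier_weighted \<rho> q has_derivative (\<lambda>v. fourier_weighted \<rho> (\<lambda>w. \<i> * of_real (w \<bullet> v) * q w) \<xi>)) (at \<xi>)"
proof -
  have [measurable_cong]: "sets \<rho> = sets borel" using q by (simp add: moments_finite_def)
  note [measurable] = moments_finite_measurable[OF q]
  define D where "D v = fourier_weighted \<rho> (\<lambda>w. \<i> * of_real (w \<bullet> v) * q w) \<xi>" for v
  have iD: "integrable \<rho> (\<lambda>w. \<i> * of_real (w \<bullet> v) * q w * iexp (w \<bullet> \<xi>))" for v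
    by (rule integrable_fourier_weighted[OF moments_finite_coord[OF q]])
  have "linear D"
  proof (rule linearI)
    fix u v c
    have "D (u + v) = (LINT w|\<rho>. \<i> * of_real (w \<bullet> u) * q w * iexp (w \<bullet> \<xi>)
        + \<i> * of_real (w \<bullet> v) * q w * iexp (w \<bullet> \<xi>))"
      unfolding D_def fourier_weighted_def
      by (intro Bochner_Integration.integral_cong refl) (simp add: inner_add_right algebra_simps)
    also have "\<dots> = D u + D v"
      unfolding D_def fourier_weighted_def by (intro Bochner_Integration.integral_add iD)
    finally show "D (u + v) = D u + D v" .
    have "D (c *\<^sub>R u) = (LINT w|\<rho>. c *\<^sub>R (\<i> * of_real (w \<bullet> u) * q w * iexp (w \<bullet> \<xi>)))"
      unfolding D_def fourier_weighted_def
      by (intro Bochner_Integration.integral_cong refl) (simp add: scaleR_conv_of_real)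
    then show "D (c *\<^sub>R u) = c *\<^sub>R D u"
      unfolding D_def fourier_weighted_def by simp
  qed
  then have bl: "bounded_linear D" by (simp add: linear_conv_bounded_linear)
  define A where "A = (LINT w|\<rho>. norm w ^ 2 * norm (q w))"
  have rem: "norm (fourier_weighted \<rho> q y - fourier_weighted \<rho> q \<xi> - D (y - \<xi>)) \<le> A * norm (y - \<xi>) ^ 2" for y
  proof -
    define v where "v = y - \<xi>"
    define r where "r w = q w * iexp (w \<bullet> y) - q w * iexp (w \<bullet> \<xi>)
          - \<i> * of_real (w \<bullet> (y - \<xi>)) * q w * iexp (w \<bullet> \<xi>)" for w
    have eq: "fourier_weighted \<rho> q y - fourier_weighted \<rho> q \<xi> - D (y - \<xi>)
      = (LINT w|\<rho>. r w)"
      unfolding D_def fourier_weighted_def r_def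
      by (simp only: Bochner_Integration.integral_diff Bochner_Integration.integrable_diff iD integrable_fourier_weighted[OF q])
    have "norm (fourier_weighted \<rho> q y - fourier_weighted \<rho> q \<xi> - D (y - \<xi>))
       \<le> (LINT w|\<rho>. norm (r w))"
      unfolding eq by (rule integral_norm_bound)
    also have "\<dots> \<le> (LINT w|\<rho>. (norm w ^ 2 * norm (q w)) * norm v ^ 2)"
    proof (rule integral_mono)
      show "integrable \<rho> (\<lambda>w. norm (r w))"
        unfolding r_def using iD integrable_fourier_weighted[OF q] by (intro integrable_norm Bochner_Integration.integrable_diff)
      show "integrable \<rho> (\<lambda>w. (norm w ^ 2 * norm (q w)) * norm v ^ 2)"
        by (intro integrable_mult_left moments_finite_integrable q)
      fix w
      have "cmod (iexp (w \<bullet> v) - (\<Sum>k\<le>1. (\<i> * of_real (w \<bullet> v)) ^ k / fact k)) \<le> \<bar>w \<bullet> v\<bar> ^ Suc 1 / fact (Suc 1)"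
        by (rule iexp_approx1)
      then have "cmod (iexp (w \<bullet> v) - 1 - \<i> * of_real (w \<bullet> v)) \<le> \<bar>w \<bullet> v\<bar> ^ 2 / 2"
        by (simp add: diff_diff_eq power2_eq_square)
      also have "\<dots> \<le> \<bar>w \<bullet> v\<bar> ^ 2" by simp
      also have "\<dots> \<le> (norm w * norm v) ^ 2"
        by (intro power_mono Cauchy_Schwarz_ineq2) auto
      finally have le: "cmod (iexp (w \<bullet> v) - 1 - \<i> * of_real (w \<bullet> v)) \<le> (norm w * norm v) ^ 2" .
      have ey: "iexp (w \<bullet> y) = iexp (w \<bullet> \<xi>) * iexp (w \<bullet> v)"
        by (simp add: v_def exp_add[symmetric] inner_diff_right algebra_simps)
      have "r w = q w * iexp (w \<bullet> \<xi>) * (iexp (w \<bullet> v) - 1 - \<i> * of_real (w \<bullet> v))"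
        unfolding r_def ey v_def[symmetric] by (simp add: algebra_simps)
      then have "norm (r w)
        = norm (q w) * cmod (iexp (w \<bullet> v) - 1 - \<i> * of_real (w \<bullet> v))"
        by (simp add: norm_mult)
      also have "\<dots> \<le> norm (q w) * (norm w * norm v) ^ 2" by (intro mult_left_mono le) simp
      finally show "norm (r w)
        \<le> (norm w ^ 2 * norm (q w)) * norm v ^ 2"
        by (simp add: power_mult_distrib mult_ac)
    qed
    also have "\<dots> = A * norm (y - \<xi>) ^ 2" by (simp add: A_def v_def)
    finally show ?thesis .
  qed
  have "(fourier_weighted \<rho> q has_derivative D) (at \<xi>)"
  proof (rule has_derivativeI_sandwich[where e = 1 and H = "\<lambda>y. A * norm (y - \<xi>)"])
    show "norm (fourier_weighted \<rho> q y - fourier_weighted \<rho> q \<xi> - D (y - \<xi>)) / norm (y - \<xi>) \<le> A * norm (y - \<xi>)"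
      if "y \<noteq> \<xi>" for y
      using rem[of y] that by (simp add: divide_simps power2_eq_square mult_ac)
    show "((\<lambda>y. A * norm (y - \<xi>)) \<longlongrightarrow> 0) (at \<xi>)"
      by (rule tendsto_eq_intros refl | simp)+
  qed (use bl in auto)
  then show ?thesis by (simp add: D_def[abs_def])
qed

lemma gauss_span_has_derivative:
  fixes \<rho> :: "'a::euclidean_space measure"
  assumes "gauss_span \<rho> a \<phi>"
  shows "\<exists>D. (\<forall>x. (\<phi> has_derivative D x) (at x)) \<and> (\<forall>b. gauss_span \<rho> a (\<lambda>x. D x b))"
  using assms
proof induction
  case (base q)
  define g where "g \<xi> = complex_of_real (exp (- a * (norm \<xi>)\<^sup>2))" for \<xi> :: 'a
  have dg: "(g has_derivative (\<lambda>v. g \<xi> * complex_of_real (- 2 * a * (\<xi> \<bullet> v)))) (at \<xi>)" for \<xi>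
    unfolding g_def power2_norm_eq_inner
    by (rule derivative_eq_intros refl)+ (auto simp: inner_commute algebra_simps)
  show ?case
  proof (intro exI conjI allI)
    fix x
    show "((\<lambda>\<xi>. complex_of_real (exp (- a * (norm \<xi>)\<^sup>2)) * fourier_weighted \<rho> q \<xi>) has_derivative
      (\<lambda>v. g x * fourier_weighted \<rho> (\<lambda>w. \<i> * of_real (w \<bullet> v) * q w) x
        + g x * complex_of_real (- 2 * a * (x \<bullet> v)) * fourier_weighted \<rho> q x)) (at x)"
      using has_derivative_mult[OF dg[of x] fourier_weighted_has_derivative[OF base, of x]]
      by (simp add: g_def)
  next
    fix b :: 'a
    have "gauss_span \<rho> a (\<lambda>x. g x * fourier_weighted \<rho> (\<lambda>w. \<i> * of_real (w \<bullet> b) * q w) x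
       + complex_of_real (- 2 * a) * (complex_of_real (x \<bullet> b) * (g x * fourier_weighted \<rho> q x)))"
      unfolding g_def
      by (intro gauss_span.add gauss_span.scale gauss_span.coord gauss_span.base moments_finite_coord base)
    then show "gauss_span \<rho> a (\<lambda>x. g x * fourier_weighted \<rho> (\<lambda>w. \<i> * of_real (w \<bullet> b) * q w) x
        + g x * complex_of_real (- 2 * a * (x \<bullet> b)) * fourier_weighted \<rho> q x)"
      by (simp add: mult_ac)
  qed
next
  case (coord \<phi> b)
  then obtain D where D: "\<And>x. (\<phi> has_derivative D x) (at x)" "\<And>b. gauss_span \<rho> a (\<lambda>x. D x b)" by auto
  show ?case
  proof (intro exI conjI allI)
    fix x
    show "((\<lambda>\<xi>. complex_of_real (\<xi> \<bullet> b) * \<phi> \<xi>) has_derivative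
      (\<lambda>v. complex_of_real (x \<bullet> b) * D x v + complex_of_real (v \<bullet> b) * \<phi> x)) (at x)"
      by (rule derivative_eq_intros D refl)+ auto
  next
    fix c
    show "gauss_span \<rho> a (\<lambda>x. complex_of_real (x \<bullet> b) * D x c + complex_of_real (c \<bullet> b) * \<phi> x)"
      by (intro gauss_span.add gauss_span.scale gauss_span.coord D coord)
  qed
next
  case (add \<phi> \<psi>)
  then obtain D E where D: "\<And>x. (\<phi> has_derivative D x) (at x)" "\<And>b. gauss_span \<rho> a (\<lambda>x. D x b)"
    and E: "\<And>x. (\<psi> has_derivative E x) (at x)" "\<And>b. gauss_span \<rho> a (\<lambda>x. E x b)" by auto
  show ?case
    by (intro exI[of _ "\<lambda>x v. D x v + E x v"] conjI allI has_derivative_add gauss_span.add D E)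
next
  case (scale \<phi> c)
  then obtain D where D: "\<And>x. (\<phi> has_derivative D x) (at x)" "\<And>b. gauss_span \<rho> a (\<lambda>x. D x b)" by auto
  show ?case
    by (intro exI[of _ "\<lambda>x v. c * D x v"] conjI allI has_derivative_mult_right gauss_span.scale D)
qed

lemma power_mult_exp_sq_bounded:
  fixes a :: real
  assumes "a > 0"
  shows "\<exists>B. \<forall>t\<ge>0. t ^ k * exp (- a * t\<^sup>2) \<le> B"
proof (cases "k = 0")
  case True
  then show ?thesis using assms by (intro exI[of _ 1]) auto
next
  case False
  \<comment> \<open>Chosen so that the k-th power of exp (c t^2) is exp (a t^2).\<close>
  define c where "c = a / real k"
  have c: "c > 0" using assms False by (simp add: c_def)
  have "t ^ k * exp (- a * t\<^sup>2) \<le> 1 / sqrt c ^ k" if "t \<ge> 0" for t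
  proof -
    have "0 \<le> (1 - sqrt c * t)\<^sup>2 + c * t\<^sup>2 + 1" using c by simp
    then have "sqrt c * t \<le> 1 + c * t\<^sup>2"
      using c by (simp add: power2_diff power_mult_distrib)
    also have "\<dots> \<le> exp (c * t\<^sup>2)" by (rule exp_ge_add_one_self)
    finally have "(sqrt c * t) ^ k \<le> exp (c * t\<^sup>2) ^ k"
      using that c by (intro power_mono) auto
    also have "\<dots> = exp (a * t\<^sup>2)"
      using False by (simp add: exp_of_nat_mult[symmetric] c_def)
    finally have "sqrt c ^ k * (t ^ k * exp (- a * t\<^sup>2)) \<le> exp (a * t\<^sup>2) * exp (- a * t\<^sup>2)"
      by (simp add: power_mult_distrib mult.assoc[symmetric])
    also have "\<dots> = 1" by (simp add: exp_add[symmetric])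
    finally show ?thesis using c by (simp add: field_simps)
  qed
  then show ?thesis by blast
qed

lemma gauss_span_bounded:
  fixes \<rho> :: "'a::euclidean_space measure"
  assumes "gauss_span \<rho> a \<phi>" "a > 0"
  shows "\<exists>B. \<forall>x. norm x ^ k * norm (\<phi> x) \<le> B"
  using assms(1)
\<comment> \<open>A coordinate factor costs one more power of the norm, so the exponent must be free
  in the induction.\<close>
proof (induction arbitrary: k)
  case (base q)
  obtain B where B: "\<And>t. t \<ge> 0 \<Longrightarrow> t ^ k * exp (- a * t\<^sup>2) \<le> B"
    using power_mult_exp_sq_bounded[OF \<open>a > 0\<close>, of k] by auto
  have "norm x ^ k * norm (complex_of_real (exp (- a * (norm x)\<^sup>2)) * fourier_weighted \<rho> q x) \<le> B * (LINT w|\<rho>. norm (q w))" for x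
  proof -
    have "0 \<le> B" using B[of 0] by (smt (verit) exp_ge_zero mult_nonneg_nonneg zero_le_power)
    then have "(norm x ^ k * exp (- a * (norm x)\<^sup>2)) * norm (fourier_weighted \<rho> q x) \<le> B * (LINT w|\<rho>. norm (q w))"
      by (intro mult_mono B norm_fourier_weighted_le base) auto
    then show ?thesis by (simp add: norm_mult mult_ac)
  qed
  then show ?case by blast
next
  case (coord \<phi> b)
  obtain B where B: "\<And>x. norm x ^ Suc k * norm (\<phi> x) \<le> B" using coord.IH[of "Suc k"] by auto
  have "norm x ^ k * norm (complex_of_real (x \<bullet> b) * \<phi> x) \<le> norm b * B" for x
  proof -
    have "norm x ^ k * norm (complex_of_real (x \<bullet> b) * \<phi> x) \<le> norm x ^ k * (norm x * norm b * norm (\<phi> x))"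
      unfolding norm_mult norm_of_real by (intro mult_left_mono mult_right_mono Cauchy_Schwarz_ineq2) auto
    also have "\<dots> = norm b * (norm x ^ Suc k * norm (\<phi> x))" by simp
    also have "\<dots> \<le> norm b * B" by (intro mult_left_mono B) auto
    finally show ?thesis .
  qed
  then show ?case by blast
next
  case (add \<phi> \<psi>)
  obtain B C where B: "\<And>x. norm x ^ k * norm (\<phi> x) \<le> B" "\<And>x. norm x ^ k * norm (\<psi> x) \<le> C"
    using add.IH[of k] by auto
  have "norm x ^ k * norm (\<phi> x + \<psi> x) \<le> B + C" for x
  proof -
    have "norm x ^ k * norm (\<phi> x + \<psi> x) \<le> norm x ^ k * (norm (\<phi> x) + norm (\<psi> x))"
      by (intro mult_left_mono norm_triangle_ineq) auto
    then show ?thesis using B(1)[of x] B(2)[of x] by (simp add: distrib_left)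
  qed
  then show ?case by blast
next
  case (scale \<phi> c)
  obtain B where B: "\<And>x. norm x ^ k * norm (\<phi> x) \<le> B" using scale.IH[of k] by auto
  have "norm x ^ k * norm (c * \<phi> x) \<le> norm c * B" for x
    using mult_left_mono[OF B[of x], of "norm c"] by (simp add: norm_mult mult_ac)
  then show ?case by blast
qed

lemma gauss_span_iterated_partial:
  "gauss_span \<rho> a \<phi> \<Longrightarrow> gauss_span \<rho> a (iterated_partial bs \<phi>)"
proof (induction bs)
  case (Cons b bs)
  then obtain D where D: "\<And>x. (iterated_partial bs \<phi> has_derivative D x) (at x)" "\<And>b. gauss_span \<rho> a (\<lambda>x. D x b)"
    using gauss_span_has_derivative by blast
  then have "frechet_derivative (iterated_partial bs \<phi>) (at x) = D x" for x
    using frechet_derivative_at by metis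
  then show ?case using D(2) by simp
qed simp

lemma schwartz_gauss_span:
  assumes "gauss_span \<rho> a \<phi>" "a > 0"
  shows "schwartz \<phi>"
  unfolding schwartz_def
proof (intro allI impI conjI)
  fix bs and x
  show "iterated_partial bs \<phi> differentiable (at x)"
    using gauss_span_has_derivative[OF gauss_span_iterated_partial[OF assms(1), of bs]] by (auto simp: differentiable_def)
next
  fix bs and k :: nat
  obtain B where "\<And>x. norm x ^ k * norm (iterated_partial bs \<phi> x) \<le> B"
    using gauss_span_bounded[OF gauss_span_iterated_partial[OF assms(1)] assms(2)] by blast
  then show "bounded (range (\<lambda>x. norm x ^ k *\<^sub>R iterated_partial bs \<phi> x))"
    by (intro boundedI[of _ B]) auto
qed

text \<open>The test function mixes two measures and two Gaussian widths, whereas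
  \<open>gauss_span\<close> fixes both parameters, so sums have to be formed at the level of
  Schwartz functions.\<close>

lemma schwartz_add:
  assumes "schwartz \<phi>" "schwartz \<psi>"
  shows "schwartz (\<lambda>x. \<phi> x + \<psi> x)"
proof -
  have eq: "set bs \<subseteq> Basis \<Longrightarrow> iterated_partial bs (\<lambda>x. \<phi> x + \<psi> x) = (\<lambda>x. iterated_partial bs \<phi> x + iterated_partial bs \<psi> x)" for bs
  proof (induction bs)
    case (Cons b bs)
    have "iterated_partial bs \<phi> differentiable (at x)" "iterated_partial bs \<psi> differentiable (at x)" for x
      using assms Cons.prems by (auto simp: schwartz_def)
    then have "((\<lambda>x. iterated_partial bs \<phi> x + iterated_partial bs \<psi> x) has_derivative
      (\<lambda>v. frechet_derivative (iterated_partial bs \<phi>) (at x) v + frechet_derivative (iterated_partial bs \<psi>) (at x) v)) (at x)" for x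
      by (intro has_derivative_add) (auto simp: frechet_derivative_works)
    then have "frechet_derivative (\<lambda>x. iterated_partial bs \<phi> x + iterated_partial bs \<psi> x) (at x)
       = (\<lambda>v. frechet_derivative (iterated_partial bs \<phi>) (at x) v + frechet_derivative (iterated_partial bs \<psi>) (at x) v)" for x
      using frechet_derivative_at by metis
    then show ?case using Cons by simp
  qed simp
  show ?thesis
    unfolding schwartz_def
  proof (intro allI impI)
    fix bs :: "'a list" assume bs: "set bs \<subseteq> Basis"
    have "bounded (range (\<lambda>x. norm x ^ k *\<^sub>R (iterated_partial bs \<phi> x + iterated_partial bs \<psi> x)))" for k
    proof -
      have "bounded (range (\<lambda>x. norm x ^ k *\<^sub>R iterated_partial bs \<phi> x))" "bounded (range (\<lambda>x. norm x ^ k *\<^sub>R iterated_partial bs \<psi> x))"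
        using assms bs by (auto simp: schwartz_def)
      then show ?thesis
        using bounded_plus_comp[of "\<lambda>x. norm x ^ k *\<^sub>R iterated_partial bs \<phi> x" UNIV "\<lambda>x. norm x ^ k *\<^sub>R iterated_partial bs \<psi> x"]
        by (simp add: scaleR_add_right)
    qed
    then show "(\<forall>x. iterated_partial bs (\<lambda>x. \<phi> x + \<psi> x) differentiable at x) \<and>
      (\<forall>k. bounded (range (\<lambda>x. norm x ^ k *\<^sub>R iterated_partial bs (\<lambda>x. \<phi> x + \<psi> x) x)))"
      unfolding eq[OF bs] using assms bs by (auto simp: schwartz_def intro!: differentiable_add)
  qed
qed

section \<open>Gaussian smoothing of a homogeneous kernel\<close>

lemma norm_add_scaleR_factor:
  assumes "\<epsilon> > 0"
  shows "norm (w + \<epsilon> *\<^sub>R z) = \<epsilon> * norm (w /\<^sub>R \<epsilon> + z)"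
proof -
  have "w + \<epsilon> *\<^sub>R z = \<epsilon> *\<^sub>R (w /\<^sub>R \<epsilon> + z)" using assms by (simp add: scaleR_add_right)
  then show ?thesis using assms by (simp del: scaleR_right_distrib)
qed

text \<open>The properties of x \<mapsto> 1/|x|_M on which the argument relies. Allowing every s
  \<noteq> 0 in \<open>f_scale\<close>, with |s| on the right, combines degree -1 with evenness. The
  constant A will be the radius of a ball containing M.\<close>

locale homogeneous_kernel =
  fixes f :: "'a::euclidean_space \<Rightarrow> real" and A :: real
  assumes dim: "DIM('a) \<ge> 2"
    and f_measurable [measurable]: "f \<in> borel_measurable borel"
    and f_nonneg: "0 \<le> f x"
    and A_nonneg: "0 \<le> A"
    and f_le: "f x \<le> A / norm x"
    and f_scale: "s \<noteq> 0 \<Longrightarrow> f (s *\<^sub>R x) = f x / \<bar>s\<bar>"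
begin

text \<open>The function F_\<epsilon> of the overview, written in the rescaled variable so that the
  Gaussian itself does not depend on \<epsilon>.\<close>

definition smooth :: "real \<Rightarrow> 'a \<Rightarrow> real" where
  "smooth \<epsilon> w = (LBINT z. f (w + \<epsilon> *\<^sub>R z) * gauss z)"

lemma smooth_nonneg: "0 \<le> smooth \<epsilon> w"
  unfolding smooth_def by (intro integral_nonneg_AE AE_I2 mult_nonneg_nonneg f_nonneg) simp

lemma smooth_measurable [measurable]: "smooth \<epsilon> \<in> borel_measurable borel"
  unfolding smooth_def by measurable

text \<open>The summand 1 is the mass of the Gaussian; the other one pays for the singularity of the
  kernel.\<close>

definition smooth_const :: real where
  "smooth_const = enn2real (inv_norm_const TYPE('a)) + 1"

text \<open>Uniform in w, so that \<open>smooth \<epsilon>\<close> is integrable against every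
  finite measure. Pulling \<epsilon> out of the norm leaves a singularity centred at - w/\<epsilon>,
  whose location is immaterial to \<open>nn_integral_div_norm_le\<close>.\<close>

lemma nn_smooth_le:
  assumes "\<epsilon> > 0"
  shows "(\<integral>\<^sup>+z. ennreal (f (w + \<epsilon> *\<^sub>R z) * gauss z) \<partial>lborel) \<le> ennreal (A / \<epsilon> * smooth_const)"
proof -
  have "(\<integral>\<^sup>+z. ennreal (f (w + \<epsilon> *\<^sub>R z) * gauss z) \<partial>lborel)
      \<le> (\<integral>\<^sup>+z. ennreal (A / \<epsilon>) * (ennreal (gauss z) * ennreal (1 / norm (w /\<^sub>R \<epsilon> + z))) \<partial>lborel)"
  proof (rule nn_integral_mono)
    fix z
    note n = norm_add_scaleR_factor[OF assms(1), of w z]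
    have "f (w + \<epsilon> *\<^sub>R z) * gauss z \<le> A / norm (w + \<epsilon> *\<^sub>R z) * gauss z"
      by (intro mult_right_mono f_le) simp
    also have "\<dots> = A / \<epsilon> * (gauss z * (1 / norm (w /\<^sub>R \<epsilon> + z)))" by (simp add: n)
    finally have "ennreal (f (w + \<epsilon> *\<^sub>R z) * gauss z) \<le> ennreal (A / \<epsilon> * (gauss z * (1 / norm (w /\<^sub>R \<epsilon> + z))))"
      by (rule ennreal_leI)
    also have "\<dots> = ennreal (A / \<epsilon>) * (ennreal (gauss z) * ennreal (1 / norm (w /\<^sub>R \<epsilon> + z)))"
      using A_nonneg assms by (subst ennreal_mult, simp, simp, subst ennreal_mult) simp_all
    finally show "ennreal (f (w + \<epsilon> *\<^sub>R z) * gauss z)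
      \<le> ennreal (A / \<epsilon>) * (ennreal (gauss z) * ennreal (1 / norm (w /\<^sub>R \<epsilon> + z)))" .
  qed
  also have "\<dots> = ennreal (A / \<epsilon>) * (\<integral>\<^sup>+z. ennreal (gauss z) * ennreal (1 / norm (w /\<^sub>R \<epsilon> + z)) \<partial>lborel)"
    by (rule nn_integral_cmult) measurable
  also have "\<dots> \<le> ennreal (A / \<epsilon>) * (inv_norm_const TYPE('a) + (\<integral>\<^sup>+z. ennreal (gauss (z::'a)) \<partial>lborel))"
    by (intro mult_left_mono nn_integral_div_norm_le) (auto simp: gauss_le_1)
  also have "\<dots> = ennreal (A / \<epsilon>) * ennreal smooth_const"
    using inv_norm_const_finite[OF dim] by (simp add: smooth_const_def nn_integral_gauss)
  also have "\<dots> = ennreal (A / \<epsilon> * smooth_const)"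
    using A_nonneg assms by (intro ennreal_mult[symmetric]) (auto simp: smooth_const_def)
  finally show ?thesis .
qed

lemma integrable_smooth:
  assumes "\<epsilon> > 0"
  shows "integrable lborel (\<lambda>z. f (w + \<epsilon> *\<^sub>R z) * gauss z)"
  by (rule integrableI_nonneg)
     (use nn_smooth_le[OF assms, of w] in \<open>auto simp: f_nonneg intro: order_le_less_trans\<close>)

lemma nn_smooth:
  assumes "\<epsilon> > 0"
  shows "(\<integral>\<^sup>+z. ennreal (f (w + \<epsilon> *\<^sub>R z) * gauss z) \<partial>lborel) = ennreal (smooth \<epsilon> w)"
  unfolding smooth_def using f_nonneg by (intro nn_integral_eq_integral integrable_smooth assms) auto

lemma smooth_le_const:
  assumes "\<epsilon> > 0"
  shows "smooth \<epsilon> w \<le> A / \<epsilon> * smooth_const"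
  using nn_smooth_le[OF assms, of w] A_nonneg assms
  unfolding nn_smooth[OF assms] by (subst (asm) ennreal_le_iff) (auto simp: smooth_const_def)

text \<open>Collects the estimate of \<open>smooth_decay\<close>: the factor 2 comes from cutting at
  half of |w|, the 1 from the Gaussian mass, and the rest bounds the Gaussian with the extra factor
  |z| against the displaced singularity.\<close>

definition decay_const :: real where
  "decay_const = 2 * A * (1 + enn2real (inv_norm_const TYPE('a) + (\<integral>\<^sup>+z. ennreal (norm (z::'a) * gauss z) \<partial>lborel)))"

lemma decay_const_ge: "2 * A \<le> decay_const"
proof -
  have "2 * A * 1 \<le> decay_const"
    unfolding decay_const_def using A_nonneg by (intro mult_left_mono) auto
  then show ?thesis by simp
qed

text \<open>The point is uniformity in \<epsilon>. If \<epsilon>|z| \<le> |w|/2, then |w +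
  \<epsilon> z| \<ge> |w|/2. Otherwise 1 \<le> 2 \<epsilon>|z|/|w|, and this \<epsilon> cancels the
  one in |w + \<epsilon> z| = \<epsilon> |w/\<epsilon> + z|.\<close>

lemma smooth_decay:
  assumes "\<epsilon> > 0" "w \<noteq> 0"
  shows "smooth \<epsilon> w \<le> decay_const / norm w"
proof -
  let ?l = "\<lambda>z. ennreal (f (w + \<epsilon> *\<^sub>R z) * gauss z)"
  let ?r = "\<lambda>z. ennreal (2 * A / norm w) * (ennreal (gauss z)
      + ennreal (norm z * gauss z) * ennreal (1 / norm (w /\<^sub>R \<epsilon> + z)))"
  let ?I = "inv_norm_const TYPE('a) + (\<integral>\<^sup>+z. ennreal (norm (z::'a) * gauss z) \<partial>lborel)"
  have fin: "?I < \<infinity>"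
    using inv_norm_const_finite[OF dim] nn_integral_norm_gauss_finite[where 'a = 'a] by simp
  have "ennreal (smooth \<epsilon> w) \<le> (\<integral>\<^sup>+z. ?r z \<partial>lborel)"
    unfolding nn_smooth[OF assms(1), symmetric]
  proof (rule nn_integral_mono)
    fix z
    note n = norm_add_scaleR_factor[OF assms(1), of w z]
    have key: "1 / norm (w + \<epsilon> *\<^sub>R z) \<le> 2 / norm w + (2 / norm w) * (norm z * (1 / norm (w /\<^sub>R \<epsilon> + z)))"
    proof (cases "\<epsilon> * norm z \<le> norm w / 2")
      case True
      have "norm w \<le> norm (w + \<epsilon> *\<^sub>R z) + norm (\<epsilon> *\<^sub>R z)"
        using norm_triangle_ineq4[of "w + \<epsilon> *\<^sub>R z" "\<epsilon> *\<^sub>R z"] by simp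
      then have "norm w / 2 \<le> norm (w + \<epsilon> *\<^sub>R z)" using True assms by simp
      then have "1 / norm (w + \<epsilon> *\<^sub>R z) \<le> 1 / (norm w / 2)"
        using assms by (intro divide_left_mono) (auto intro!: mult_pos_pos intro: less_le_trans[of 0 "norm w / 2"])
      then show ?thesis by (simp add: add_increasing2)
    next
      case False
      then have "1 \<le> (2 / norm w) * (\<epsilon> * norm z)" using assms by (simp add: field_simps)
      then have "1 * (1 / norm (w + \<epsilon> *\<^sub>R z)) \<le> (2 / norm w) * (\<epsilon> * norm z) * (1 / norm (w + \<epsilon> *\<^sub>R z))"
        by (intro mult_right_mono) auto
      also have "\<dots> = (2 / norm w) * (norm z * (1 / norm (w /\<^sub>R \<epsilon> + z)))"
        unfolding n using assms by simp
      finally show ?thesis by (simp add: add_increasing)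
    qed
    have "f (w + \<epsilon> *\<^sub>R z) \<le> A * (1 / norm (w + \<epsilon> *\<^sub>R z))" using f_le by simp
    also have "\<dots> \<le> A * (2 / norm w + (2 / norm w) * (norm z * (1 / norm (w /\<^sub>R \<epsilon> + z))))"
      by (intro mult_left_mono key A_nonneg)
    finally have "f (w + \<epsilon> *\<^sub>R z) * gauss z \<le> A * (2 / norm w + (2 / norm w) * (norm z * (1 / norm (w /\<^sub>R \<epsilon> + z)))) * gauss z"
      by (rule mult_right_mono) simp
    also have "\<dots> = 2 * A / norm w * (gauss z + norm z * gauss z * (1 / norm (w /\<^sub>R \<epsilon> + z)))"
      by (simp only: algebra_simps times_divide_eq_left times_divide_eq_right)
    finally have "?l z \<le> ennreal (2 * A / norm w * (gauss z + norm z * gauss z * (1 / norm (w /\<^sub>R \<epsilon> + z))))"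
      by (rule ennreal_leI)
    also have "\<dots> = ennreal (2 * A / norm w) * ennreal (gauss z + norm z * gauss z * (1 / norm (w /\<^sub>R \<epsilon> + z)))"
      using A_nonneg by (intro ennreal_mult) auto
    also have "ennreal (gauss z + norm z * gauss z * (1 / norm (w /\<^sub>R \<epsilon> + z)))
        = ennreal (gauss z) + ennreal (norm z * gauss z * (1 / norm (w /\<^sub>R \<epsilon> + z)))"
      by (intro ennreal_plus) auto
    also have "ennreal (norm z * gauss z * (1 / norm (w /\<^sub>R \<epsilon> + z))) = ennreal (norm z * gauss z) * ennreal (1 / norm (w /\<^sub>R \<epsilon> + z))"
      by (intro ennreal_mult) auto
    finally show "?l z \<le> ?r z" .
  qed
  also have "\<dots> = ennreal (2 * A / norm w) * (1 + (\<integral>\<^sup>+z. ennreal (norm z * gauss z) * ennreal (1 / norm (w /\<^sub>R \<epsilon> + z)) \<partial>lborel))"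
    by (simp add: nn_integral_cmult nn_integral_add nn_integral_gauss)
  also have "\<dots> \<le> ennreal (2 * A / norm w) * (1 + ?I)"
    by (intro mult_left_mono add_left_mono nn_integral_div_norm_le) (auto simp: norm_gauss_le_1)
  also have "1 + ?I = ennreal (1 + enn2real ?I)"
    using fin by (simp only: ennreal_plus enn2real_nonneg zero_le_one ennreal_1 ennreal_enn2real infinity_ennreal_def)
  also have "ennreal (2 * A / norm w) * \<dots> = ennreal (2 * A / norm w * (1 + enn2real ?I))"
    using A_nonneg by (intro ennreal_mult[symmetric]) auto
  also have "2 * A / norm w * (1 + enn2real ?I) = decay_const / norm w"
    by (simp add: decay_const_def)
  finally show ?thesis
    using decay_const_ge A_nonneg by (subst (asm) ennreal_le_iff) auto
qed

text \<open>Dilating the point is exchanged for changing the width. This identifies the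
  2\<epsilon>-integral with an \<epsilon>-integral and later moves s out of the argument of the
  smoothed kernel.\<close>

lemma smooth_scale:
  assumes "\<epsilon> > 0" "s \<noteq> 0"
  shows "smooth \<epsilon> (s *\<^sub>R w) = smooth (\<epsilon> / \<bar>s\<bar>) w / \<bar>s\<bar>"
proof -
  have e: "f (s *\<^sub>R w + \<epsilon> *\<^sub>R z) = f (w + (\<epsilon> / s) *\<^sub>R z) / \<bar>s\<bar>" for z
    using f_scale[OF assms(2), of "w + (\<epsilon> / s) *\<^sub>R z"] assms(2) by (simp add: scaleR_add_right)
  have "smooth \<epsilon> (s *\<^sub>R w) = smooth (\<epsilon> / s) w / \<bar>s\<bar>"
    unfolding smooth_def e by simp
  \<comment> \<open>A negative s produces a negative width; the evenness of the Gaussian removes the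
    sign.\<close>
  moreover have "smooth (- t) w = smooth t w" for t
    unfolding smooth_def by (subst integral_lborel_affine[where c = "-1" and t = 0]) auto
  from this[of "\<epsilon> / s"] have "smooth (\<epsilon> / \<bar>s\<bar>) w = smooth (\<epsilon> / s) w"
    by (cases "s > 0") (auto simp: abs_if)
  ultimately show ?thesis by simp
qed

end

section \<open>Fourier transforms of Gaussian multipliers and their pairing with the kernel\<close>

abbreviation gauss_exp :: "real \<Rightarrow> 'a::euclidean_space \<Rightarrow> real" where
  "gauss_exp \<epsilon> \<xi> \<equiv> exp (- (\<epsilon>\<^sup>2 / 2) * (norm \<xi>)\<^sup>2)"

definition gauss_multiplier :: "'a::euclidean_space measure \<Rightarrow> real \<Rightarrow> 'a \<Rightarrow> complex" where
  "gauss_multiplier \<rho> \<epsilon> \<xi> = of_real (gauss_exp \<epsilon> \<xi>) * fourier_weighted \<rho> (\<lambda>_. 1) \<xi>"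

lemma integral_exp_sq_iexp:
  fixes x :: "'a::euclidean_space"
  assumes "\<epsilon> > 0"
  shows "(LBINT \<xi>. of_real (gauss_exp \<epsilon> \<xi>) * iexp (\<xi> \<bullet> x))
    = of_real ((2 * pi) ^ DIM('a) / \<epsilon> ^ DIM('a) * gauss (x /\<^sub>R \<epsilon>))"
proof -
  \<comment> \<open>The reciprocal of the normalising factor of \<open>gauss\<close>. It enters once
    through the integrand and once through the value, which is why its square (2\<pi>)^n
    appears.\<close>
  define c where "c = sqrt (2 * pi) ^ DIM('a)"
  have c0: "c > 0" by (simp add: c_def)
  have "c * c = (sqrt (2 * pi) * sqrt (2 * pi)) ^ DIM('a)"
    unfolding c_def by (rule power_mult_distrib[symmetric])
  then have cc: "c * c = (2 * pi) ^ DIM('a)" by simp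
  have g: "c * gauss y = exp (- (norm y)\<^sup>2 / 2)" for y :: 'a
    using c0 by (simp add: gauss_def c_def power_one_over)
  let ?J = "LBINT \<xi>. of_real (gauss_exp \<epsilon> \<xi>) * iexp (\<xi> \<bullet> x)"
  have "complex_of_real c * complex_of_real (exp (- (norm (x /\<^sub>R \<epsilon>))\<^sup>2 / 2))
     = complex_of_real c * (LBINT \<xi>. of_real (gauss \<xi>) * iexp (\<xi> \<bullet> (x /\<^sub>R \<epsilon>)))"
    by (simp only: integral_gauss_exp)
  also have "\<dots> = (LBINT \<xi>. complex_of_real c * (of_real (gauss \<xi>) * iexp (\<xi> \<bullet> (x /\<^sub>R \<epsilon>))))"
    by (rule integral_mult_right_zero[symmetric])
  also have "\<dots> = (LBINT \<xi>. complex_of_real (exp (- (norm \<xi>)\<^sup>2 / 2)) * iexp ((\<xi>::'a) \<bullet> (x /\<^sub>R \<epsilon>)))"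
    by (simp only: mult.assoc[symmetric] of_real_mult[symmetric] g)
  also have "\<dots> = \<bar>\<epsilon>\<bar> ^ DIM('a) *\<^sub>R (LBINT \<xi>. complex_of_real (exp (- (norm (0 + \<epsilon> *\<^sub>R \<xi>))\<^sup>2 / 2)) * iexp ((0 + \<epsilon> *\<^sub>R (\<xi>::'a)) \<bullet> (x /\<^sub>R \<epsilon>)))"
    using assms by (intro integral_lborel_affine) auto
  also have "\<dots> = of_real (\<epsilon> ^ DIM('a)) * ?J"
  proof -
    have "(0 + \<epsilon> *\<^sub>R \<xi>) \<bullet> (x /\<^sub>R \<epsilon>) = \<xi> \<bullet> x" "- (norm (0 + \<epsilon> *\<^sub>R \<xi>))\<^sup>2 / 2 = - (\<epsilon>\<^sup>2 / 2) * (norm \<xi>)\<^sup>2" for \<xi>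
      using assms by (auto simp: power_mult_distrib)
    then show ?thesis using assms by (simp only: scaleR_conv_of_real abs_of_pos)
  qed
  finally have "complex_of_real (\<epsilon> ^ DIM('a)) * ?J = of_real (c * exp (- (norm (x /\<^sub>R \<epsilon>))\<^sup>2 / 2))"
    by simp
  also have "c * exp (- (norm (x /\<^sub>R \<epsilon>))\<^sup>2 / 2) = (2 * pi) ^ DIM('a) * gauss (x /\<^sub>R \<epsilon>)"
    by (simp only: g[symmetric] cc[symmetric] mult.assoc)
  finally have "complex_of_real (\<epsilon> ^ DIM('a)) * ?J = of_real ((2 * pi) ^ DIM('a) * gauss (x /\<^sub>R \<epsilon>))" .
  then have "?J = of_real ((2 * pi) ^ DIM('a) * gauss (x /\<^sub>R \<epsilon>)) / complex_of_real (\<epsilon> ^ DIM('a))"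
    using assms by (simp add: eq_divide_eq mult.commute)
  then show ?thesis
    by (simp only: of_real_divide[symmetric] times_divide_eq_left)
qed

lemma integrable_exp_sq:
  assumes "a > 0"
  shows "integrable lborel (\<lambda>\<xi>::'a::euclidean_space. exp (- a * (norm \<xi>)\<^sup>2))"
proof -
  define r where "r = sqrt (2 * a)"
  have r: "r > 0" "r\<^sup>2 = 2 * a" using assms by (auto simp: r_def)
  have "integrable lborel (\<lambda>\<xi>::'a. sqrt (2 * pi) ^ DIM('a) * gauss (0 + r *\<^sub>R \<xi>))"
  proof (intro integrable_mult_right integrableI_nonneg)
    have "(\<integral>\<^sup>+\<xi>. ennreal (gauss (\<xi>::'a)) \<partial>lborel) = ennreal (\<bar>r\<bar> ^ DIM('a)) * (\<integral>\<^sup>+\<xi>. ennreal (gauss (0 + r *\<^sub>R (\<xi>::'a))) \<partial>lborel)"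
      using r by (intro nn_integral_lborel_affine) auto
    then show "(\<integral>\<^sup>+\<xi>. ennreal (gauss (0 + r *\<^sub>R (\<xi>::'a))) \<partial>lborel) < \<infinity>"
      using r by (cases "(\<integral>\<^sup>+\<xi>. ennreal (gauss (0 + r *\<^sub>R (\<xi>::'a))) \<partial>lborel) = top")
        (auto simp: nn_integral_gauss less_top ennreal_mult_top)
  qed auto
  moreover have "sqrt (2 * pi) ^ DIM('a) * gauss (0 + r *\<^sub>R \<xi>) = exp (- a * (norm \<xi>)\<^sup>2)" for \<xi> :: 'a
    using r(2) by (simp add: gauss_def power_mult_distrib power_divide)
  ultimately show ?thesis by (simp only:)
qed

text \<open>Fourier inversion for a finite measure convolved with a Gaussian, obtained from Fubini.
  \<open>fourier_weighted\<close> has the opposite sign in the exponent to \<open>fourier\<close>,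
  so \<rho> comes back without reflection.\<close>

lemma fourier_gauss_multiplier:
  fixes \<rho> :: "'a::euclidean_space measure"
  assumes \<rho>: "moments_finite \<rho> (\<lambda>_. 1)" and "\<epsilon> > 0"
  shows "integrable lborel (\<lambda>\<xi>. gauss_multiplier \<rho> \<epsilon> \<xi> * exp (- \<i> * of_real (\<xi> \<bullet> x)))"
    and "fourier (gauss_multiplier \<rho> \<epsilon>) x
      = of_real ((2 * pi) ^ DIM('a) / \<epsilon> ^ DIM('a) * (LINT w|\<rho>. gauss ((x - w) /\<^sub>R \<epsilon>)))"
proof -
  have s [measurable_cong]: "sets \<rho> = sets borel" using \<rho> by (simp add: moments_finite_def)
  interpret \<rho>: finite_measure \<rho> by (rule moments_finite_finite_measure[OF \<rho>])
  interpret P: pair_sigma_finite \<rho> "lborel :: 'a measure" ..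
  define G where "G w \<xi> = of_real (gauss_exp \<epsilon> \<xi>) * iexp (\<xi> \<bullet> (w - x))"
    for w \<xi> :: 'a
  have [measurable]: "case_prod G \<in> borel_measurable (\<rho> \<Otimes>\<^sub>M lborel)"
    unfolding G_def by measurable
  have nG: "norm (G w \<xi>) = gauss_exp \<epsilon> \<xi>" for w \<xi>
    by (simp add: G_def norm_mult)
  have iexp: "integrable lborel (\<lambda>\<xi>::'a. gauss_exp \<epsilon> \<xi>)"
    using \<open>\<epsilon> > 0\<close> by (intro integrable_exp_sq) auto
  have int_G: "integrable (\<rho> \<Otimes>\<^sub>M lborel) (case_prod G)"
  proof (rule P.Fubini_integrable)
    show "integrable \<rho> (\<lambda>w. LBINT \<xi>. norm (case_prod G (w, \<xi>)))"
      by (simp only: prod.case nG \<rho>.integrable_const)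
    have "integrable lborel (G w)" for w
    proof (rule Bochner_Integration.integrable_bound[OF iexp])
      show "G w \<in> borel_measurable lborel" unfolding G_def by measurable
      show "AE \<xi> in lborel. norm (G w \<xi>) \<le> norm (gauss_exp \<epsilon> \<xi>)"
        unfolding nG by simp
    qed
    then show "AE w in \<rho>. integrable lborel (\<lambda>\<xi>. case_prod G (w, \<xi>))" by simp
  qed measurable
  have eq: "(LINT w|\<rho>. G w \<xi>) = gauss_multiplier \<rho> \<epsilon> \<xi> * exp (- \<i> * of_real (\<xi> \<bullet> x))" for \<xi>
  proof -
    have "G w \<xi> = of_real (gauss_exp \<epsilon> \<xi>) * exp (- \<i> * of_real (\<xi> \<bullet> x)) * iexp (w \<bullet> \<xi>)" for w
      by (simp add: G_def mult.assoc exp_add[symmetric] inner_diff_right inner_commute[of w] algebra_simps)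
    then show ?thesis
      by (simp add: gauss_multiplier_def fourier_weighted_def)
  qed
  show "integrable lborel (\<lambda>\<xi>. gauss_multiplier \<rho> \<epsilon> \<xi> * exp (- \<i> * of_real (\<xi> \<bullet> x)))"
    using P.integrable_snd[OF int_G] by (simp only: eq)
  have "fourier (gauss_multiplier \<rho> \<epsilon>) x = (LBINT \<xi>. (LINT w|\<rho>. G w \<xi>))"
    unfolding fourier_def eq ..
  also have "\<dots> = (LINT w|\<rho>. (LBINT \<xi>. G w \<xi>))"
    by (rule P.Fubini_integral[OF int_G])
  also have "\<dots> = (LINT w|\<rho>. complex_of_real ((2 * pi) ^ DIM('a) / \<epsilon> ^ DIM('a) * gauss ((w - x) /\<^sub>R \<epsilon>)))"
    unfolding G_def by (simp only: integral_exp_sq_iexp[OF \<open>\<epsilon> > 0\<close>])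
  also have "\<dots> = of_real (LINT w|\<rho>. (2 * pi) ^ DIM('a) / \<epsilon> ^ DIM('a) * gauss ((w - x) /\<^sub>R \<epsilon>))"
    by (rule integral_complex_of_real)
  also have "(LINT w|\<rho>. (2 * pi) ^ DIM('a) / \<epsilon> ^ DIM('a) * gauss ((w - x) /\<^sub>R \<epsilon>))
      = (2 * pi) ^ DIM('a) / \<epsilon> ^ DIM('a) * (LINT w|\<rho>. gauss ((w - x) /\<^sub>R \<epsilon>))"
    by (rule integral_mult_right_zero)
  also have "(\<lambda>w. gauss ((w - x) /\<^sub>R \<epsilon>)) = (\<lambda>w. gauss ((x - w) /\<^sub>R \<epsilon>))"
    by (simp add: gauss_def norm_minus_commute)
  finally show "fourier (gauss_multiplier \<rho> \<epsilon>) x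
      = of_real ((2 * pi) ^ DIM('a) / \<epsilon> ^ DIM('a) * (LINT w|\<rho>. gauss ((x - w) /\<^sub>R \<epsilon>)))" .
qed

context homogeneous_kernel
begin

text \<open>Fubini moves the Gaussian from \<rho> onto f. It applies because \<rho> is finite and
  \<open>smooth \<epsilon>\<close> is bounded.\<close>

lemma pairing_gauss_multiplier:
  assumes \<rho>: "moments_finite \<rho> (\<lambda>_. 1)" and "\<epsilon> > 0"
  shows "integrable lborel (\<lambda>x. of_real (f x) * fourier (gauss_multiplier \<rho> \<epsilon>) x)"
    and "(LBINT x. of_real (f x) * fourier (gauss_multiplier \<rho> \<epsilon>) x)
      = of_real ((2 * pi) ^ DIM('a) * (LINT w|\<rho>. smooth \<epsilon> w))"
proof -
  have s [measurable_cong]: "sets \<rho> = sets borel" using \<rho> by (simp add: moments_finite_def)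
  interpret \<rho>: finite_measure \<rho> by (rule moments_finite_finite_measure[OF \<rho>])
  interpret P: pair_sigma_finite \<rho> "lborel :: 'a measure" ..
  define G where "G w x = f x * (1 / \<epsilon> ^ DIM('a) * gauss ((x - w) /\<^sub>R \<epsilon>))" for w x :: 'a
  have [measurable]: "case_prod G \<in> borel_measurable (\<rho> \<Otimes>\<^sub>M lborel)"
    unfolding G_def by measurable
  have G0: "0 \<le> G w x" for w x using f_nonneg \<open>\<epsilon> > 0\<close> by (simp add: G_def)
  have [measurable]: "G w \<in> borel_measurable borel" for w unfolding G_def by measurable
  have subst: "ennreal (\<bar>\<epsilon>\<bar> ^ DIM('a)) * ennreal (G w (w + \<epsilon> *\<^sub>R z)) = ennreal (f (w + \<epsilon> *\<^sub>R z) * gauss z)" for w z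
    using \<open>\<epsilon> > 0\<close> f_nonneg by (simp add: G_def ennreal_mult[symmetric])
  have nnG: "(\<integral>\<^sup>+x. ennreal (G w x) \<partial>lborel) = ennreal (smooth \<epsilon> w)" for w
  proof -
    have "(\<integral>\<^sup>+x. ennreal (G w x) \<partial>lborel) = ennreal (\<bar>\<epsilon>\<bar> ^ DIM('a)) * (\<integral>\<^sup>+z. ennreal (G w (w + \<epsilon> *\<^sub>R z)) \<partial>lborel)"
      using \<open>\<epsilon> > 0\<close> by (intro nn_integral_lborel_affine) auto
    also have "\<dots> = (\<integral>\<^sup>+z. ennreal (f (w + \<epsilon> *\<^sub>R z) * gauss z) \<partial>lborel)"
      by (subst nn_integral_cmult[symmetric]) (auto simp: subst)
    finally show ?thesis by (simp add: nn_smooth[OF \<open>\<epsilon> > 0\<close>])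
  qed
  have iG: "integrable lborel (G w)" for w
    by (rule integrableI_nonneg) (auto simp: G0 nnG)
  have G_int: "(LBINT x. G w x) = smooth \<epsilon> w" for w
    by (subst integral_eq_nn_integral) (auto simp: G0 nnG smooth_nonneg)
  have int_G: "integrable (\<rho> \<Otimes>\<^sub>M lborel) (case_prod G)"
  proof (rule P.Fubini_integrable)
    show "AE w in \<rho>. integrable lborel (\<lambda>x. case_prod G (w, x))" using iG by simp
    have "integrable \<rho> (smooth \<epsilon>)"
      using smooth_le_const[OF \<open>\<epsilon> > 0\<close>] smooth_nonneg
      by (intro \<rho>.integrable_const_bound[where B = "A / \<epsilon> * smooth_const"]) auto
    then show "integrable \<rho> (\<lambda>w. LBINT x. norm (case_prod G (w, x)))"
      using G0 by (simp add: G_int)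
  qed measurable
  have eq: "of_real (f x) * fourier (gauss_multiplier \<rho> \<epsilon>) x = of_real ((2 * pi) ^ DIM('a) * (LINT w|\<rho>. G w x))" for x
  proof -
    have "(LINT w|\<rho>. G w x) = f x * (1 / \<epsilon> ^ DIM('a) * (LINT w|\<rho>. gauss ((x - w) /\<^sub>R \<epsilon>)))"
      unfolding G_def by (simp only: integral_mult_right_zero)
    then show ?thesis
      unfolding fourier_gauss_multiplier(2)[OF assms] of_real_mult[symmetric] by simp
  qed
  show "integrable lborel (\<lambda>x. of_real (f x) * fourier (gauss_multiplier \<rho> \<epsilon>) x)"
    unfolding eq using P.integrable_snd[OF int_G] by (intro integrable_of_real integrable_mult_right)
  have "(LBINT x. of_real (f x) * fourier (gauss_multiplier \<rho> \<epsilon>) x)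
      = of_real ((2 * pi) ^ DIM('a) * (LBINT x. (LINT w|\<rho>. G w x)))"
    unfolding eq integral_complex_of_real integral_mult_right_zero ..
  also have "(LBINT x. (LINT w|\<rho>. G w x)) = (LINT w|\<rho>. smooth \<epsilon> w)"
    unfolding P.Fubini_integral[OF int_G] G_int ..
  finally show "(LBINT x. of_real (f x) * fourier (gauss_multiplier \<rho> \<epsilon>) x)
      = of_real ((2 * pi) ^ DIM('a) * (LINT w|\<rho>. smooth \<epsilon> w))" .
qed

end

section \<open>The cone measure of a compact set\<close>

text \<open>
  If \<open>C\<close> is a symmetric star-shaped body with radial function \<open>r\<close>, this measure has, up to a constant
  factor, the density \<open>exp (- |x|\<^sup>2/2) |x|\<^bsup>1-n\<^esup> r(x/|x|)\<^bsup>n-1\<^esup>\<close>.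
\<close>

definition cone_measure :: "'a::euclidean_space set \<Rightarrow> 'a measure" where
  "cone_measure C = distr (density lborel (\<lambda>p. ennreal (indicator C (snd p) * cone_exp p)))
     borel (\<lambda>p. fst p *\<^sub>R snd p)"

lemma sets_cone_measure [simp, measurable_cong]: "sets (cone_measure C) = sets borel"
  by (simp add: cone_measure_def)

lemma cone_density_measurable:
  assumes [measurable]: "C \<in> sets borel"
  shows "(\<lambda>p::real \<times> 'a::euclidean_space. indicator C (snd p) * cone_exp p) \<in> borel_measurable borel"
    and "(\<lambda>p::real \<times> 'a. fst p *\<^sub>R snd p) \<in> borel_measurable borel"
  unfolding borel_prod[symmetric] by measurable

lemma integral_cone_measure:
  fixes h :: "'a::euclidean_space \<Rightarrow> 'b::{banach, second_countable_topology}"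
  assumes C: "C \<in> sets borel" and [measurable]: "h \<in> borel_measurable borel"
  shows "(LINT w|cone_measure C. h w)
    = (LBINT p. (indicator C (snd p) * cone_exp p) *\<^sub>R h (fst p *\<^sub>R snd p))"
proof -
  note [measurable] = cone_density_measurable[OF C]
  show ?thesis
    unfolding cone_measure_def by (subst integral_distr, simp, simp, subst integral_density)
      (use cone_density_measurable[OF C] in simp_all)
qed

lemma integrable_cone_measure:
  fixes h :: "'a::euclidean_space \<Rightarrow> 'b::{banach, second_countable_topology}"
  assumes C: "C \<in> sets borel" and [measurable]: "h \<in> borel_measurable borel"
  shows "integrable (cone_measure C) h
    \<longleftrightarrow> integrable lborel (\<lambda>p. (indicator C (snd p) * cone_exp p) *\<^sub>R h (fst p *\<^sub>R snd p))"
proof -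
  note [measurable] = cone_density_measurable[OF C]
  show ?thesis
    unfolding cone_measure_def by (subst integrable_distr_eq, simp, simp, subst integrable_density)
      (use cone_density_measurable[OF C] in simp_all)
qed

lemma moments_finite_cone_measure:
  fixes C :: "'a::euclidean_space set"
  assumes "DIM('a) \<ge> 2" "compact C"
  shows "moments_finite (cone_measure C) (\<lambda>_. 1)"
  unfolding moments_finite_def
proof (intro conjI allI)
  have C: "C \<in> sets borel" using assms(2) by (rule borel_compact)
  obtain R where R: "C \<subseteq> cball 0 R"
    using compact_imp_bounded[OF assms(2)] unfolding bounded_iff by (auto simp: subset_eq)
  fix k
  have "integrable lborel (\<lambda>p::real \<times> 'a. norm (fst p *\<^sub>R snd p) ^ k * (indicator C (snd p) * cone_exp p))"
    by (rule integrable_cone[OF assms(1), where R = R]) (use C R in \<open>auto simp: indicator_def\<close>)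
  then have "integrable lborel (\<lambda>p::real \<times> 'a. complex_of_real (norm (fst p *\<^sub>R snd p) ^ k * (indicator C (snd p) * cone_exp p)))"
    by (rule integrable_of_real)
  then show "integrable (cone_measure C) (\<lambda>w. norm w ^ k *\<^sub>R (1::complex))"
    by (subst integrable_cone_measure[OF C]) (auto simp: scaleR_conv_of_real mult_ac)
qed simp

lemma integral_odd_real:
  fixes g :: "real \<Rightarrow> real"
  assumes [measurable]: "g \<in> borel_measurable borel" and "\<And>s. g (- s) = - g s"
  shows "(LBINT s. g s) = 0"
proof -
  have "(LBINT s. g s) = \<bar>-1\<bar> ^ DIM(real) *\<^sub>R (LBINT s. g (0 + (-1) *\<^sub>R s))"
    by (rule integral_lborel_affine) auto
  also have "\<dots> = - (LBINT s. g s)" using assms(2) by simp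
  finally show ?thesis by simp
qed

text \<open>Since s runs over both signs, the sine part is odd in s and already vanishes in the
  inner integral; the transform is therefore real.\<close>

lemma fourier_cone_measure:
  fixes C :: "'a::euclidean_space set"
  assumes "DIM('a) \<ge> 2" "compact C"
  shows "fourier_weighted (cone_measure C) (\<lambda>_. 1) \<xi> = of_real (cone_cos (indicator C) 0 \<xi>)"
proof -
  have C [measurable]: "C \<in> sets borel" using assms(2) by (rule borel_compact)
  note [measurable] = cone_density_measurable[OF C]
  have [measurable]: "(\<lambda>p::real \<times> 'a. snd p \<bullet> \<xi>) \<in> borel_measurable borel"
    "(\<lambda>p::real \<times> 'a. fst p * (snd p \<bullet> \<xi>)) \<in> borel_measurable borel"
    unfolding borel_prod[symmetric] by measurable
  define d where "d p = indicator C (snd p) * cone_exp p" for p :: "real \<times> 'a"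
  have [measurable]: "d \<in> borel_measurable borel" unfolding d_def by measurable
  have "integrable (cone_measure C) (\<lambda>_. 1 :: complex)"
    using moments_finite_integrable(1)[OF moments_finite_cone_measure[OF assms]] .
  then have "integrable lborel (\<lambda>p. norm (d p *\<^sub>R (1::complex)))"
    unfolding d_def by (intro integrable_norm) (subst (asm) integrable_cone_measure[OF C], auto)
  then have id: "integrable lborel d"
    by (simp add: d_def[abs_def])
  have icos: "integrable lborel (\<lambda>p. d p * cos (fst p * (snd p \<bullet> \<xi>)))"
    and isin: "integrable lborel (\<lambda>p. d p * sin (fst p * (snd p \<bullet> \<xi>)))"
    by (rule Bochner_Integration.integrable_bound[OF id]; auto simp: abs_mult intro!: mult_left_le)+
  have "(LBINT p. d p * sin (fst p * (snd p \<bullet> \<xi>))) = (LBINT y. (LBINT s. d (s, y) * sin (s * (y \<bullet> \<xi>))))"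
    using lborel_pair.integral_snd[of "\<lambda>s y. d (s, y) * sin (s * (y \<bullet> \<xi>))"] isin
    by (simp add: lborel_prod case_prod_unfold)
  also have "\<dots> = (LINT y|(lborel :: 'a measure). 0)"
    by (intro Bochner_Integration.integral_cong refl integral_odd_real) (auto simp: d_def)
  finally have sin0: "(LBINT p. d p * sin (fst p * (snd p \<bullet> \<xi>))) = 0" by simp
  have "fourier_weighted (cone_measure C) (\<lambda>_. 1) \<xi>
      = (LBINT p. d p *\<^sub>R iexp (fst p *\<^sub>R snd p \<bullet> \<xi>))"
    unfolding fourier_weighted_def d_def by (subst integral_cone_measure[OF C]) auto
  also have "\<dots> = (LBINT p. complex_of_real (d p * cos (fst p * (snd p \<bullet> \<xi>))) + \<i> * of_real (d p * sin (fst p * (snd p \<bullet> \<xi>))))"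
    by (intro Bochner_Integration.integral_cong refl)
       (simp add: complex_eq_iff Re_exp Im_exp)
  also have "\<dots> = of_real (LBINT p. d p * cos (fst p * (snd p \<bullet> \<xi>)))
      + \<i> * of_real (LBINT p. d p * sin (fst p * (snd p \<bullet> \<xi>)))"
    by (subst Bochner_Integration.integral_add)
       (simp_all only: integral_complex_of_real integral_mult_right_zero integrable_of_real icos isin integrable_mult_right)
  also have "\<dots> = of_real (cone_cos (indicator C) 0 \<xi>)"
    by (simp only: sin0) (simp add: cone_cos_def d_def)
  finally show ?thesis .
qed

lemma schwartz_gauss_multiplier:
  assumes "moments_finite \<rho> (\<lambda>_. 1)" "\<epsilon> > 0"
  shows "schwartz (\<lambda>\<xi>. c * gauss_multiplier \<rho> \<epsilon> \<xi>)"
  unfolding gauss_multiplier_def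
  by (rule schwartz_gauss_span[OF gauss_span.scale[OF gauss_span.base[OF assms(1)]]]) (use assms(2) in auto)

text \<open>
  Vanishes to second order at 0, which makes \<open>radial_weight t / |t|\<close> integrable. This is why the
  test functions carry a difference of two Gaussians.
\<close>

definition radial_weight :: "real \<Rightarrow> real" where
  "radial_weight t = exp (- t\<^sup>2 / 2) - exp (- (2 * t)\<^sup>2 / 2)"

section \<open>Using positive definiteness, and comparing the two widths\<close>

context homogeneous_kernel
begin

lemma cone_smooth_mono:
  assumes pd: "positive_definite (function_distribution f)"
    and K: "compact K" and L: "compact L"
    and le: "\<And>\<xi>. cone_cos (indicator K) 0 \<xi> \<le> cone_cos (indicator L) 0 \<xi>" and "\<epsilon> > 0"
  shows "(LINT w|cone_measure K. smooth \<epsilon> w) - (LINT w|cone_measure K. smooth (2 * \<epsilon>) w)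
       \<le> (LINT w|cone_measure L. smooth \<epsilon> w) - (LINT w|cone_measure L. smooth (2 * \<epsilon>) w)"
proof -
  define g where "g C e = gauss_multiplier (cone_measure C) e" for C :: "'a set" and e
  have m: "moments_finite (cone_measure C) (\<lambda>_. 1)" if "compact C" for C :: "'a set"
    using that by (rule moments_finite_cone_measure[OF dim])
  have e2: "2 * \<epsilon> > 0" using \<open>\<epsilon> > 0\<close> by simp
  \<comment> \<open>The product of the two differences, expanded into four multipliers. The explicit
    coefficients 1 and -1 fit \<open>schwartz_gauss_multiplier\<close>; the sign is visible only
    after factoring again.\<close>
  define \<phi> where "\<phi> \<xi> = (1 * g L \<epsilon> \<xi> + (-1) * g K \<epsilon> \<xi>) + ((-1) * g L (2 * \<epsilon>) \<xi> + 1 * g K (2 * \<epsilon>) \<xi>)" for \<xi>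
  have sch: "schwartz \<phi>"
    unfolding \<phi>_def g_def by (intro schwartz_add schwartz_gauss_multiplier m K L e2 \<open>\<epsilon> > 0\<close>)
  have pos: "\<phi> \<xi> \<in> \<real>\<^sub>\<ge>\<^sub>0" for \<xi>
  proof -
    have "\<phi> \<xi> = of_real ((gauss_exp \<epsilon> \<xi> - gauss_exp (2 * \<epsilon>) \<xi>)
        * (cone_cos (indicator L) 0 \<xi> - cone_cos (indicator K) 0 \<xi>))"
      unfolding \<phi>_def g_def gauss_multiplier_def fourier_cone_measure[OF dim K] fourier_cone_measure[OF dim L]
      by (simp add: algebra_simps)
    moreover have "gauss_exp (2 * \<epsilon>) \<xi> \<le> gauss_exp \<epsilon> \<xi>"
      by (simp add: power_mult_distrib mult_right_mono)
    then have "0 \<le> (gauss_exp \<epsilon> \<xi> - gauss_exp (2 * \<epsilon>) \<xi>)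
        * (cone_cos (indicator L) 0 \<xi> - cone_cos (indicator K) 0 \<xi>)"
      using le[of \<xi>] by (intro mult_nonneg_nonneg) auto
    ultimately show ?thesis by (simp only: nonneg_Reals_of_real_iff)
  qed
  have F: "fourier \<phi> x = fourier (g L \<epsilon>) x - fourier (g K \<epsilon>) x - fourier (g L (2 * \<epsilon>)) x + fourier (g K (2 * \<epsilon>)) x" for x
  proof -
    note i = fourier_gauss_multiplier(1)[OF m, of _ _ x, folded g_def] K L e2 \<open>\<epsilon> > 0\<close>
    have "fourier \<phi> x = (LBINT \<xi>. g L \<epsilon> \<xi> * exp (- \<i> * of_real (\<xi> \<bullet> x)) - g K \<epsilon> \<xi> * exp (- \<i> * of_real (\<xi> \<bullet> x))
      - g L (2 * \<epsilon>) \<xi> * exp (- \<i> * of_real (\<xi> \<bullet> x)) + g K (2 * \<epsilon>) \<xi> * exp (- \<i> * of_real (\<xi> \<bullet> x)))"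
      unfolding fourier_def \<phi>_def by (intro Bochner_Integration.integral_cong refl) (simp add: algebra_simps)
    also have "\<dots> = fourier (g L \<epsilon>) x - fourier (g K \<epsilon>) x - fourier (g L (2 * \<epsilon>)) x + fourier (g K (2 * \<epsilon>)) x"
      unfolding fourier_def
      by (simp only: Bochner_Integration.integral_add Bochner_Integration.integral_diff i
          Bochner_Integration.integrable_diff Bochner_Integration.integrable_add)
    finally show ?thesis .
  qed
  define S where "S C e = (LINT w|cone_measure C. smooth e w)" for C e
  let ?d = "S L \<epsilon> - S K \<epsilon> - S L (2 * \<epsilon>) + S K (2 * \<epsilon>)"
  note j = pairing_gauss_multiplier[OF m, folded g_def S_def] K L e2 \<open>\<epsilon> > 0\<close>
  have "fourier_distribution (function_distribution f) \<phi>
     = (LBINT x. of_real (f x) * fourier (g L \<epsilon>) x - of_real (f x) * fourier (g K \<epsilon>) x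
        - of_real (f x) * fourier (g L (2 * \<epsilon>)) x + of_real (f x) * fourier (g K (2 * \<epsilon>)) x)"
    unfolding fourier_distribution_def function_distribution_def F
    by (intro Bochner_Integration.integral_cong refl) (simp add: algebra_simps)
  also have "\<dots> = of_real ((2 * pi) ^ DIM('a) * S L \<epsilon>) - complex_of_real ((2 * pi) ^ DIM('a) * S K \<epsilon>)
     - complex_of_real ((2 * pi) ^ DIM('a) * S L (2 * \<epsilon>)) + complex_of_real ((2 * pi) ^ DIM('a) * S K (2 * \<epsilon>))"
    by (simp only: Bochner_Integration.integral_add Bochner_Integration.integral_diff j
          Bochner_Integration.integrable_diff Bochner_Integration.integrable_add)
  also have "\<dots> = of_real ((2 * pi) ^ DIM('a) * ?d)"
    by (simp add: algebra_simps)
  finally have "complex_of_real ((2 * pi) ^ DIM('a) * ?d) \<in> \<real>\<^sub>\<ge>\<^sub>0"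
    using pd sch pos unfolding positive_definite_def by metis
  then have "0 \<le> (2 * pi) ^ DIM('a) * ?d"
    by (simp only: nonneg_Reals_of_real_iff)
  moreover have "(2 * pi) ^ DIM('a) > 0" by simp
  ultimately have "0 \<le> ?d"
    by (meson mult_pos_neg not_le)
  then show ?thesis unfolding S_def by linarith
qed

text \<open>In the 2\<epsilon>-integral substitute s = 2t: the Jacobian 2 cancels the 1/2 from
  \<open>smooth_scale\<close>, and both integrals now contain \<open>smooth \<epsilon>\<close> at
  the same point. Only the Gaussian weights differ, and they subtract to
  \<open>radial_weight\<close>.\<close>

lemma cone_smooth_diff:
  assumes C: "compact C" and "\<epsilon> > 0"
  shows "integrable lborel (\<lambda>p. indicator C (snd p) * radial_weight (fst p * norm (snd p)) * smooth \<epsilon> (fst p *\<^sub>R snd p))"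
    and "(LINT w|cone_measure C. smooth \<epsilon> w) - (LINT w|cone_measure C. smooth (2 * \<epsilon>) w)
     = (LBINT p. indicator C (snd p) * radial_weight (fst p * norm (snd p)) * smooth \<epsilon> (fst p *\<^sub>R snd p))"
proof -
  let ?G = "\<lambda>p. indicator C (snd p) * radial_weight (fst p * norm (snd p)) * smooth \<epsilon> (fst p *\<^sub>R snd p)"
  have Cb [measurable]: "C \<in> sets borel" using C by (rule borel_compact)
  note [measurable] = cone_density_measurable[OF Cb]
  have e2: "2 * \<epsilon> > 0" using \<open>\<epsilon> > 0\<close> by simp
  have m: "moments_finite (cone_measure C) (\<lambda>_. 1)" by (rule moments_finite_cone_measure[OF dim C])
  interpret cm: finite_measure "cone_measure C" by (rule moments_finite_finite_measure[OF m])
  have int: "integrable (cone_measure C) (smooth e)" if "e > 0" for e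
    using smooth_le_const[OF that] smooth_nonneg
    by (intro cm.integrable_const_bound[where B = "A / e * smooth_const"]) auto
  define G where "G e p = indicator C (snd p) * cone_exp p * smooth e (fst p *\<^sub>R snd p)"
    for e and p :: "real \<times> 'a"
  have iG: "integrable lborel (G e)" if "e > 0" for e
    using int[OF that] unfolding integrable_cone_measure[OF Cb smooth_measurable] by (simp add: G_def[abs_def])
  have vG: "(LINT w|cone_measure C. smooth e w) = (LBINT p. G e p)" for e
    by (simp add: integral_cone_measure[OF Cb] G_def)
  \<comment> \<open>The integrand for width 2\<epsilon> after the substitution s = 2t.\<close>
  define H where "H p = indicator C (snd p) * exp (- (2 * (fst p * norm (snd p)))\<^sup>2 / 2) * smooth \<epsilon> (fst p *\<^sub>R snd p)"
    for p :: "real \<times> 'a"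
  have [measurable]: "H \<in> borel_measurable borel" "G e \<in> borel_measurable borel" for e
    unfolding H_def G_def borel_prod[symmetric] by measurable
  have iH: "integrable lborel H"
  proof (rule Bochner_Integration.integrable_bound[OF iG[OF \<open>\<epsilon> > 0\<close>]])
    show "AE p in lborel. norm (H p) \<le> norm (G \<epsilon> p)"
    proof (rule AE_I2)
      fix p :: "real \<times> 'a"
      have "exp (- (2 * (fst p * norm (snd p)))\<^sup>2 / 2) \<le> cone_exp p"
        by (simp add: power_mult_distrib)
      then have "H p \<le> G \<epsilon> p"
        unfolding H_def G_def by (intro mult_right_mono mult_left_mono smooth_nonneg) auto
      moreover have "0 \<le> H p" unfolding H_def by (simp add: smooth_nonneg)
      ultimately show "norm (H p) \<le> norm (G \<epsilon> p)" by simp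
    qed
  qed simp
  have "(LBINT p. G (2 * \<epsilon>) p) = (LBINT y. (LBINT s. G (2 * \<epsilon>) (s, y)))"
    using lborel_pair.integral_snd[of "\<lambda>s y. G (2 * \<epsilon>) (s, y)"] iG[OF e2] by (simp add: lborel_prod)
  also have "\<dots> = (LBINT y. (LBINT s. H (s, y)))"
  proof (rule Bochner_Integration.integral_cong[OF refl])
    fix y :: 'a
    have [measurable]: "(\<lambda>s. G (2 * \<epsilon>) (s, y)) \<in> borel_measurable borel"
      unfolding G_def by measurable
    have "(LBINT s. G (2 * \<epsilon>) (s, y)) = \<bar>2\<bar> ^ DIM(real) *\<^sub>R (LBINT t. G (2 * \<epsilon>) (0 + 2 *\<^sub>R t, y))"
      by (rule integral_lborel_affine) auto
    also have "\<dots> = (LBINT t. 2 * G (2 * \<epsilon>) (2 * t, y))" by simp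
    also have "\<dots> = (LBINT t. H (t, y))"
    proof (intro Bochner_Integration.integral_cong refl)
      fix t :: real
      have "smooth (2 * \<epsilon>) (2 *\<^sub>R (t *\<^sub>R y)) = smooth \<epsilon> (t *\<^sub>R y) / 2"
        using smooth_scale[OF e2, of 2 "t *\<^sub>R y"] by simp
      then show "2 * G (2 * \<epsilon>) (2 * t, y) = H (t, y)"
        by (simp add: G_def H_def mult.assoc)
    qed
    finally show "(LBINT s. G (2 * \<epsilon>) (s, y)) = (LBINT s. H (s, y))" .
  qed
  also have "\<dots> = (LBINT p. H p)"
    using lborel_pair.integral_snd[of "\<lambda>s y. H (s, y)"] iH by (simp add: lborel_prod)
  finally have GH: "(LBINT p. G (2 * \<epsilon>) p) = (LBINT p. H p)" .
  have eq: "?G p = G \<epsilon> p - H p" for p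
    by (simp add: radial_weight_def G_def H_def algebra_simps)
  show "integrable lborel (\<lambda>p. ?G p)"
    unfolding eq using iG[OF \<open>\<epsilon> > 0\<close>] iH by simp
  show "(LINT w|cone_measure C. smooth \<epsilon> w) - (LINT w|cone_measure C. smooth (2 * \<epsilon>) w)
     = (LBINT p. ?G p)"
    unfolding eq vG GH using iG[OF \<open>\<epsilon> > 0\<close>] iH by simp
qed

end

section \<open>Removing the smoothing\<close>

lemma radial_weight_nonneg: "0 \<le> radial_weight t"
  by (simp add: radial_weight_def power_mult_distrib)

lemma radial_weight_le_1: "radial_weight t \<le> 1"
  unfolding radial_weight_def
  by (smt (verit) exp_ge_zero exp_le_one_iff divide_nonpos_pos zero_le_power2)

lemma radial_weight_pos:
  assumes "t \<noteq> 0"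
  shows "0 < radial_weight t"
proof -
  have "t\<^sup>2 > 0" using assms by simp
  then show ?thesis by (simp add: radial_weight_def power_mult_distrib)
qed

text \<open>Factor out the larger Gaussian and use 1 - exp (-u) \<le> u with u = (2t)^2/2 - t^2/2 =
  3t^2/2.\<close>

lemma radial_weight_le: "radial_weight t \<le> 3 / 2 * t\<^sup>2 * exp (- t\<^sup>2 / 2)"
proof -
  have "radial_weight t = exp (- t\<^sup>2 / 2) * (1 - exp (- (3 / 2 * t\<^sup>2)))"
    by (simp add: radial_weight_def right_diff_distrib exp_add[symmetric] power_mult_distrib)
  also have "\<dots> \<le> exp (- t\<^sup>2 / 2) * (3 / 2 * t\<^sup>2)"
    using exp_ge_add_one_self[of "- (3 / 2 * t\<^sup>2)"] by (intro mult_left_mono) auto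
  finally show ?thesis by (simp add: mult_ac)
qed

lemma radial_weight_continuous: "continuous_on S radial_weight"
  unfolding radial_weight_def by (intro continuous_intros) auto

lemma radial_weight_measurable [measurable]: "radial_weight \<in> borel_measurable borel"
  by (intro borel_measurable_continuous_onI radial_weight_continuous)

text \<open>The positive multiple left undetermined in the overview. It is common to all sets C, so
  it cancels once shown finite and positive.\<close>

definition radial_const :: ennreal where
  "radial_const = (\<integral>\<^sup>+t. ennreal (radial_weight t / \<bar>t\<bar>) \<partial>lborel)"

lemma radial_const_finite: "radial_const < \<infinity>"
proof -
  have "radial_const \<le> (\<integral>\<^sup>+t. ennreal (3 / 2) * ennreal (\<bar>t\<bar> ^ 1 * exp (- t\<^sup>2 / 2)) \<partial>lborel)"
    unfolding radial_const_def
  proof (rule nn_integral_mono)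
    fix t :: real
    have "radial_weight t / \<bar>t\<bar> \<le> (3 / 2 * t\<^sup>2 * exp (- t\<^sup>2 / 2)) / \<bar>t\<bar>"
      by (intro divide_right_mono radial_weight_le) auto
    also have "\<dots> = 3 / 2 * (\<bar>t\<bar> ^ 1 * exp (- t\<^sup>2 / 2))"
      by (cases "t = 0") (auto simp: power2_eq_square abs_if)
    finally show "ennreal (radial_weight t / \<bar>t\<bar>) \<le> ennreal (3 / 2) * ennreal (\<bar>t\<bar> ^ 1 * exp (- t\<^sup>2 / 2))"
      by (subst ennreal_mult[symmetric]) (auto intro: ennreal_leI)
  qed
  also have "\<dots> = ennreal (3 / 2) * (\<integral>\<^sup>+t. ennreal (\<bar>t\<bar> ^ 1 * exp (- (t::real)\<^sup>2 / 2)) \<partial>lborel)"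
    by (rule nn_integral_cmult) measurable
  also have "\<dots> < \<infinity>" using nn_integral_gauss_moment_finite[of 1] by (simp add: ennreal_mult_less_top)
  finally show ?thesis .
qed

lemma radial_const_pos: "enn2real radial_const > 0"
proof -
  have "radial_const \<noteq> 0"
  proof
    assume "radial_const = 0"
    then have "AE t in lborel. ennreal (radial_weight t / \<bar>t\<bar>) = 0"
      unfolding radial_const_def by (subst (asm) nn_integral_0_iff_AE) auto
    then have "AE t in lborel. t = (0::real)"
    proof eventually_elim
      case (elim t)
      then have "radial_weight t / \<bar>t\<bar> \<le> 0" by (simp add: ennreal_eq_0_iff)
      then show ?case using radial_weight_pos[of t] divide_pos_pos[of "radial_weight t" "\<bar>t\<bar>"] by fastforce
    qed
    with AE_lborel_singleton[of "0::real"] have "AE t in (lborel :: real measure). False"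
      by eventually_elim simp
    then show False by (simp add: eventually_False ae_filter_eq_bot_iff)
  qed
  then show ?thesis using radial_const_finite by (simp add: enn2real_positive_iff less_top zero_less_iff_neq_zero)
qed

text \<open>The measure ds/|s| is invariant under dilations, so r = |y| drops out and the limit
  contains no weight in y besides f.\<close>

lemma nn_integral_radial_weight:
  assumes "r > 0"
  shows "(\<integral>\<^sup>+s. ennreal (radial_weight (s * r) / \<bar>s\<bar>) \<partial>lborel) = radial_const"
proof -
  have "(\<integral>\<^sup>+s. ennreal (radial_weight (s * r) / \<bar>s\<bar>) \<partial>lborel)
      = (\<integral>\<^sup>+s. ennreal r * ennreal (radial_weight (s * r) / \<bar>s * r\<bar>) \<partial>lborel)"
    using assms by (intro nn_integral_cong) (simp add: ennreal_mult[symmetric] radial_weight_nonneg abs_mult)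
  also have "\<dots> = ennreal r * (\<integral>\<^sup>+s. ennreal (radial_weight (s * r) / \<bar>s * r\<bar>) \<partial>lborel)"
    by (rule nn_integral_cmult) measurable
  also have "(\<integral>\<^sup>+s. ennreal (radial_weight (s * r) / \<bar>s * r\<bar>) \<partial>lborel) = ennreal (1 / r) * radial_const"
    unfolding radial_const_def using assms
    by (intro nn_integral_scale_real[where g = "\<lambda>t. ennreal (radial_weight t / \<bar>t\<bar>)"]) auto
  also have "ennreal r * (ennreal (1 / r) * radial_const) = radial_const"
    using assms by (simp add: mult.assoc[symmetric] ennreal_mult[symmetric])
  finally show ?thesis .
qed

lemma integrable_div_norm:
  fixes V :: "'a::euclidean_space \<Rightarrow> real"
  assumes dim: "DIM('a) \<ge> 2" and [measurable]: "V \<in> borel_measurable borel"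
    and V: "\<And>y. \<bar>V y\<bar> \<le> indicator (cball 0 R) y"
  shows "integrable lborel (\<lambda>y. V y * (1 / norm y))"
proof (rule Bochner_Integration.integrable_bound)
  show "integrable lborel (\<lambda>y::'a. indicator (cball 0 R) y * (1 / norm y))"
  proof (rule integrableI_nonneg)
    have "ennreal (indicator (cball 0 R) y * (1 / norm y)) = indicator (cball 0 R) y * ennreal (1 / norm y)" for y :: 'a
      by (auto simp: indicator_def)
    then show "(\<integral>\<^sup>+y. ennreal (indicator (cball 0 R) y * (1 / norm (y::'a))) \<partial>lborel) < \<infinity>"
      using nn_integral_cball_div_norm_finite[OF dim, of R] by simp
  qed auto
  show "AE y in lborel. norm (V y * (1 / norm y)) \<le> norm (indicator (cball 0 R) y * (1 / norm y))"
    using V by (intro AE_I2) (auto simp: abs_mult intro!: divide_right_mono)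
qed measurable

section \<open>Weak convergence of the smoothed kernel\<close>

context homogeneous_kernel
begin

lemma smooth_decay': "\<epsilon> > 0 \<Longrightarrow> y \<noteq> 0 \<Longrightarrow> smooth \<epsilon> y \<le> decay_const * (1 / norm y)"
  using smooth_decay by simp

lemma f_decay: "f y \<le> decay_const * (1 / norm y)"
proof -
  have "A / norm y \<le> decay_const / norm y"
    using decay_const_ge A_nonneg by (intro divide_right_mono) auto
  then show ?thesis using f_le[of y] by simp
qed

lemma integrable_smooth_weight:
  assumes "V \<in> borel_measurable borel" "\<And>y. \<bar>V y\<bar> \<le> indicator (cball 0 R) y"
  shows "\<epsilon> > 0 \<Longrightarrow> integrable lborel (\<lambda>y. V y * smooth \<epsilon> y)" and "integrable lborel (\<lambda>y. V y * f y)"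
proof -
  note [measurable] = assms(1)
  have i: "integrable lborel (\<lambda>y. decay_const * (V y * (1 / norm y)))"
    by (intro integrable_mult_right integrable_div_norm[OF dim assms])
  have d0: "decay_const \<ge> 0" using decay_const_ge A_nonneg by simp
  show "integrable lborel (\<lambda>y. V y * smooth \<epsilon> y)" if "\<epsilon> > 0"
  proof (rule Bochner_Integration.integrable_bound[OF i])
    show "AE y in lborel. norm (V y * smooth \<epsilon> y) \<le> norm (decay_const * (V y * (1 / norm y)))"
      using AE_lborel_singleton[of "0::'a"]
    proof eventually_elim
      case (elim y)
      have "\<bar>V y\<bar> * smooth \<epsilon> y \<le> \<bar>V y\<bar> * (decay_const * (1 / norm y))"
        by (intro mult_left_mono smooth_decay' that elim) auto
      then show ?case using d0 smooth_nonneg[of \<epsilon> y] by (simp add: abs_mult mult_ac)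
    qed
  qed measurable
  show "integrable lborel (\<lambda>y. V y * f y)"
  proof (rule Bochner_Integration.integrable_bound[OF i])
    show "AE y in lborel. norm (V y * f y) \<le> norm (decay_const * (V y * (1 / norm y)))"
    proof (rule AE_I2)
      fix y
      have "\<bar>V y\<bar> * f y \<le> \<bar>V y\<bar> * (decay_const * (1 / norm y))"
        by (intro mult_left_mono f_decay) auto
      then show "norm (V y * f y) \<le> norm (decay_const * (V y * (1 / norm y)))"
        using d0 f_nonneg[of y] by (simp add: abs_mult mult_ac)
    qed
  qed measurable
qed

text \<open>The translation sits on the continuous V rather than on f, which is only measurable. All
  the translates are supported in one larger ball because the displacements are bounded.\<close>

lemma integral_translate_tendsto:
  assumes cont: "continuous_on UNIV V" and V: "\<And>y. \<bar>V y\<bar> \<le> indicator (cball 0 R) y"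
    and d: "d \<longlonglongrightarrow> 0"
  shows "(\<lambda>m. LBINT x. V (x - d m *\<^sub>R z) * f x) \<longlonglongrightarrow> (LBINT x. V x * f x)"
proof -
  have [measurable]: "V \<in> borel_measurable borel" using cont by (rule borel_measurable_continuous_onI)
  obtain D where D: "\<And>m. \<bar>d m\<bar> \<le> D"
    using convergent_imp_Bseq[OF convergentI[OF d]] unfolding Bseq_def by auto
  define R' where "R' = R + D * norm z"
  show ?thesis
  proof (rule integral_dominated_convergence)
    show "integrable lborel (\<lambda>x. indicator (cball 0 R') x * f x)"
      by (rule integrable_smooth_weight(2)[where R = R']) auto
    show "AE x in lborel. norm (V (x - d m *\<^sub>R z) * f x) \<le> indicator (cball 0 R') x * f x" for m
    proof (rule AE_I2)
      fix x
      have "norm x \<le> norm (x - d m *\<^sub>R z) + norm (d m *\<^sub>R z)"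
        using norm_triangle_ineq[of "x - d m *\<^sub>R z" "d m *\<^sub>R z"] by simp
      also have "norm (d m *\<^sub>R z) \<le> D * norm z" using D[of m] by (simp add: mult_right_mono)
      finally have "indicator (cball 0 R) (x - d m *\<^sub>R z) \<le> (indicator (cball 0 R') x :: real)"
        by (auto simp: indicator_def R'_def)
      then have "\<bar>V (x - d m *\<^sub>R z)\<bar> \<le> indicator (cball 0 R') x" using V order_trans by blast
      then show "norm (V (x - d m *\<^sub>R z) * f x) \<le> indicator (cball 0 R') x * f x"
        using f_nonneg[of x] by (simp add: abs_mult mult_right_mono)
    qed
    show "AE x in lborel. (\<lambda>m. V (x - d m *\<^sub>R z) * f x) \<longlonglongrightarrow> V x * f x"
    proof (intro AE_I2 tendsto_mult tendsto_const)
      fix x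
      have "(\<lambda>m. x - d m *\<^sub>R z) \<longlonglongrightarrow> x - 0 *\<^sub>R z" by (intro tendsto_intros d)
      moreover have "isCont V x" using cont by (simp add: continuous_on_eq_continuous_at)
      ultimately show "(\<lambda>m. V (x - d m *\<^sub>R z)) \<longlonglongrightarrow> V x"
        by (intro isCont_tendsto_compose[of x V]) auto
    qed
  qed measurable
qed

text \<open>Uniform in a, hence a constant multiple of the Gaussian dominates when a = \<epsilon> z
  is integrated over z.\<close>

lemma integral_translate_bound:
  assumes [measurable]: "V \<in> borel_measurable borel" and V: "\<And>y. \<bar>V y\<bar> \<le> indicator (cball 0 R) y"
  shows "norm (LBINT y. V y * f (y + a)) \<le> A * enn2real (inv_norm_const TYPE('a) + emeasure lborel (cball (0::'a) R))"
proof -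
  let ?m = "\<lambda>y. indicator (cball 0 R) y * ennreal (1 / norm (a + y))"
  let ?l = "\<lambda>y. ennreal (norm (V y * f (y + a)))"
  let ?c = "inv_norm_const TYPE('a) + emeasure lborel (cball (0::'a) R)"
  have fin: "?c < \<infinity>"
    using inv_norm_const_finite[OF dim] emeasure_lborel_cball_finite[of "0::'a" R] by simp
  have "ennreal (norm (LBINT y. V y * f (y + a))) \<le> (\<integral>\<^sup>+y. ?l y \<partial>lborel)"
  proof (cases "integrable lborel (\<lambda>y. V y * f (y + a))")
    case True then show ?thesis by (rule integral_norm_bound_ennreal)
  qed (simp add: not_integrable_integral_eq)
  also have "\<dots> \<le> (\<integral>\<^sup>+y. ennreal A * (?m y) \<partial>lborel)"
  proof (rule nn_integral_mono)
    fix y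
    have "norm (V y * f (y + a)) \<le> indicator (cball 0 R) y * (A / norm (y + a))"
      unfolding real_norm_def abs_mult abs_of_nonneg[OF f_nonneg] by (intro mult_mono V f_le f_nonneg) auto
    then have "?l y \<le> ennreal (indicator (cball 0 R) y * (A / norm (y + a)))"
      by (rule ennreal_leI)
    also have "\<dots> = ennreal A * (?m y)"
      using A_nonneg by (auto simp: indicator_def ennreal_mult[symmetric] add.commute)
    finally show "?l y \<le> ennreal A * (?m y)" .
  qed
  also have "\<dots> = ennreal A * (\<integral>\<^sup>+y. ?m y \<partial>lborel)"
    by (rule nn_integral_cmult) measurable
  also have "\<dots> \<le> ennreal A * (inv_norm_const TYPE('a) + (\<integral>\<^sup>+y. indicator (cball (0::'a) R) y \<partial>lborel))"
    by (intro mult_left_mono nn_integral_div_norm_le) (auto simp: indicator_def)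
  also have "\<dots> = ennreal A * ennreal (enn2real ?c)" using fin by simp
  also have "\<dots> = ennreal (A * enn2real ?c)" using A_nonneg by (simp add: ennreal_mult)
  finally show ?thesis using A_nonneg by (subst (asm) ennreal_le_iff) auto
qed

text \<open>Fubini makes the Gaussian integral the outer one; for each z the translation is then
  shifted from f to V, where continuity gives the limit.\<close>

lemma smooth_tendsto_continuous:
  assumes cont: "continuous_on UNIV V" and V: "\<And>y. \<bar>V y\<bar> \<le> indicator (cball 0 R) y"
    and d0: "\<And>m. d m > 0" and d: "d \<longlonglongrightarrow> 0"
  shows "(\<lambda>m. LBINT y. V y * smooth (d m) y) \<longlonglongrightarrow> (LBINT y. V y * f y)"
proof -
  have [measurable]: "V \<in> borel_measurable borel" using cont by (rule borel_measurable_continuous_onI)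
  have swap: "(LBINT y. V y * smooth e y) = (LBINT z. (LBINT y. V y * f (y + e *\<^sub>R z)) * gauss z)"
    if "e > 0" for e
  proof -
    define G where "G y z = V y * (f (y + e *\<^sub>R z) * gauss z)" for y z
    have int_G: "integrable (lborel \<Otimes>\<^sub>M lborel) (case_prod G)"
    proof (rule lborel_pair.Fubini_integrable)
      have i: "integrable lborel (G y)" for y
        unfolding G_def[abs_def] by (intro integrable_mult_right integrable_smooth that)
      then show "AE y in lborel. integrable lborel (\<lambda>z. case_prod G (y, z))" by simp
      have "(LBINT z. norm (G y z)) = \<bar>V y\<bar> * smooth e y" for y
      proof -
        have "norm (G y z) = \<bar>V y\<bar> * (f (y + e *\<^sub>R z) * gauss z)" for z
          using f_nonneg by (simp add: G_def abs_mult)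
        then show ?thesis by (simp add: smooth_def)
      qed
      then show "integrable lborel (\<lambda>y. LBINT z. norm (case_prod G (y, z)))"
        using integrable_smooth_weight(1)[of "\<lambda>y. \<bar>V y\<bar>" R, OF _ _ that] V by simp
    qed (unfold G_def, measurable)
    have "(LBINT y. V y * smooth e y) = (LBINT y. (LBINT z. G y z))"
      by (simp add: G_def smooth_def)
    also have "\<dots> = (LBINT z. (LBINT y. G y z))"
      by (rule lborel_pair.Fubini_integral[OF int_G, symmetric])
    also have "\<dots> = (LBINT z. (LBINT y. V y * f (y + e *\<^sub>R z)) * gauss z)"
      by (simp add: G_def mult.assoc[symmetric])
    finally show ?thesis .
  qed
  have "(\<lambda>m. LBINT z. (LBINT y. V y * f (y + d m *\<^sub>R z)) * gauss z)
     \<longlonglongrightarrow> (LBINT z. (LBINT y. V y * f y) * gauss (z::'a))"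
  proof (rule integral_dominated_convergence)
    let ?B = "A * enn2real (inv_norm_const TYPE('a) + emeasure lborel (cball (0::'a) R))"
    show "integrable lborel (\<lambda>z::'a. ?B * gauss z)" by (intro integrable_mult_right integrable_gauss)
    show "AE z in lborel. norm ((LBINT y. V y * f (y + d m *\<^sub>R z)) * gauss z) \<le> ?B * gauss z" for m
      using integral_translate_bound[OF _ V] by (intro AE_I2) (simp add: abs_mult mult_right_mono)
    show "AE z in lborel. (\<lambda>m. (LBINT y. V y * f (y + d m *\<^sub>R z)) * gauss z) \<longlonglongrightarrow> (LBINT y. V y * f y) * gauss (z::'a)"
    proof (intro AE_I2 tendsto_mult tendsto_const)
      fix z :: 'a
      have "(LBINT y. V y * f (y + d m *\<^sub>R z)) = (LBINT x. V (x - d m *\<^sub>R z) * f x)" for m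
        by (subst (2) integral_lborel_affine[where c = 1 and t = "d m *\<^sub>R z"]) (auto simp: add.commute)
      then show "(\<lambda>m. LBINT y. V y * f (y + d m *\<^sub>R z)) \<longlonglongrightarrow> (LBINT y. V y * f y)"
        using integral_translate_tendsto[OF cont V d, of z] by simp
    qed
  qed measurable
  moreover have "(LBINT z. gauss (z::'a)) = 1"
    using integral_gauss_cos[of "0::'a" 0] by simp
  ultimately show ?thesis by (simp add: swap[OF d0])
qed

text \<open>Replacing the indicator by a tent costs at most the integral of their difference against
  \<open>decay_const\<close>/|y|. By the uniform decay this error is the same for every width and
  for f itself, so the continuous case transfers. The factor k will be the radial weight at fixed
  s.\<close>

lemma smooth_tendsto_compact:
  assumes C: "compact C" "C \<noteq> {}" and cont: "continuous_on UNIV k" and k0: "\<And>y. 0 \<le> k y" and k1: "\<And>y. k y \<le> 1"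
    and d0: "\<And>m. d m > 0" and d: "d \<longlonglongrightarrow> 0"
  shows "(\<lambda>m. LBINT y. (indicator C y * k y) * smooth (d m) y) \<longlonglongrightarrow> (LBINT y. (indicator C y * k y) * f y)"
    (is "?Z \<longlonglongrightarrow> ?W")
proof -
  obtain R K where R: "R > 0" "C \<subseteq> cball 0 R" and Kc: "\<And>m. continuous_on UNIV (K m)"
    and K0: "\<And>m y. 0 \<le> (K m y :: real)" and K1: "\<And>m y. K m y \<le> indicator (cball 0 R) y"
    and Klim: "\<And>y. (\<lambda>m::nat. K m y) \<longlonglongrightarrow> indicator C y" and KC: "\<And>m y. indicator C y \<le> K m y"
    by (rule continuous_approx_indicator[OF C]) blast
  have [measurable]: "C \<in> sets borel" using C(1) by (rule borel_compact)
  have [measurable]: "k \<in> borel_measurable borel" "K m \<in> borel_measurable borel" for m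
    using cont Kc by (auto intro: borel_measurable_continuous_onI)
  have d0': "decay_const \<ge> 0" using decay_const_ge A_nonneg by simp
  have CV: "\<bar>indicator C y * k y\<bar> \<le> indicator (cball 0 R) y" for y
    using R(2) k0[of y] k1[of y] by (auto simp: indicator_def)
  have KV: "\<bar>K j y * k y\<bar> \<le> indicator (cball 0 R) y" for j y
    using K0[of j y] K1[of j y] k0[of y] k1[of y] mult_left_le[of "k y" "K j y"] by (simp add: abs_mult)
  have DV: "\<bar>K j y - indicator C y\<bar> \<le> indicator (cball 0 R) y" for j y
    using K1[of j y] KC[of y j] by (simp add: abs_if) (metis indicator_pos_le diff_le_eq add_increasing2 order_trans)
  define e where "e j = (LBINT y. decay_const * ((K j y - indicator C y) * (1 / norm y)))" for j
  have ie: "integrable lborel (\<lambda>y. decay_const * ((K j y - indicator C y) * (1 / norm y)))" for j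
    by (intro integrable_mult_right integrable_div_norm[OF dim _ DV]) measurable
  have "e \<longlonglongrightarrow> (LINT y|(lborel :: 'a measure). 0)"
    unfolding e_def
  proof (rule integral_dominated_convergence)
    show "integrable lborel (\<lambda>y::'a. decay_const * (indicator (cball 0 R) y * (1 / norm y)))"
      by (intro integrable_mult_right integrable_div_norm[OF dim, where R = R]) auto
    show "AE y in lborel. norm (decay_const * ((K j y - indicator C y) * (1 / norm y))) \<le> decay_const * (indicator (cball 0 R) y * (1 / norm y))" for j
      using DV d0' by (intro AE_I2) (simp only: real_norm_def abs_mult abs_of_nonneg, intro mult_left_mono mult_right_mono, auto intro!: divide_right_mono)
    show "AE y in lborel. (\<lambda>j. decay_const * ((K j y - indicator C y) * (1 / norm y))) \<longlonglongrightarrow> 0"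
    proof (rule AE_I2)
      fix y :: 'a
      have "(\<lambda>j. decay_const * ((K j y - indicator C y) * (1 / norm y))) \<longlonglongrightarrow> decay_const * ((indicator C y - indicator C y) * (1 / norm y))"
        by (intro tendsto_intros Klim)
      then show "(\<lambda>j. decay_const * ((K j y - indicator C y) * (1 / norm y))) \<longlonglongrightarrow> 0" by simp
    qed
  qed measurable
  then have e0: "e \<longlonglongrightarrow> 0" by simp
  have diff: "\<bar>(LBINT y. (K j y * k y) * g y) - (LBINT y. (indicator C y * k y) * g y)\<bar> \<le> e j"
    if g: "\<And>y. 0 \<le> g y" "\<And>y. y \<noteq> 0 \<Longrightarrow> g y \<le> decay_const * (1 / norm y)"
      and i1: "integrable lborel (\<lambda>y. (K j y * k y) * g y)" and i2: "integrable lborel (\<lambda>y. (indicator C y * k y) * g y)" for g j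
  proof -
    have "\<bar>(LBINT y. (K j y * k y) * g y) - (LBINT y. (indicator C y * k y) * g y)\<bar>
       = norm (LBINT y. (K j y * k y) * g y - (indicator C y * k y) * g y)"
      using i1 i2 by simp
    also have "\<dots> \<le> (LBINT y. norm ((K j y * k y) * g y - (indicator C y * k y) * g y))"
      by (rule integral_norm_bound)
    also have "\<dots> \<le> e j"
      unfolding e_def
    proof (rule integral_mono_AE)
      show "integrable lborel (\<lambda>y. norm ((K j y * k y) * g y - (indicator C y * k y) * g y))"
        using i1 i2 by (intro integrable_norm Bochner_Integration.integrable_diff)
      show "AE y in lborel. norm ((K j y * k y) * g y - (indicator C y * k y) * g y) \<le> decay_const * ((K j y - indicator C y) * (1 / norm y))"
        using AE_lborel_singleton[of "0::'a"]
      proof eventually_elim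
        case (elim y)
        have D: "0 \<le> K j y - indicator C y" using KC[of y j] by simp
        have "norm ((K j y * k y) * g y - (indicator C y * k y) * g y) = (K j y - indicator C y) * (k y * g y)"
          using D k0[of y] g(1)[of y] by (simp add: left_diff_distrib[symmetric] abs_mult)
        also have "\<dots> \<le> (K j y - indicator C y) * (1 * (decay_const * (1 / norm y)))"
          using D k0 k1 g elim by (intro mult_left_mono mult_mono) auto
        finally show ?case by (simp add: mult_ac)
      qed
    qed (rule ie)
    finally show ?thesis .
  qed
  let ?X = "\<lambda>j m. LBINT y. (K j y * k y) * smooth (d m) y"
  let ?Y = "\<lambda>j. LBINT y. (K j y * k y) * f y"
  show ?thesis
  proof (rule LIMSEQ_I)
    fix \<epsilon> :: real assume \<epsilon>: "\<epsilon> > 0"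
    \<comment> \<open>One j serves all m, because \<open>e j\<close> bounds the error for every
      width at once.\<close>
    obtain j where j: "\<bar>e j\<bar> < \<epsilon> / 3"
      using LIMSEQ_D[OF e0, of "\<epsilon> / 3"] \<epsilon> by auto
    have lim: "?X j \<longlonglongrightarrow> ?Y j"
      by (rule smooth_tendsto_continuous[OF _ KV d0 d]) (intro continuous_intros Kc cont)
    obtain N where N: "\<And>m. m \<ge> N \<Longrightarrow> norm (?X j m - ?Y j) < \<epsilon> / 3"
      using LIMSEQ_D[OF lim, of "\<epsilon> / 3"] \<epsilon> by auto
    have a: "\<bar>?X j m - ?Z m\<bar> \<le> e j" for m
    proof (rule diff[OF smooth_nonneg smooth_decay'[OF d0]])
      show "integrable lborel (\<lambda>y. (K j y * k y) * smooth (d m) y)" "integrable lborel (\<lambda>y. (indicator C y * k y) * smooth (d m) y)"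
        by (rule integrable_smooth_weight(1)[OF _ KV d0], measurable, rule integrable_smooth_weight(1)[OF _ CV d0], measurable)
    qed
    have b: "\<bar>?Y j - ?W\<bar> \<le> e j"
    proof (rule diff[OF f_nonneg f_decay])
      show "integrable lborel (\<lambda>y. (K j y * k y) * f y)" "integrable lborel (\<lambda>y. (indicator C y * k y) * f y)"
        by (rule integrable_smooth_weight(2)[OF _ KV], measurable, rule integrable_smooth_weight(2)[OF _ CV], measurable)
    qed
    have "norm (?Z m - ?W) < \<epsilon>" if "m \<ge> N" for m
      using N[OF that] a[of m] b j unfolding real_norm_def by linarith
    then show "\<exists>N. \<forall>m\<ge>N. norm (?Z m - ?W) < \<epsilon>"
      by blast
  qed
qed


text \<open>For fixed s \<noteq> 0, \<open>smooth_scale\<close> turns the inner integral over y into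
  one of width d m/|s| with a prefactor 1/|s|, and \<open>smooth_tendsto_compact\<close> gives its
  limit. The uniform decay bound at s y yields the dominating function w; it is integrable because
  the radial weight absorbs 1/|s| at 0.\<close>

lemma cone_smooth_diff_tendsto:
  assumes C: "compact C" "C \<noteq> {}" and d0: "\<And>m. d m > 0" and d: "d \<longlonglongrightarrow> 0"
  shows "(\<lambda>m. (LINT w|cone_measure C. smooth (d m) w) - (LINT w|cone_measure C. smooth (2 * d m) w))
    \<longlonglongrightarrow> enn2real radial_const * (LBINT y. indicator C y * f y)"
proof -
  let ?v = "\<lambda>s y. indicator C y * radial_weight (s * norm y)"
  have [measurable]: "C \<in> sets borel" using C(1) by (rule borel_compact)
  obtain R where R: "C \<subseteq> cball 0 R"
    using compact_imp_bounded[OF C(1)] unfolding bounded_iff by (auto simp: subset_eq)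
  have d0': "decay_const \<ge> 0" using decay_const_ge A_nonneg by simp
  define G where "G m s y = ?v s y * smooth (d m) (s *\<^sub>R y)" for m and s :: real and y
  define g where "g s y = 1 / \<bar>s\<bar> * (?v s y * f y)" for s :: real and y
  define w where "w s y = decay_const * (1 / \<bar>s\<bar> * ?v s y * (1 / norm y))" for s :: real and y :: 'a
  have mG [measurable]: "case_prod (G m) \<in> borel_measurable (lborel \<Otimes>\<^sub>M lborel)" for m
    unfolding G_def by measurable
  have mg [measurable]: "case_prod g \<in> borel_measurable (lborel \<Otimes>\<^sub>M lborel)"
    unfolding g_def by measurable
  have mw [measurable]: "case_prod w \<in> borel_measurable (lborel \<Otimes>\<^sub>M lborel)"
    unfolding w_def by measurable
  have w0: "0 \<le> w s y" for s y using d0' radial_weight_nonneg by (simp add: w_def)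
  have iw: "integrable (lborel \<Otimes>\<^sub>M lborel) (case_prod w)"
  proof (rule integrableI_nonneg)
    have "(\<integral>\<^sup>+p. ennreal (case_prod w p) \<partial>(lborel \<Otimes>\<^sub>M lborel)) = (\<integral>\<^sup>+y. (\<integral>\<^sup>+s. ennreal (w s y) \<partial>lborel) \<partial>lborel)"
      using lborel_pair.nn_integral_snd[of "\<lambda>p. ennreal (case_prod w p)"] by simp
    also have "\<dots> \<le> (\<integral>\<^sup>+y. (ennreal decay_const * radial_const) * (indicator (cball (0::'a) R) y * ennreal (1 / norm y)) \<partial>lborel)"
    proof (rule nn_integral_mono_AE)
      show "AE y in lborel. (\<integral>\<^sup>+s. ennreal (w s y) \<partial>lborel) \<le> (ennreal decay_const * radial_const) * (indicator (cball (0::'a) R) y * ennreal (1 / norm y))"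
        using AE_lborel_singleton[of "0::'a"]
      proof eventually_elim
        case (elim y)
        have "ennreal (w s y) = (ennreal decay_const * (indicator C y * ennreal (1 / norm y))) * ennreal (radial_weight (s * norm y) / \<bar>s\<bar>)" for s
          using d0' radial_weight_nonneg by (auto simp: w_def indicator_def ennreal_mult[symmetric] mult_ac)
        then have "(\<integral>\<^sup>+s. ennreal (w s y) \<partial>lborel)
            = (ennreal decay_const * (indicator C y * ennreal (1 / norm y))) * (\<integral>\<^sup>+s. ennreal (radial_weight (s * norm y) / \<bar>s\<bar>) \<partial>lborel)"
          by (simp add: nn_integral_cmult)
        also have "\<dots> = (ennreal decay_const * radial_const) * (indicator C y * ennreal (1 / norm y))"
          using elim by (simp add: nn_integral_radial_weight mult_ac)
        also have "\<dots> \<le> (ennreal decay_const * radial_const) * (indicator (cball (0::'a) R) y * ennreal (1 / norm y))"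
          using R by (intro mult_left_mono mult_right_mono) (auto simp: indicator_def)
        finally show ?case .
      qed
    qed
    also have "\<dots> = (ennreal decay_const * radial_const) * (\<integral>\<^sup>+y. indicator (cball (0::'a) R) y * ennreal (1 / norm y) \<partial>lborel)"
      by (rule nn_integral_cmult) measurable
    also have "\<dots> < \<infinity>"
      using radial_const_finite nn_integral_cball_div_norm_finite[OF dim, of R] by (simp add: ennreal_mult_less_top)
    finally show "(\<integral>\<^sup>+p. ennreal (case_prod w p) \<partial>(lborel \<Otimes>\<^sub>M lborel)) < \<infinity>" .
  qed (use w0 in auto)
  have iws: "integrable lborel (w s)" for s
  proof -
    have V: "\<bar>?v s y\<bar> \<le> indicator (cball 0 R) y" for y
      using R radial_weight_nonneg[of "s * norm y"] radial_weight_le_1[of "s * norm y"] by (auto simp: indicator_def)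
    have "integrable lborel (\<lambda>y. decay_const * (1 / \<bar>s\<bar> * (?v s y * (1 / norm y))))"
      by (intro integrable_mult_right integrable_div_norm[OF dim _ V]) measurable
    then show ?thesis by (simp add: w_def[abs_def] mult_ac)
  qed
  have Gw: "\<bar>G m s y\<bar> \<le> w s y" if "s \<noteq> 0" "y \<noteq> 0" for m s y
  proof -
    have "smooth (d m) (s *\<^sub>R y) \<le> decay_const * (1 / \<bar>s\<bar> * (1 / norm y))"
      using smooth_decay[OF d0, of "s *\<^sub>R y" m] that by simp
    then have "?v s y * smooth (d m) (s *\<^sub>R y)
       \<le> ?v s y * (decay_const * (1 / \<bar>s\<bar> * (1 / norm y)))"
      by (intro mult_left_mono mult_nonneg_nonneg radial_weight_nonneg) auto
    then show ?thesis
      using radial_weight_nonneg[of "s * norm y"] smooth_nonneg[of "d m" "s *\<^sub>R y"] by (simp add: G_def w_def abs_mult mult_ac)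
  qed
  have gw: "\<bar>g s y\<bar> \<le> w s y" for s y
  proof -
    have "1 / \<bar>s\<bar> * ?v s y * f y \<le> 1 / \<bar>s\<bar> * ?v s y * (decay_const * (1 / norm y))"
      by (intro mult_left_mono mult_nonneg_nonneg radial_weight_nonneg f_decay) auto
    then show ?thesis
      using radial_weight_nonneg[of "s * norm y"] f_nonneg[of y] by (simp add: g_def w_def abs_mult mult_ac)
  qed
  have ig: "integrable (lborel \<Otimes>\<^sub>M lborel) (case_prod g)"
    by (rule Bochner_Integration.integrable_bound[OF iw]) (auto intro!: AE_I2 order_trans[OF gw] simp: w0)
  have iG: "integrable (lborel \<Otimes>\<^sub>M lborel) (case_prod (G m))" for m
    using cone_smooth_diff(1)[OF C(1) d0, of m] by (simp add: lborel_prod G_def case_prod_unfold)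
  have val: "(LINT w|cone_measure C. smooth (d m) w) - (LINT w|cone_measure C. smooth (2 * d m) w)
      = (LBINT s. (LBINT y. G m s y))" for m
    using cone_smooth_diff(2)[OF C(1) d0, of m] lborel_pair.integral_fst[OF iG[of m]]
    by (simp add: lborel_prod G_def case_prod_unfold)
  have "(\<lambda>m. LBINT s. (LBINT y. G m s y)) \<longlonglongrightarrow> (LBINT s. (LBINT y. g s y))"
  proof (rule integral_dominated_convergence)
    show "integrable lborel (\<lambda>s. LBINT y. w s y)"
      using lborel_pair.integrable_fst[OF iw] .
    show "AE s in lborel. norm (LBINT y. G m s y) \<le> (LBINT y. w s y)" for m
      using AE_lborel_singleton[of "0::real"]
    proof eventually_elim
      case (elim s)
      have AEb: "AE y in lborel. norm (G m s y) \<le> w s y"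
        using AE_lborel_singleton[of "0::'a"] by eventually_elim (use Gw[OF elim] in simp)
      have [measurable]: "G m s \<in> borel_measurable borel"
        unfolding G_def by measurable
      have "integrable lborel (G m s)"
        by (rule Bochner_Integration.integrable_bound[OF iws[of s]]) (use AEb in \<open>auto simp: w0\<close>)
      then have "(LBINT y. norm (G m s y)) \<le> (LBINT y. w s y)"
        by (intro integral_mono_AE integrable_norm iws AEb)
      then show ?case using integral_norm_bound[of lborel "G m s"] by linarith
    qed
    show "AE s in lborel. (\<lambda>m. LBINT y. G m s y) \<longlonglongrightarrow> (LBINT y. g s y)"
      using AE_lborel_singleton[of "0::real"]
    proof eventually_elim
      case (elim s)
      have eq: "G m s y = 1 / \<bar>s\<bar> * (?v s y * smooth (d m / \<bar>s\<bar>) y)" for m y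
        unfolding G_def smooth_scale[OF d0 elim] by simp
      have "(\<lambda>m. LBINT y. ?v s y * smooth (d m / \<bar>s\<bar>) y)
         \<longlonglongrightarrow> (LBINT y. ?v s y * f y)"
      proof (rule smooth_tendsto_compact[OF C])
        show "continuous_on UNIV (\<lambda>y::'a. radial_weight (s * norm y))"
          unfolding radial_weight_def by (intro continuous_intros) auto
        show "d m / \<bar>s\<bar> > 0" for m using d0 elim by simp
        show "(\<lambda>m. d m / \<bar>s\<bar>) \<longlonglongrightarrow> 0" using tendsto_divide[OF d tendsto_const[of "\<bar>s\<bar>"]] elim by simp
      qed (auto simp: radial_weight_nonneg radial_weight_le_1)
      from tendsto_mult[OF tendsto_const[of "1 / \<bar>s\<bar>"] this] show ?case
        unfolding eq g_def by (simp only: integral_mult_right_zero)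
    qed
  qed measurable
  \<comment> \<open>The limit needed y innermost; evaluating it needs s innermost, where the
    integral is \<open>radial_const\<close> for every y \<noteq> 0.\<close>
  also have "(LBINT s. (LBINT y. g s y)) = (LBINT y. (LBINT s. g s y))"
    by (rule lborel_pair.Fubini_integral[OF ig, symmetric])
  also have "\<dots> = (LBINT y. enn2real radial_const * (indicator C y * f y))"
  proof (rule integral_cong_AE)
    show "AE y in lborel. (LBINT s. g s y) = enn2real radial_const * (indicator C y * f y)"
      using AE_lborel_singleton[of "0::'a"]
    proof eventually_elim
      case (elim y)
      have "g s y = (indicator C y * f y) * (radial_weight (s * norm y) / \<bar>s\<bar>)" for s by (simp add: g_def)
      then have "(LBINT s. g s y) = (indicator C y * f y) * (LBINT s. radial_weight (s * norm y) / \<bar>s\<bar>)"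
        by (simp only: integral_mult_right_zero)
      also have "(LBINT s. radial_weight (s * norm y) / \<bar>s\<bar>) = enn2real radial_const"
        using elim nn_integral_radial_weight[of "norm y"]
        by (subst integral_eq_nn_integral) (auto simp: radial_weight_nonneg)
      finally show ?case by simp
    qed
  qed measurable
  also have "\<dots> = enn2real radial_const * (LBINT y. indicator C y * f y)"
    by (rule integral_mult_right_zero)
  finally show ?thesis unfolding val .
qed

lemma integral_mono_of_cone_cos:
  assumes pd: "positive_definite (function_distribution f)"
    and K: "compact K" "K \<noteq> {}" and L: "compact L" "L \<noteq> {}"
    and le: "\<And>\<xi>. cone_cos (indicator K) 0 \<xi> \<le> cone_cos (indicator L) 0 \<xi>"
  shows "(LBINT y. indicator K y * f y) \<le> (LBINT y. indicator L y * f y)"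
proof -
  define d where "d m = 1 / real (Suc m)" for m
  have d: "d m > 0" "d \<longlonglongrightarrow> 0" for m
    using LIMSEQ_inverse_real_of_nat by (simp_all add: d_def[abs_def] inverse_eq_divide)
  have "enn2real radial_const * (LBINT y. indicator K y * f y) \<le> enn2real radial_const * (LBINT y. indicator L y * f y)"
    by (rule LIMSEQ_le[OF cone_smooth_diff_tendsto[OF K d] cone_smooth_diff_tendsto[OF L d]])
       (use cone_smooth_mono[OF pd K(1) L(1) le d(1)] in blast)
  then show ?thesis using radial_const_pos by simp
qed

end

section \<open>The Minkowski functional\<close>

lemma minkowski_functional_le:
  assumes "0 < a" "x \<in> (\<lambda>y. a *\<^sub>R y) ` M"
  shows "minkowski_functional M x \<le> ennreal a"
  unfolding minkowski_functional_def using assms by (intro Inf_lower) auto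

lemma minkowski_functional_ge:
  assumes "\<And>a. 0 < a \<Longrightarrow> x \<in> (\<lambda>y. a *\<^sub>R y) ` M \<Longrightarrow> c \<le> ennreal a"
  shows "c \<le> minkowski_functional M x"
  unfolding minkowski_functional_def using assms by (intro Inf_greatest) auto

lemma minkowski_functional_scale_le:
  assumes "0 < c"
  shows "minkowski_functional M (c *\<^sub>R x) \<le> ennreal c * minkowski_functional M x"
proof -
  have "ennreal (1 / c) * minkowski_functional M (c *\<^sub>R x) \<le> minkowski_functional M x"
  proof (rule minkowski_functional_ge)
    fix a assume a: "0 < a" "x \<in> (\<lambda>y. a *\<^sub>R y) ` M"
    then have "c *\<^sub>R x \<in> (\<lambda>y. (c * a) *\<^sub>R y) ` M" by auto
    then have "minkowski_functional M (c *\<^sub>R x) \<le> ennreal (c * a)"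
      using a assms by (intro minkowski_functional_le) auto
    then have "ennreal (1 / c) * minkowski_functional M (c *\<^sub>R x) \<le> ennreal (1 / c) * ennreal (c * a)"
      by (rule mult_left_mono) simp
    also have "\<dots> = ennreal a" using a assms by (simp add: ennreal_mult[symmetric])
    finally show "ennreal (1 / c) * minkowski_functional M (c *\<^sub>R x) \<le> ennreal a" .
  qed
  then have "ennreal c * (ennreal (1 / c) * minkowski_functional M (c *\<^sub>R x)) \<le> ennreal c * minkowski_functional M x"
    by (rule mult_left_mono) simp
  then show ?thesis using assms by (simp add: mult.assoc[symmetric] ennreal_mult[symmetric])
qed

lemma minkowski_functional_scale:
  assumes "0 < c"
  shows "minkowski_functional M (c *\<^sub>R x) = ennreal c * minkowski_functional M x"
proof (rule antisym)
  have "minkowski_functional M ((1 / c) *\<^sub>R (c *\<^sub>R x)) \<le> ennreal (1 / c) * minkowski_functional M (c *\<^sub>R x)"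
    using assms by (intro minkowski_functional_scale_le) simp
  then have "minkowski_functional M x \<le> ennreal (1 / c) * minkowski_functional M (c *\<^sub>R x)"
    using assms by simp
  then have "ennreal c * minkowski_functional M x \<le> ennreal c * (ennreal (1 / c) * minkowski_functional M (c *\<^sub>R x))"
    by (rule mult_left_mono) simp
  then show "ennreal c * minkowski_functional M x \<le> minkowski_functional M (c *\<^sub>R x)"
    using assms by (simp add: mult.assoc[symmetric] ennreal_mult[symmetric])
qed (rule minkowski_functional_scale_le[OF assms])

lemma minkowski_functional_uminus:
  assumes "origin_symmetric M"
  shows "minkowski_functional M (- x) = minkowski_functional M x"
proof -
  have neg: "- y \<in> M" if "y \<in> M" for y
    using assms that unfolding origin_symmetric_def by blast
  have "- x \<in> (\<lambda>y. a *\<^sub>R y) ` M \<longleftrightarrow> x \<in> (\<lambda>y. a *\<^sub>R y) ` M" for a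
  proof
    assume "- x \<in> (\<lambda>y. a *\<^sub>R y) ` M"
    then obtain y where "y \<in> M" "- x = a *\<^sub>R y" by auto
    then show "x \<in> (\<lambda>y. a *\<^sub>R y) ` M"
      using neg by (intro image_eqI[of _ _ "- y"]) (auto simp: minus_equation_iff[of x])
  next
    assume "x \<in> (\<lambda>y. a *\<^sub>R y) ` M"
    then obtain y where "y \<in> M" "x = a *\<^sub>R y" by auto
    then show "- x \<in> (\<lambda>y. a *\<^sub>R y) ` M"
      using neg by (intro image_eqI[of _ _ "- y"]) auto
  qed
  then show ?thesis by (simp add: minkowski_functional_def)
qed

lemma minkowski_functional_lower_bound:
  assumes "M \<subseteq> cball 0 R" "R > 0"
  shows "ennreal (norm x / R) \<le> minkowski_functional M x"
proof (rule minkowski_functional_ge)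
  fix a assume a: "0 < a" "x \<in> (\<lambda>y. a *\<^sub>R y) ` M"
  then obtain y where "y \<in> M" "x = a *\<^sub>R y" by auto
  then have "norm x \<le> a * R" using assms a by (auto simp: subset_eq)
  then show "ennreal (norm x / R) \<le> ennreal a" using assms a by (intro ennreal_leI) (simp add: field_simps)
qed

text \<open>Star-shapedness makes the dilates of M increase with the factor. A strict sublevel set
  is therefore a union of dilates over rational factors only, a countable union of compact
  sets.\<close>

lemma minkowski_functional_measurable:
  fixes M :: "'a::euclidean_space set"
  assumes M: "star_body M"
  shows "minkowski_functional M \<in> borel_measurable borel"
proof (rule borel_measurableI_less)
  fix y :: ennreal
  have mono: "x \<in> (\<lambda>y. b *\<^sub>R y) ` M" if "x \<in> (\<lambda>y. a *\<^sub>R y) ` M" "0 < a" "a \<le> b" for x a b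
  proof -
    obtain z where z: "z \<in> M" "x = a *\<^sub>R z" using \<open>x \<in> _\<close> by auto
    have "(a / b) *\<^sub>R z \<in> closed_segment 0 z"
      using that by (auto simp: closed_segment_def intro!: exI[of _ "a / b"])
    then have "(a / b) *\<^sub>R z \<in> M" using M z by (auto simp: star_body_def)
    then show ?thesis using z that by (intro image_eqI[of _ _ "(a / b) *\<^sub>R z"]) auto
  qed
  have "{x. minkowski_functional M x < y} = (\<Union>q\<in>{q\<in>\<rat>. 0 < q \<and> ennreal q < y}. (\<lambda>z. q *\<^sub>R z) ` M)" (is "?L = ?R")
  proof (intro equalityI subsetI)
    fix x assume "x \<in> ?L"
    then obtain a where a: "0 < a" "x \<in> (\<lambda>y. a *\<^sub>R y) ` M" "ennreal a < y"
      by (auto simp: minkowski_functional_def Inf_less_iff)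
    obtain q where q: "q \<in> \<rat>" "a \<le> q" "ennreal q < y"
    proof -
      obtain b where b: "a < b" "ennreal b \<le> y"
      proof (cases y)
        case (real r)
        then show ?thesis using a that[of r] by (simp add: ennreal_less_iff)
      next
        case top
        then show ?thesis using that[of "a + 1"] by simp
      qed
      obtain q where "q \<in> \<rat>" "a < q" "q < b" using Rats_dense_in_real[OF b(1)] by auto
      then show ?thesis using a b that[of q]
        by (meson ennreal_lessI less_imp_le less_le_trans order_less_trans)
    qed
    then show "x \<in> ?R" using a mono[OF a(2) a(1) q(2)] by auto
  next
    fix x assume "x \<in> ?R"
    then obtain q where "0 < q" "ennreal q < y" "x \<in> (\<lambda>z. q *\<^sub>R z) ` M" by auto
    then show "x \<in> ?L" using minkowski_functional_le[of q x M] by auto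
  qed
  moreover have "?R \<in> sets borel"
  proof (intro sets.countable_UN'')
    show "countable {q\<in>\<rat>. 0 < q \<and> ennreal q < y}"
      by (rule countable_subset[OF _ countable_rat]) auto
    show "(\<lambda>z. q *\<^sub>R z) ` M \<in> sets borel" for q
      using M by (intro borel_compact compact_scaling) (auto simp: star_body_def)
  qed
  ultimately show "{x \<in> space borel. minkowski_functional M x < y} \<in> sets borel" by simp
qed


text \<open>A ball of radius R around M gives |x|_M \<ge> |x|/R, so A = R works and the inverse is
  finite off the origin. Rays that meet M only in 0 have functional \<infinity> and kernel value
  0.\<close>

lemma homogeneous_kernel_minkowski:
  fixes M :: "'a::euclidean_space set"
  assumes dim: "DIM('a) \<ge> 2" and M: "star_body M" "origin_symmetric M"
  obtains A where "homogeneous_kernel (\<lambda>x. enn2real (inverse (minkowski_functional M x))) A"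
    "\<And>x. x \<noteq> 0 \<Longrightarrow> inverse (minkowski_functional M x) < top"
proof -
  obtain R where R: "R > 0" "M \<subseteq> cball 0 R"
    using M(1) compact_imp_bounded[of M] unfolding star_body_def bounded_pos by (auto simp: subset_eq)
  let ?f = "\<lambda>x. enn2real (inverse (minkowski_functional M x))"
  have lb: "ennreal (norm x / R) \<le> minkowski_functional M x" for x
    by (rule minkowski_functional_lower_bound[OF R(2,1)])
  have ub: "inverse (minkowski_functional M x) \<le> ennreal (R / norm x)" if "x \<noteq> 0" for x
  proof (cases "minkowski_functional M x")
    case (real m)
    then have m: "norm x / R \<le> m" using lb[of x] by simp
    moreover have "norm x / R > 0" using that R(1) by simp
    ultimately have "m > 0" by linarith
    then have "inverse m \<le> R / norm x" using m that R(1) by (simp add: field_simps)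
    then show ?thesis using real \<open>m > 0\<close> by (simp add: inverse_ennreal ennreal_leI)
  qed simp
  \<comment> \<open>At the origin the inverse is \<infinity>, which \<open>enn2real\<close> maps to
    0. This agrees with R / 0 = 0, so the pointwise bound holds there too.\<close>
  have zero: "minkowski_functional M 0 = 0"
  proof (rule ccontr)
    assume "minkowski_functional M 0 \<noteq> 0"
    moreover have "minkowski_functional M (0::'a) \<le> 0"
    proof (rule ennreal_le_epsilon)
      show "minkowski_functional M (0::'a) \<le> 0 + ennreal e" if "e > 0" for e
        using M(1) that by (simp, intro minkowski_functional_le) (auto simp: star_body_def)
    qed
    ultimately show False by simp
  qed
  have sc: "?f (s *\<^sub>R x) = ?f x / \<bar>s\<bar>" if "s \<noteq> 0" for s x
  proof -
    have "minkowski_functional M (s *\<^sub>R x) = minkowski_functional M (\<bar>s\<bar> *\<^sub>R x)"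
      using minkowski_functional_uminus[OF M(2), of "s *\<^sub>R x"] by (cases "s > 0") auto
    also have "\<dots> = ennreal \<bar>s\<bar> * minkowski_functional M x"
      using that by (intro minkowski_functional_scale) simp
    finally have "inverse (minkowski_functional M (s *\<^sub>R x)) = inverse (ennreal \<bar>s\<bar>) * inverse (minkowski_functional M x)"
      using that by (simp add: ennreal_inverse_mult')
    then show ?thesis
      using that by (simp add: inverse_ennreal enn2real_mult inverse_eq_divide)
  qed
  have "homogeneous_kernel ?f R"
  proof
    show "DIM('a) \<ge> 2" by (rule dim)
    show "?f \<in> borel_measurable borel"
      using minkowski_functional_measurable[OF M(1)] by measurable
    show "?f x \<le> R / norm x" for x
    proof (cases "x = 0")
      case False
      then show ?thesis using ub[OF False] R(1) by (intro enn2real_leI) auto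
    qed (simp add: zero)
  qed (use R sc in auto)
  moreover have "inverse (minkowski_functional M x) < top" if "x \<noteq> 0" for x
    using ub[OF that] by (rule order_le_less_trans) simp
  ultimately show ?thesis by (rule that)
qed

theorem lemma3:
  fixes M K L :: "'a::euclidean_space set"
  assumes "DIM('a) \<ge> 2"
    and "star_body M" and "origin_symmetric M"
    and "positive_definite
           (function_distribution (\<lambda>x. enn2real (inverse (minkowski_functional M x))))"
    and "star_body K" and "origin_symmetric K"
    and "star_body L" and "origin_symmetric L"
    and "\<And>\<xi>. \<xi> \<in> sphere 0 1 \<Longrightarrow> section_volume K \<xi> \<le> section_volume L \<xi>"
  shows "(\<integral>\<^sup>+x\<in>K. inverse (minkowski_functional M x) \<partial>lborel)
       \<le> (\<integral>\<^sup>+x\<in>L. inverse (minkowski_functional M x) \<partial>lborel)"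
proof -
  define f where "f x = enn2real (inverse (minkowski_functional M x))" for x
  obtain A where "homogeneous_kernel f A" and fin: "\<And>x. x \<noteq> 0 \<Longrightarrow> inverse (minkowski_functional M x) < top"
    using homogeneous_kernel_minkowski[OF assms(1-3)] unfolding f_def by metis
  then interpret homogeneous_kernel f A by simp
  have K: "compact K" "K \<noteq> {}" and L: "compact L" "L \<noteq> {}"
    using assms(5,7) by (auto simp: star_body_def)
  \<comment> \<open>The extended-valued kernel and its real version differ at most at the origin, a
    null set, and the real one is integrable over compact sets. The claim can thus be proved for
    real integrals.\<close>
  have eq: "(\<integral>\<^sup>+x\<in>C. inverse (minkowski_functional M x) \<partial>lborel) = ennreal (LBINT x. indicator C x * f x)"
    if C: "compact C" for C
  proof -
    have [measurable]: "C \<in> sets borel" using C by (rule borel_compact)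
    obtain R where R: "C \<subseteq> cball 0 R"
      using compact_imp_bounded[OF C] unfolding bounded_iff by (auto simp: subset_eq)
    have "(\<integral>\<^sup>+x\<in>C. inverse (minkowski_functional M x) \<partial>lborel) = (\<integral>\<^sup>+x. ennreal (indicator C x * f x) \<partial>lborel)"
    proof (rule nn_integral_cong_AE)
      show "AE x in lborel. inverse (minkowski_functional M x) * indicator C x = ennreal (indicator C x * f x)"
        using AE_lborel_singleton[of "0::'a"] by eventually_elim (use fin in \<open>auto simp: f_def indicator_def\<close>)
    qed
    also have "\<dots> = ennreal (LBINT x. indicator C x * f x)"
    proof (rule nn_integral_eq_integral)
      show "integrable lborel (\<lambda>x. indicator C x * f x)"
        by (rule integrable_smooth_weight(2)[where R = R]) (use R in \<open>auto simp: indicator_def\<close>)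
    qed (simp add: f_nonneg)
    finally show ?thesis .
  qed
  have "(LBINT x. indicator K x * f x) \<le> (LBINT x. indicator L x * f x)"
  proof (rule integral_mono_of_cone_cos[OF _ K L])
    show "positive_definite (function_distribution f)"
      using assms(4) by (simp add: f_def[abs_def])
    show "cone_cos (indicator K) 0 \<xi> \<le> cone_cos (indicator L) 0 \<xi>" for \<xi>
      by (rule cone_cos_mono_sections[OF assms(1) K L assms(9)])
  qed
  then show ?thesis
    unfolding eq[OF K(1)] eq[OF L(1)] by (rule ennreal_leI)
qed

end
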